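(* Given $W_0\in\mathfrak{su}(N)$ and $1\le r\le N$, let $S_0\in\mathbb{C}^{r\times r}$ be the diagonal matrix of the $r$ eigenvalues of $W_0$ of largest modulus, let $U_0\in \mathrm{St}(r,\mathbb{C}^N)$ have as columns corresponding orthonormal eigenvectors, and let $Y_0=\Pi_r(W_0)=U_0S_0U_0^*$. The implicit midpoint rule applied to the reconstruction equation $\dot U+\hbar_N^{-1}P(US_0U^* )U=0$ in $(t_\tau,t_{\tau+1}]$, namely $$U_{\tau+1}-U_\tau=-\hbar_N^{-1}\Delta t\,P(\widetilde US_0\widetilde U^* )\widetilde U,\qquad \widetilde U=\frac{U_{\tau+1}+U_\tau}{2},\qquad \tau\ge 0,$$ descends to an isospectral Lie--Poisson integrator for the Zeitlin model $\dot Y+[P(Y),Y]_N=0$ with initial condition $Y_0$. In particular, the numerical scheme $$Y_\tau=U_\tau S_0U_\tau^*\longmapsto Y_{\tau+1}=U_{\tau+1}S_0U_{\tau+1}^*,\qquad \tau\ge0,$$ coincides with the second order isospectral Lie--Poisson integrator of Modin and Viviani defined by $$Y_\tau=\Bigl(I+\tfrac{\Delta t}{2\hbar_N}P(\widetilde Y)\Bigr)\widetilde Y\Bigl(I-\tfrac{\Delta t}{2\hbar_N}P(\widetilde Y)\Bigr),\qquad Y_{\tau+1}=\Bigl(I-\tfrac{\Delta t}{2\hbar_N}P(\widetilde Y)\Bigr)\widetilde Y\Bigl(I+\tfrac{\Delta t}{2\hbar_N}P(\widetilde Y)\Bigr).$$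
   Context: Let $N\ge 2$, $\hbar_N=2/\sqrt{N^2-1}$ and $[A,B]_N=\hbar_N^{-1}(AB-BA)$. $\mathfrak{u}(N)$ denotes the skew-Hermitian $N\times N$ matrices, $\mathfrak{su}(N)$ the traceless ones, and $\mathrm{St}(r,\mathbb{C}^N)=\{U\in\mathbb{C}^{N\times r}:U^*U=I_r\}$. $\Pi_r(W)$ is the best rank-$r$ approximation of $W$. Put $s=(N-1)/2$ and, for $0\le\ell\le N-1$, $-\ell\le m\le\ell$, let $T^N_{\ell,m}\in\mathbb{C}^{N\times N}$ (rows and columns indexed by $m_1,m_2\in\{-s,\dots,s\}$) be $$(T^N_{\ell,m})_{m_1,m_2}=\sqrt{\tfrac{N}{4\pi}}\,(-1)^{s-m_1}\sqrt{2\ell+1}\begin{pmatrix}s&\ell&s\\-m_1&m&m_2\end{pmatrix}$$ (Wigner 3j-symbol), a basis of $\mathbb{C}^{N\times N}$. The discrete Laplacian $\Delta_N$ is the linear map with $\Delta_NT^N_{\ell,m}=-\ell(\ell+1)T^N_{\ell,m}$; it preserves $\mathfrak{u}(N)$ and its kernel consists of multiples of the identity. $\Delta_N^{-1}$ is its inverse on traceless matrices, extended linearly by $\Delta_N^{-1}I=0$, and $P(X)=\Delta_N^{-1}X$. An integrator $Y_\tau\mapsto Y_{\tau+1}$ is isospectral if $Y_{\tau+1}$ has the same spectrum as $Y_\tau$ (here: stays in $\{RY_0R^*:R\in \mathrm{U}(N)\}$), and Lie--Poisson if the one-step map preserves the Lie--Poisson bracket on the dual of $\mathfrak{u}(N)$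 (identified with $\mathfrak{u}(N)$ via the Frobenius inner product). That the Modin--Viviani scheme displayed in the claim is a second order isospectral Lie--Poisson integrator is a known result. In both schemes the implicit equations are understood as solved exactly (with the solution near $U_\tau$, respectively $Y_\tau$, which exists for small $\Delta t$), and the scheme for $U$ is started at $U_0$. *)

theory Defs
  imports "HOL-Analysis.Analysis"
begin

section \<open>Complex matrices\<close>

type_synonym 'n cmatrix = "((complex, 'n) vec, 'n) vec"

type_synonym ('r, 'n) cframe = "((complex, 'r) vec, 'n) vec"

definition ctranspose :: "complex^'n^'m \<Rightarrow> complex^'m^'n" where
  "ctranspose A = (\<chi> i j. cnj (A $ j $ i))"

definition cscale :: "complex \<Rightarrow> complex^'n^'m \<Rightarrow> complex^'n^'m" where
  "cscale c A = (\<chi> i j. c * A $ i $ j)"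

definition diagonal_matrix :: "('n \<Rightarrow> complex) \<Rightarrow> complex^'n^'n" where
  "diagonal_matrix d = (\<chi> i j. if i = j then d i else 0)"

definition skew_hermitian :: "(complex^'n^'n) set" where
  "skew_hermitian = {A. ctranspose A = - A}"

definition traceless_skew_hermitian :: "(complex^'n^'n) set" where
  "traceless_skew_hermitian = {A \<in> skew_hermitian. trace A = 0}"

definition unitary_matrices :: "(complex^'n^'n) set" where
  "unitary_matrices = {R. ctranspose R ** R = mat 1}"

text \<open>The number of columns of the Stiefel manifold is the cardinality of the type \<open>'r\<close>.\<close>

definition stiefel :: "(complex^'r^'n) set" where
  "stiefel = {U. ctranspose U ** U = mat 1}"

definition unitary_orbit :: "complex^'n^'n \<Rightarrow> (complex^'n^'n) set" where
  "unitary_orbit Y = {R ** Y ** ctranspose R | R. R \<in> unitary_matrices}"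


section \<open>Low-rank truncation\<close>

text \<open>
  The norm on \<open>complex^'n^'n\<close> is the Frobenius norm.  With ties among the moduli of the
  eigenvalues a best approximation need not be unique, hence a predicate.
\<close>

definition is_best_rank_approximation :: "nat \<Rightarrow> complex^'n^'n \<Rightarrow> complex^'n^'n \<Rightarrow> bool" where
  "is_best_rank_approximation r W X \<longleftrightarrow>
     rank X \<le> r \<and> (\<forall>Z. rank Z \<le> r \<longrightarrow> norm (W - X) \<le> norm (W - Z))"

text \<open>
  \<open>V\<close> is an orthonormal eigenbasis of \<open>W\<close>, so \<open>d\<close> lists the eigenvalues of \<open>W\<close> with
  multiplicity; \<open>e\<close> selects \<open>CARD('r)\<close> of them of largest modulus (ties are broken arbitrarily).
\<close>

definition leading_eigendata :: "complex^'n^'n \<Rightarrow> complex^'r^'r \<Rightarrow> complex^'r^'n \<Rightarrow> bool" where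
  "leading_eigendata W S U \<longleftrightarrow>
     (\<exists>V d (e :: 'r \<Rightarrow> 'n).
        V \<in> unitary_matrices \<and> W ** V = V ** diagonal_matrix d \<and>
        inj e \<and> (\<forall>k j. j \<notin> range e \<longrightarrow> cmod (d j) \<le> cmod (d (e k))) \<and>
        S = diagonal_matrix (\<lambda>k. d (e k)) \<and>
        U = (\<chi> i k. V $ i $ e k))"


section \<open>Wigner 3j-symbols and the discrete Laplacian\<close>

text \<open>
  Racah's formula.  The arguments are integers or half-integers; every factorial below is taken
  of a nonnegative integer whenever the guard holds and \<open>t\<close> lies in the summation range.
\<close>

definition rfact :: "real \<Rightarrow> real" where
  "rfact x = fact (nat \<lfloor>x\<rfloor>)"

definition racah_range :: "real \<Rightarrow> real \<Rightarrow> real \<Rightarrow> real \<Rightarrow> real \<Rightarrow> nat set" where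
  "racah_range j1 j2 j3 m1 m2 =
     {t. 0 \<le> j3 - j2 + real t + m1 \<and> 0 \<le> j3 - j1 + real t - m2 \<and>
         0 \<le> j1 + j2 - j3 - real t \<and> 0 \<le> j1 - real t - m1 \<and> 0 \<le> j2 - real t + m2}"

definition wigner3j :: "real \<Rightarrow> real \<Rightarrow> real \<Rightarrow> real \<Rightarrow> real \<Rightarrow> real \<Rightarrow> real" where
  "wigner3j j1 j2 j3 m1 m2 m3 =
     (if m1 + m2 + m3 = 0 \<and> \<bar>m1\<bar> \<le> j1 \<and> \<bar>m2\<bar> \<le> j2 \<and> \<bar>m3\<bar> \<le> j3 \<and>
         \<bar>j1 - j2\<bar> \<le> j3 \<and> j3 \<le> j1 + j2 \<and>
         j1 + j2 + j3 \<in> \<int> \<and> j1 - m1 \<in> \<int> \<and> j2 - m2 \<in> \<int> \<and> j3 - m3 \<in> \<int>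
      then (-1) powi \<lfloor>j1 - j2 - m3\<rfloor>
         * sqrt (rfact (j1 + j2 - j3) * rfact (j1 - j2 + j3) * rfact (- j1 + j2 + j3)
                 / rfact (j1 + j2 + j3 + 1))
         * sqrt (rfact (j1 + m1) * rfact (j1 - m1) * rfact (j2 + m2) * rfact (j2 - m2)
                 * rfact (j3 + m3) * rfact (j3 - m3))
         * (\<Sum>t\<in>racah_range j1 j2 j3 m1 m2.
              (-1) ^ t / (fact t * rfact (j3 - j2 + real t + m1) * rfact (j3 - j1 + real t - m2)
                          * rfact (j1 + j2 - j3 - real t) * rfact (j1 - real t - m1)
                          * rfact (j2 - real t + m2)))
      else 0)"

definition spin :: "nat \<Rightarrow> real" where
  "spin N = (real N - 1) / 2"

text \<open>
  The linear order on the finite type \<open>'n\<close> labels its \<open>N\<close> elements, in increasing order, by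
  \<open>-s, -s + 1, \<dots>, s\<close>.
\<close>

definition magnetic :: "'n::{finite,linorder} \<Rightarrow> real" where
  "magnetic i = real (card {j. j < i}) - spin CARD('n)"

definition T_basis :: "nat \<Rightarrow> int \<Rightarrow> 'n::{finite,linorder} cmatrix" where
  "T_basis l m = (\<chi> i j.
     let s = spin CARD('n); m1 = magnetic i; m2 = magnetic j in
     complex_of_real
       (sqrt (real CARD('n) / (4 * pi)) * (-1) powi \<lfloor>s - m1\<rfloor> * sqrt (2 * real l + 1)
        * wigner3j s (real l) s (- m1) (real_of_int m) m2))"

definition discrete_laplacian ::
    "'n::{finite,linorder} cmatrix \<Rightarrow> 'n cmatrix" where
  "discrete_laplacian =
     (THE L. Vector_Spaces.linear cscale cscale L \<and>
        (\<forall>l m. l < CARD('n) \<and> \<bar>m\<bar> \<le> int l \<longrightarrow>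
           L (T_basis l m) = cscale (- (of_nat l * (of_nat l + 1))) (T_basis l m)))"

text \<open>
  The stream matrix \<open>P(X)\<close>: the inverse Laplacian on traceless matrices, extended linearly by \<open>0\<close> on the identity;
  the traceless part of \<open>X\<close> is \<open>X - (trace X / N) I\<close>.
\<close>

definition stream_matrix :: "'n::{finite,linorder} cmatrix \<Rightarrow> 'n cmatrix" where
  "stream_matrix X = the_inv_into {A. trace A = 0} discrete_laplacian
                (X - cscale (trace X / of_nat CARD('n)) (mat 1))"


section \<open>The Zeitlin model and its Lie--Poisson structure\<close>

definition hbar :: "nat \<Rightarrow> real" where
  "hbar N = 2 / sqrt (real N ^ 2 - 1)"

definition bracketN :: "complex^'n^'n \<Rightarrow> complex^'n^'n \<Rightarrow> complex^'n^'n" where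
  "bracketN A B = (1 / hbar CARD('n)) *\<^sub>R (A ** B - B ** A)"

definition zeitlin_solution :: "real \<Rightarrow> (real \<Rightarrow> 'n::{finite,linorder} cmatrix) \<Rightarrow> bool" where
  "zeitlin_solution T y \<longleftrightarrow>
     (\<forall>t\<in>{0..T}. (y has_vector_derivative - bracketN (stream_matrix (y t)) (y t)) (at t within {0..T}))"

text \<open>
  The dual of the Lie algebra of skew-Hermitian matrices is identified with that algebra by the
  Frobenius inner product, which is \<open>inner\<close> on \<open>complex^'n^'n\<close> (it equals \<open>Re (trace (A\<^sup>* B))\<close>).
  Observables are functions on matrices of which only the restriction to the skew-Hermitian
  ones matters; the differential of an observable is thus represented by a skew-Hermitian matrix.
\<close>

definition lp_gradient :: "(complex^'n^'n \<Rightarrow> real) \<Rightarrow> complex^'n^'n \<Rightarrow> complex^'n^'n" where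
  "lp_gradient F Y =
     (THE A. A \<in> skew_hermitian \<and>
             (F has_derivative (\<lambda>V. A \<bullet> V)) (at Y within skew_hermitian))"

definition lp_bracket ::
    "(complex^'n^'n \<Rightarrow> real) \<Rightarrow> (complex^'n^'n \<Rightarrow> real) \<Rightarrow> complex^'n^'n \<Rightarrow> real" where
  "lp_bracket F G Y = Y \<bullet> bracketN (lp_gradient F Y) (lp_gradient G Y)"

text \<open>\<open>D\<close> is meant to be relatively open in the space of skew-Hermitian matrices.\<close>

definition lie_poisson_on :: "(complex^'n^'n) set \<Rightarrow> (complex^'n^'n \<Rightarrow> complex^'n^'n) \<Rightarrow> bool" where
  "lie_poisson_on D \<phi> \<longleftrightarrow>
     (\<forall>Y\<in>D. \<phi> Y \<in> skew_hermitian \<and> \<phi> differentiable (at Y within skew_hermitian) \<and>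
        (\<forall>F G. F differentiable_on skew_hermitian \<and> G differentiable_on skew_hermitian \<longrightarrow>
           lp_bracket (F \<circ> \<phi>) (G \<circ> \<phi>) Y = lp_bracket F G (\<phi> Y)))"

definition isospectral_on :: "(complex^'n^'n) set \<Rightarrow> (complex^'n^'n \<Rightarrow> complex^'n^'n) \<Rightarrow> bool" where
  "isospectral_on D \<phi> \<longleftrightarrow> (\<forall>Y\<in>D. \<phi> Y \<in> unitary_orbit Y)"

text \<open>Order \<open>p\<close>: the local error is \<open>O(h\<^bsup>p+1\<^esup>)\<close>, uniformly for initial values in \<open>D\<close>.\<close>

definition zeitlin_order_on ::
    "nat \<Rightarrow> ('n::{finite,linorder} cmatrix) set
       \<Rightarrow> (real \<Rightarrow> 'n cmatrix \<Rightarrow> 'n cmatrix) \<Rightarrow> bool" where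
  "zeitlin_order_on p D \<Phi> \<longleftrightarrow>
     (\<exists>h0>0. \<exists>C. \<forall>h y. 0 < h \<and> h < h0 \<and> zeitlin_solution h y \<and> y 0 \<in> D \<longrightarrow>
        norm (\<Phi> h (y 0) - y h) \<le> C * h ^ (p + 1))"


section \<open>The two schemes\<close>

text \<open>
  In both schemes \<open>\<delta>\<close> singles out the solution of the implicit equation near the current value.
\<close>

definition implicit_midpoint_rule ::
    "('a::real_normed_vector \<Rightarrow> 'a) \<Rightarrow> real \<Rightarrow> 'a \<Rightarrow> 'a \<Rightarrow> bool" where
  "implicit_midpoint_rule f h u u' \<longleftrightarrow> u' - u = h *\<^sub>R f ((1/2) *\<^sub>R (u' + u))"

definition reconstruction_field ::
    "complex^'r^'r \<Rightarrow> ('r, 'n::{finite,linorder}) cframe \<Rightarrow> ('r, 'n) cframe" where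
  "reconstruction_field S U =
     - ((1 / hbar CARD('n)) *\<^sub>R (stream_matrix (U ** S ** ctranspose U) ** U))"

definition midpoint_near ::
    "real \<Rightarrow> complex^'r^'r \<Rightarrow> real \<Rightarrow> ('r, 'n::{finite,linorder}) cframe \<Rightarrow> ('r, 'n) cframe \<Rightarrow> bool" where
  "midpoint_near \<delta> S h U U' \<longleftrightarrow>
     dist U' U < \<delta> \<and> implicit_midpoint_rule (reconstruction_field S) h U U'"

definition midpoint_step ::
    "real \<Rightarrow> complex^'r^'r \<Rightarrow> real \<Rightarrow> ('r, 'n::{finite,linorder}) cframe \<Rightarrow> ('r, 'n) cframe" where
  "midpoint_step \<delta> S h U = (THE U'. midpoint_near \<delta> S h U U')"

definition mv_conj :: "real \<Rightarrow> 'n::{finite,linorder} cmatrix \<Rightarrow> 'n cmatrix" where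
  "mv_conj a Y = (mat 1 + a *\<^sub>R stream_matrix Y) ** Y ** (mat 1 - a *\<^sub>R stream_matrix Y)"

definition mv_near ::
    "real \<Rightarrow> real \<Rightarrow> 'n::{finite,linorder} cmatrix \<Rightarrow> 'n cmatrix \<Rightarrow> bool" where
  "mv_near \<delta> h Y Yt \<longleftrightarrow> dist Yt Y < \<delta> \<and> Y = mv_conj (h / (2 * hbar CARD('n))) Yt"

definition mv_step ::
    "real \<Rightarrow> real \<Rightarrow> 'n::{finite,linorder} cmatrix \<Rightarrow> 'n cmatrix" where
  "mv_step \<delta> h Y = mv_conj (- (h / (2 * hbar CARD('n)))) (THE Yt. mv_near \<delta> h Y Yt)"

text \<open>
  The map \<open>\<Psi>\<close> on frames induces \<open>\<phi>\<close> on the matrices \<open>U S U\<^sup>*\<close>; in particular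
  \<open>\<Psi> U S (\<Psi> U)\<^sup>*\<close> depends on \<open>U\<close> only through \<open>U S U\<^sup>*\<close>.
\<close>

definition descends_to ::
    "complex^'r^'r \<Rightarrow> (complex^'r^'n \<Rightarrow> complex^'r^'n) \<Rightarrow> (complex^'n^'n \<Rightarrow> complex^'n^'n) \<Rightarrow> bool" where
  "descends_to S \<Psi> \<phi> \<longleftrightarrow>
     (\<forall>U\<in>stiefel. \<Psi> U \<in> stiefel \<and>
        \<phi> (U ** S ** ctranspose U) = \<Psi> U ** S ** ctranspose (\<Psi> U))"

end

theory Submission
  imports Defs
begin

text \<open>
  \<^bold>\<open>Why the schemes coincide.\<close>  Write \<open>a = h / (2 hbar N)\<close>, let \<open>m\<close> be the midpoint of a step of the
  implicit midpoint rule on frames, \<open>Z = m S m\<^sup>*\<close> and \<open>K = a P(Z)\<close>.  The rule then says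
  \<open>U = (I + K) m\<close> and \<open>U' = (I - K) m\<close>.  As \<open>K\<close> is skew-Hermitian, conjugating \<open>S\<close> gives
  \<open>U S U\<^sup>* = (I + K) Z (I - K)\<close> and \<open>U' S U'\<^sup>* = (I - K) Z (I + K)\<close>, the two equations of
  Modin and Viviani (\<open>midpoint_frames\<close>).  Both implicit equations are perturbations of the
  identity of size \<open>O(h)\<close>, so the contraction principle makes the solution near the current value
  unique (\<open>small_perturbation_unique_solution\<close>), and \<open>Z\<close> is that solution.

  \<^bold>\<open>Isospectrality.\<close>  The step maps \<open>(I + K) Z (I - K)\<close> to \<open>(I - K) Z (I + K)\<close>, which is conjugation
  with the Cayley transform \<open>(I - K) (I + K)\<^sup>-\<^sup>1\<close>, a unitary matrix.

  \<^bold>\<open>Lie--Poisson property.\<close>  The step is \<open>C\<^sub>- \<circ> C\<^sub>+\<^sup>-\<^sup>1\<close> with \<open>C\<^sub>\<plusminus>(Z) = (I \<plusminus> K) Z (I \<minusplus> K)\<close>.  A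
  gradient \<open>A\<close> after the step and its pullback \<open>\<alpha>\<close> before the step satisfy
  \<open>C\<^sub>+'(Z)\<^sup>T \<alpha> = C\<^sub>-'(Z)\<^sup>T A\<close> (\<open>pullback_condition\<close>).  For two such pairs the equality of
  brackets \<open>\<langle>C\<^sub>+(Z), [\<alpha>, \<beta>]\<rangle> = \<langle>C\<^sub>-(Z), [A, B]\<rangle>\<close> is an algebraic identity whose defect is
  \<open>tr (P(E) F) - tr (E P(F))\<close> for matrices \<open>E\<close> and \<open>F\<close> built from the two pairs
  (\<open>cayley_trace_identity\<close>); it vanishes because \<open>P\<close> is self-adjoint.

  \<^bold>\<open>Order.\<close>  Up to the quadratic term \<open>a\<^sup>2 P(Z) Z P(Z)\<close>, \<open>Z\<close> solves the implicit Euler equation with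
  half the step size, and the whole step adds \<open>h\<close> times the vector field at \<open>Z\<close> exactly.
  A second order Taylor expansion of the flow settles the rest (\<open>midpoint_local_error\<close>).

  \<^bold>\<open>The stream matrix.\<close>  All of this uses of \<open>P\<close> only that it is linear, commutes with the conjugate
  transpose and is self-adjoint for the trace form.  These properties rest on the fact that the
  matrices \<open>T\<^sub>l\<^sub>m\<close> form a basis.  Racah's sum satisfies a ladder relation and is symmetric
  up to sign under exchange of rows and columns.  This says that commutators with the spin
  matrices \<open>S\<^sub>\<plusminus>\<close> raise and lower the index \<open>m\<close>; commutators with \<open>S\<^sub>z\<close> multiply by it.  Hence
  \<open>T\<^sub>l\<^sub>m\<close> is an eigenvector of the self-adjoint Casimir operator
  \<open>X \<mapsto> ([S\<^sub>+, [S\<^sub>-, X]] + [S\<^sub>-, [S\<^sub>+, X]]) / 2 + [S\<^sub>z, [S\<^sub>z, X]]\<close> for the eigenvalue \<open>l (l + 1)\<close>; distinct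
  labels give orthogonal matrices, and there are \<open>N\<^sup>2\<close> of them.  The discrete Laplacian is
  therefore minus the Casimir operator (\<open>discrete_laplacian_casimir\<close>), a sum of double
  commutators from which the required properties can be read off.

  \<^bold>\<open>Best approximation.\<close>  In an orthonormal eigenbasis the matrix is diagonal.  The rows of a matrix of
  rank at most \<open>r\<close> lie in the span of \<open>r\<close> orthonormal vectors, and Bessel's inequality bounds
  the part of the diagonal matrix that such a span can capture by the sum of the \<open>r\<close> largest squared moduli
  (\<open>diagonal_low_rank_distance\<close>).
\<close>

section \<open>Complex matrices and the Frobenius inner product\<close>

lemma bilinear_matrix_mult:
  "bilinear ((**) :: complex^'b::finite^'a::finite \<Rightarrow> complex^'c::finite^'b \<Rightarrow> complex^'c^'a)"
  unfolding bilinear_def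
  by (auto intro!: linearI simp: matrix_matrix_mult_def vec_eq_iff sum.distrib scaleR_sum_right
      algebra_simps)

interpretation mm: bounded_bilinear
  "((**) :: complex^'b::finite^'a::finite \<Rightarrow> complex^'c::finite^'b \<Rightarrow> complex^'c^'a)"
  using bilinear_matrix_mult by (simp add: bilinear_conv_bounded_bilinear)

lemmas matrix_ring_simps = mm.add_left mm.add_right mm.diff_left mm.diff_right mm.minus_left
  mm.minus_right mm.scaleR_left mm.scaleR_right mm.zero_left mm.zero_right

lemma ctranspose_ctranspose [simp]: "ctranspose (ctranspose A) = A"
  by (simp add: ctranspose_def vec_eq_iff)

lemma ctranspose_mult: "ctranspose (A ** B) = ctranspose B ** ctranspose A"
  by (simp add: ctranspose_def vec_eq_iff matrix_matrix_mult_def mult.commute)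

lemma linear_ctranspose: "linear (ctranspose :: complex^'b::finite^'a::finite \<Rightarrow> _)"
  by (auto intro!: linearI simp: ctranspose_def vec_eq_iff)

lemma bounded_linear_ctranspose: "bounded_linear (ctranspose :: complex^'b::finite^'a::finite \<Rightarrow> _)"
  using linear_ctranspose linear_conv_bounded_linear by blast

lemma ctranspose_simps [simp]:
  "ctranspose (A + B) = ctranspose A + ctranspose B"
  "ctranspose (A - B) = ctranspose A - ctranspose B"
  "ctranspose (- A) = - ctranspose A"
  "ctranspose (c *\<^sub>R A) = c *\<^sub>R ctranspose A"
  "ctranspose (mat 1 :: complex^'b::finite^'b) = mat 1"
  "ctranspose (0 :: complex^'b::finite^'a::finite) = 0"
  by (auto simp: ctranspose_def vec_eq_iff mat_def)

lemma inner_eq_trace: "X \<bullet> Y = Re (trace (ctranspose X ** Y))"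
  for X Y :: "complex^'b::finite^'a::finite"
proof -
  have "X \<bullet> Y = (\<Sum>i\<in>UNIV. \<Sum>j\<in>UNIV. Re (cnj (X $ i $ j) * Y $ i $ j))"
    by (simp add: inner_vec_def inner_complex_def)
  also have "\<dots> = Re (trace (ctranspose X ** Y))"
    by (simp add: trace_def matrix_matrix_mult_def ctranspose_def) (rule sum.swap)
  finally show ?thesis .
qed

lemma norm_ctranspose [simp]: "norm (ctranspose X) = norm X" for X :: "complex^'b::finite^'a::finite"
  by (simp add: norm_eq_sqrt_inner inner_eq_trace trace_mul_sym[of X])

lemma trace_linear_simps:
  fixes X Y :: "complex^'a::finite^'a"
  shows "trace (c *\<^sub>R X) = c *\<^sub>R trace X" and "trace (- X) = - trace X"
    and "trace (0 :: complex^'a^'a) = 0"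
  by (auto simp: trace_def scaleR_sum_right sum_negf)

lemma trace_ctranspose: "trace (ctranspose X) = cnj (trace X)"
  by (simp add: trace_def ctranspose_def)

lemma skewD: "X \<in> skew_hermitian \<Longrightarrow> ctranspose X = - X"
  by (simp add: skew_hermitian_def)

lemma skewI: "ctranspose X = - X \<Longrightarrow> X \<in> skew_hermitian"
  by (simp add: skew_hermitian_def)

lemma subspace_skew_hermitian: "subspace (skew_hermitian :: (complex^'a::finite^'a) set)"
  by (auto simp: subspace_def skew_hermitian_def)

lemma inner_skew_left: "X \<in> skew_hermitian \<Longrightarrow> X \<bullet> Y = - Re (trace (X ** Y))"
  for X Y :: "complex^'a::finite^'a"
  by (simp add: inner_eq_trace skewD mm.minus_left trace_linear_simps)

text \<open>
  This keeps the iterates in every ball that contains the initial value: the norm of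
  \<open>U S U\<^sup>*\<close> does not depend on the frame \<open>U\<close>.
\<close>

lemma norm_frame_conj:
  fixes U :: "complex^'r::finite^'n::finite" and S :: "complex^'r^'r"
  assumes "U \<in> stiefel"
  shows "norm (U ** S ** ctranspose U) = norm S"
proof -
  have U: "ctranspose U ** U = mat 1" using assms by (simp add: stiefel_def)
  have "trace (ctranspose (U ** S ** ctranspose U) ** (U ** S ** ctranspose U))
      = trace (U ** ctranspose S ** (ctranspose U ** U) ** S ** ctranspose U)"
    by (simp add: ctranspose_mult matrix_mul_assoc)
  also have "\<dots> = trace (U ** (ctranspose S ** S ** ctranspose U))"
    by (simp add: U matrix_mul_assoc)
  also have "\<dots> = trace (ctranspose S ** S ** ctranspose U ** U)"
    by (rule trace_mul_sym)
  also have "\<dots> = trace (ctranspose S ** S ** (ctranspose U ** U))"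
    by (simp only: matrix_mul_assoc)
  finally show ?thesis by (simp add: norm_eq_sqrt_inner inner_eq_trace U)
qed

lemma norm_stiefel:
  fixes U :: "complex^'r::finite^'n::finite"
  assumes "U \<in> stiefel" shows "norm U = sqrt (real CARD('r))"
  using assms by (simp add: norm_eq_sqrt_inner inner_eq_trace stiefel_def trace_I)

lemma frame_conj_skew:
  "S \<in> skew_hermitian \<Longrightarrow> U ** S ** ctranspose U \<in> skew_hermitian"
  by (simp add: skew_hermitian_def ctranspose_mult matrix_mul_assoc matrix_ring_simps)


section \<open>Best low-rank approximation of a normal matrix\<close>

text \<open>
  The inner product \<open>\<bullet>\<close> on complex vectors is only real bilinear, which does not suffice for
  projections onto complex subspaces.
\<close>

definition hinner :: "complex^'n::finite \<Rightarrow> complex^'n \<Rightarrow> complex" where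
  "hinner x y = (\<Sum>j\<in>UNIV. x $ j * cnj (y $ j))"

lemma hinner_simps:
  "hinner (x + y) z = hinner x z + hinner y z"
  "hinner (x - y) z = hinner x z - hinner y z"
  "hinner z (x + y) = hinner z x + hinner z y"
  "hinner z (x - y) = hinner z x - hinner z y"
  "hinner (c *s x) z = c * hinner x z"
  "hinner z (c *s x) = cnj c * hinner z x"
  "hinner 0 z = 0" "hinner z 0 = 0"
  by (simp_all add: hinner_def algebra_simps sum.distrib sum_subtractf sum_distrib_left)

lemma hinner_sum_left: "hinner (\<Sum>i\<in>A. f i) z = (\<Sum>i\<in>A. hinner (f i) z)"
  by (induction A rule: infinite_finite_induct) (simp_all add: hinner_simps)

lemma hinner_sum_right: "hinner z (\<Sum>i\<in>A. f i) = (\<Sum>i\<in>A. hinner z (f i))"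
  by (induction A rule: infinite_finite_induct) (simp_all add: hinner_simps)

lemma hinner_commute: "hinner y x = cnj (hinner x y)"
  by (simp add: hinner_def mult.commute)

lemma hinner_self: "hinner x x = of_real ((norm x)\<^sup>2)"
proof -
  have "hinner x x = (\<Sum>j\<in>UNIV. of_real ((cmod (x $ j))\<^sup>2))"
    unfolding hinner_def by (intro sum.cong refl) (simp only: complex_norm_square)
  then show ?thesis by (simp add: norm_vec_def L2_set_def sum_nonneg)
qed

definition orthonormal :: "(complex^'n::finite) set \<Rightarrow> bool" where
  "orthonormal Q \<longleftrightarrow> (\<forall>p\<in>Q. \<forall>q\<in>Q. hinner p q = (if p = q then 1 else 0))"

text \<open>
  Gram--Schmidt, one vector at a time: subtract the projection of \<open>b\<close> and normalise what is
  left, unless nothing is left.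
\<close>

lemma orthonormal_spanning:
  "finite B \<Longrightarrow> \<exists>Q. finite Q \<and> card Q \<le> card B \<and> orthonormal Q \<and> B \<subseteq> vec.span (Q :: (complex^'n::finite) set)"
proof (induction B rule: finite_induct)
  case empty
  then show ?case by (intro exI[of _ "{}"]) (simp add: orthonormal_def)
next
  case (insert b B)
  then obtain Q where Q: "finite Q" "card Q \<le> card B" "orthonormal Q" "B \<subseteq> vec.span Q" by blast
  define p where "p = (\<Sum>q\<in>Q. hinner b q *s q)"
  define c where "c = b - p"
  have p: "p \<in> vec.span Q" unfolding p_def
    by (intro vec.span_sum vec.span_scale vec.span_base)
  have c_orth: "hinner c q = 0" if "q \<in> Q" for q
  proof -
    have "hinner p q = (\<Sum>r\<in>Q. if r = q then hinner b q else 0)"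
      unfolding p_def hinner_sum_left hinner_simps
      by (intro sum.cong) (use that Q in \<open>auto simp: orthonormal_def\<close>)
    then show ?thesis using that Q by (simp add: c_def hinner_simps)
  qed
  show ?case
  proof (cases "c = 0")
    case True
    then have "b \<in> vec.span Q" using p by (simp add: c_def)
    then show ?thesis using Q insert by (intro exI[of _ Q]) auto
  next
    case False
    define u where "u = of_real (1 / norm c) *s c"
    have cu: "c = of_real (norm c) *s u" using False by (simp add: u_def)
    have "hinner u u = 1" using False unfolding u_def hinner_simps hinner_self[of c]
      by (simp add: power2_eq_square)
    moreover have "hinner u q = 0" "hinner q u = 0" if "q \<in> Q" for q
      using c_orth[OF that] hinner_commute[of q c] by (simp_all add: u_def hinner_simps)
    ultimately have on: "orthonormal (insert u Q)" using Q(3) by (auto simp: orthonormal_def)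
    have "u \<in> vec.span (insert u Q)" by (simp add: vec.span_base)
    then have "c \<in> vec.span (insert u Q)" by (subst cu) (rule vec.span_scale)
    moreover have sub: "vec.span Q \<subseteq> vec.span (insert u Q)" by (intro vec.span_mono) auto
    ultimately have "c + p \<in> vec.span (insert u Q)" using p by (intro vec.span_add) auto
    then have "b \<in> vec.span (insert u Q)" by (simp add: c_def)
    moreover have "card (insert u Q) \<le> card (insert b B)"
      using Q insert card_insert_le_m1[of _ Q] by (simp add: card_insert_if)
    ultimately show ?thesis using Q on sub by (intro exI[of _ "insert u Q"]) auto
  qed
qed

text \<open>
  Completing the square.  Best approximation and Bessel's inequality both follow.
\<close>

lemma orthonormal_distance:
  assumes "finite Q" "orthonormal Q"
  shows "(norm (w - (\<Sum>q\<in>Q. c q *s q)))\<^sup>2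
    = (norm w)\<^sup>2 + (\<Sum>q\<in>Q. (cmod (c q - hinner w q))\<^sup>2 - (cmod (hinner w q))\<^sup>2)"
proof -
  let ?z = "\<Sum>q\<in>Q. c q *s q"
  have zq: "hinner ?z q = c q" if "q \<in> Q" for q
  proof -
    have "hinner ?z q = (\<Sum>r\<in>Q. if r = q then c q else 0)"
      unfolding hinner_sum_left hinner_simps
      by (intro sum.cong) (use that assms in \<open>auto simp: orthonormal_def\<close>)
    then show ?thesis using that assms by simp
  qed
  have wz: "hinner w ?z = (\<Sum>q\<in>Q. cnj (c q) * hinner w q)"
    by (simp add: hinner_sum_right hinner_simps)
  have zz: "hinner ?z ?z = (\<Sum>q\<in>Q. cnj (c q) * c q)"
    unfolding hinner_sum_right hinner_simps by (intro sum.cong) (simp_all add: zq)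
  have "of_real ((norm (w - ?z))\<^sup>2) = hinner w w - hinner w ?z - cnj (hinner w ?z) + hinner ?z ?z"
    unfolding hinner_self[symmetric] hinner_commute[of ?z w, symmetric]
    by (simp add: hinner_simps)
  also have "\<dots> = hinner w w + (\<Sum>q\<in>Q. cnj (c q) * c q - cnj (c q) * hinner w q - c q * cnj (hinner w q))"
    unfolding wz zz by (simp add: sum.distrib sum_subtractf)
  also have "(\<Sum>q\<in>Q. cnj (c q) * c q - cnj (c q) * hinner w q - c q * cnj (hinner w q))
     = (\<Sum>q\<in>Q. of_real ((cmod (c q - hinner w q))\<^sup>2 - (cmod (hinner w q))\<^sup>2))"
    by (intro sum.cong refl, simp only: of_real_diff complex_norm_square) (simp add: algebra_simps)
  finally have "complex_of_real ((norm (w - ?z))\<^sup>2) = of_real ((norm w)\<^sup>2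
      + (\<Sum>q\<in>Q. (cmod (c q - hinner w q))\<^sup>2 - (cmod (hinner w q))\<^sup>2))"
    by (simp add: hinner_self)
  then show ?thesis by (simp only: of_real_eq_iff)
qed

lemma bessel:
  assumes "finite Q" "orthonormal Q"
  shows "(\<Sum>q\<in>Q. (cmod (hinner w q))\<^sup>2) \<le> (norm w)\<^sup>2"
proof -
  have "0 \<le> (norm (w - (\<Sum>q\<in>Q. hinner w q *s q)))\<^sup>2" by simp
  then show ?thesis unfolding orthonormal_distance[OF assms] by (simp add: sum_negf)
qed

lemma distance_from_span:
  assumes "finite Q" "orthonormal Q" "z \<in> vec.span Q"
  shows "(norm w)\<^sup>2 - (\<Sum>q\<in>Q. (cmod (hinner w q))\<^sup>2) \<le> (norm (w - z))\<^sup>2"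
proof -
  obtain c where z: "z = (\<Sum>q\<in>Q. c q *s q)"
    using assms by (auto simp: vec.span_finite)
  have "0 \<le> (\<Sum>q\<in>Q. (cmod (c q - hinner w q))\<^sup>2)" by (simp add: sum_nonneg)
  then show ?thesis unfolding z orthonormal_distance[OF assms(1,2)] by (simp add: sum_subtractf)
qed

lemma rank_mult_le:
  fixes A :: "complex^'b::finite^'a::finite" and B :: "complex^'c::finite^'b"
  shows "rank (A ** B) \<le> rank B" "rank (A ** B) \<le> rank A"
proof -
  have row: "row i (A ** B) = (\<Sum>k\<in>UNIV. A $ i $ k *s row k B)" for i
    by (simp add: row_def matrix_matrix_mult_def vec_eq_iff)
  have "rows (A ** B) \<subseteq> vec.span (rows B)"
  proof
    fix y assume "y \<in> rows (A ** B)"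
    then obtain i where y: "y = row i (A ** B)" by (auto simp: rows_def)
    show "y \<in> vec.span (rows B)" unfolding y row
      by (intro vec.span_sum vec.span_scale vec.span_base) (auto simp: rows_def)
  qed
  then show "rank (A ** B) \<le> rank B"
    unfolding row_rank_def_gen by (metis vec.dim_span vec.dim_subset)
  have "row i (A ** B) = transpose B *v row i A" for i
    by (simp add: row_def matrix_matrix_mult_def matrix_vector_mult_def transpose_def vec_eq_iff mult.commute)
  then have "rows (A ** B) = (*v) (transpose B) ` rows A"
    by (auto simp: rows_def)
  then show "rank (A ** B) \<le> rank A"
    unfolding row_rank_def_gen using vec.dim_image_le[OF matrix_vector_mul_linear_gen, of "transpose B" "rows A"]
    by simp
qed

lemma rank_le_rows: "rank (A :: complex^'c::finite^'b::finite) \<le> CARD('b)"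
proof -
  have fin: "finite (rows A)" and "card (rows A) \<le> CARD('b)"
    unfolding rows_def by (auto simp: full_SetCompr_eq intro: card_image_le)
  then show ?thesis unfolding row_rank_def_gen
    using vec.dim_le_card[of "rows A" "rows A"] vec.span_superset by fastforce
qed

text \<open>
  Moving mass from an entry outside \<open>R\<close> to an unsaturated entry of \<open>R\<close> cannot lower the sum;
  comparing every entry with the smallest one in \<open>R\<close> makes this precise.
\<close>

lemma weighted_sum_le_top:
  fixes a c :: "'a::finite \<Rightarrow> real"
  assumes R: "R \<noteq> {}" and top: "\<And>i j. i \<in> R \<Longrightarrow> j \<notin> R \<Longrightarrow> a j \<le> a i"
    and a: "\<And>i. 0 \<le> a i" and c: "\<And>i. 0 \<le> c i" "\<And>i. c i \<le> 1" and mass: "sum c UNIV \<le> card R"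
  shows "(\<Sum>i\<in>UNIV. a i * c i) \<le> sum a R"
proof -
  define \<mu> where "\<mu> = Min (a ` R)"
  have mu: "\<And>i. i \<in> R \<Longrightarrow> \<mu> \<le> a i" by (simp add: \<mu>_def)
  have "\<mu> \<in> a ` R" unfolding \<mu>_def using R by (intro Min_in) auto
  then have mu': "\<And>j. j \<notin> R \<Longrightarrow> a j \<le> \<mu>" and "0 \<le> \<mu>" using top a by auto
  have split: "sum f UNIV = sum f R + sum f (- R)" for f :: "'a \<Rightarrow> real"
    using sum.union_disjoint[of R "- R" f] by simp
  have "sum (\<lambda>i. a i * c i) (- R) \<le> sum (\<lambda>i. \<mu> * c i) (- R)"
    by (intro sum_mono mult_right_mono) (use mu' c in auto)
  moreover have "sum (\<lambda>i. \<mu> * (1 - c i)) R \<le> sum (\<lambda>i. a i * (1 - c i)) R"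
    by (intro sum_mono mult_right_mono) (use mu c in auto)
  moreover have "\<mu> * sum c UNIV \<le> \<mu> * card R" using mass \<open>0 \<le> \<mu>\<close> by (rule mult_left_mono)
  ultimately show ?thesis
    unfolding split by (simp add: right_diff_distrib sum_subtractf sum_distrib_left[symmetric] algebra_simps)
qed

lemma norm_sq_rows: "(norm A)\<^sup>2 = (\<Sum>i\<in>UNIV. (norm (A $ i))\<^sup>2)" for A :: "complex^'c::finite^'b::finite"
  by (simp add: norm_vec_def[of A] L2_set_def sum_nonneg)

text \<open>
  If orthonormal vectors \<open>q\<close> span the rows of \<open>Z\<close>, the distance is at least
  \<open>\<Sum>\<^sub>i |d\<^sub>i|\<^sup>2 (1 - c\<^sub>i)\<close> with \<open>c\<^sub>i = \<Sum>\<^sub>q |q\<^sub>i|\<^sup>2\<close>.  Bessel's inequality for the standard basis vectors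
  gives \<open>c\<^sub>i \<le> 1\<close>, and the total mass of \<open>c\<close> is the number of vectors.
\<close>

lemma diagonal_low_rank_distance:
  fixes Z :: "complex^'n::finite^'n"
  assumes "rank Z \<le> card R" "R \<noteq> {}" "\<And>i j. i \<in> R \<Longrightarrow> j \<notin> R \<Longrightarrow> cmod (d j) \<le> cmod (d i)"
  shows "(\<Sum>j\<in>- R. (cmod (d j))\<^sup>2) \<le> (norm (diagonal_matrix d - Z))\<^sup>2"
proof -
  obtain B where B: "B \<subseteq> rows Z" "vec.independent B" "rows Z \<subseteq> vec.span B" "card B = vec.dim (rows Z)"
    using vec.basis_exists by blast
  have "finite B" using B(2) by (rule vec.finiteI_independent)
  then obtain Q where Q: "finite Q" "card Q \<le> card B" "orthonormal Q" "B \<subseteq> vec.span Q"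
    using orthonormal_spanning by blast
  have ZQ: "Z $ i \<in> vec.span Q" for i
  proof -
    have "Z $ i = row i Z" by (simp add: row_def vec_eq_iff)
    then have "Z $ i \<in> vec.span B" using B(3) by (auto simp: rows_def)
    moreover have "vec.span B \<subseteq> vec.span Q" by (intro vec.span_minimal Q vec.subspace_span)
    ultimately show ?thesis by blast
  qed
  have row: "diagonal_matrix d $ i = d i *s axis i 1" for i
    by (simp add: diagonal_matrix_def vec_eq_iff axis_def)
  have ax: "hinner (axis i 1) q = cnj (q $ i)" for i and q :: "complex^'n"
    by (simp add: hinner_def axis_def if_distribR if_distrib cong: if_cong)
  have nax: "norm (axis i 1 :: complex^'n) = 1" for i by (simp add: norm_axis_1)
  define c where "c i = (\<Sum>q\<in>Q. (cmod (q $ i))\<^sup>2)" for i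
  have c1: "c i \<le> 1" for i using bessel[OF Q(1,3), of "axis i 1"] by (simp add: ax nax c_def)
  have c0: "0 \<le> c i" for i by (simp add: c_def sum_nonneg)
  have "sum c UNIV = (\<Sum>q\<in>Q. \<Sum>i\<in>UNIV. (cmod (q $ i))\<^sup>2)" unfolding c_def by (rule sum.swap)
  also have "\<dots> = (\<Sum>q\<in>Q. 1)"
  proof (rule sum.cong[OF refl])
    fix q assume "q \<in> Q"
    then have "complex_of_real ((norm q)\<^sup>2) = 1" using Q(3) hinner_self[of q] by (auto simp: orthonormal_def)
    then have "(norm q)\<^sup>2 = 1" by (metis of_real_eq_1_iff)
    then show "(\<Sum>i\<in>UNIV. (cmod (q $ i))\<^sup>2) = 1" by (simp add: norm_vec_def L2_set_def sum_nonneg)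
  qed
  also have "\<dots> \<le> card R" using Q(2) B(4) assms(1) by (simp add: row_rank_def_gen)
  finally have mass: "sum c UNIV \<le> card R" .
  have "(\<Sum>i\<in>UNIV. (cmod (d i))\<^sup>2 * c i) \<le> (\<Sum>i\<in>R. (cmod (d i))\<^sup>2)"
    by (rule weighted_sum_le_top[OF assms(2) _ _ c0 c1 mass]) (use assms(3) in \<open>auto intro: power_mono\<close>)
  moreover have "(cmod (d i))\<^sup>2 - (cmod (d i))\<^sup>2 * c i \<le> (norm ((diagonal_matrix d - Z) $ i))\<^sup>2" for i
  proof -
    have "(norm (d i *s axis i 1))\<^sup>2 = (cmod (d i))\<^sup>2"
      unfolding vector_scalar_mult_def
      by (simp add: norm_vec_def L2_set_def axis_def norm_mult sum_nonneg if_distrib if_distribR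
        sum.delta' cong: if_cong)
    moreover have "(\<Sum>q\<in>Q. (cmod (hinner (d i *s axis i 1) q))\<^sup>2) = (cmod (d i))\<^sup>2 * c i"
      by (simp add: hinner_simps ax norm_mult power_mult_distrib c_def sum_distrib_left)
    ultimately show ?thesis
      using distance_from_span[OF Q(1,3) ZQ[of i], of "diagonal_matrix d $ i"] unfolding row
      by (simp add: row[symmetric])
  qed
  then have "(\<Sum>i\<in>UNIV. (cmod (d i))\<^sup>2 - (cmod (d i))\<^sup>2 * c i) \<le> (norm (diagonal_matrix d - Z))\<^sup>2"
    unfolding norm_sq_rows[of "diagonal_matrix d - Z"] by (rule sum_mono)
  moreover have "sum f UNIV = sum f R + sum f (- R)" for f :: "'n \<Rightarrow> real"
    using sum.union_disjoint[of R "- R" f] by simp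
  ultimately show ?thesis by (simp add: sum_subtractf)
qed

lemma norm_diagonal: "(norm (diagonal_matrix d :: complex^'n::finite^'n))\<^sup>2 = (\<Sum>j\<in>UNIV. (cmod (d j))\<^sup>2)"
proof -
  have "(norm ((diagonal_matrix d :: complex^'n^'n) $ i))\<^sup>2 = (cmod (d i))\<^sup>2" for i
    by (simp add: diagonal_matrix_def norm_vec_def L2_set_def sum_nonneg if_distrib[of cmod] if_distrib[of "\<lambda>x. x\<^sup>2"]
        cong: if_cong)
  then show ?thesis by (simp add: norm_sq_rows)
qed

text \<open>
  The Eckart--Young theorem for a normal matrix, by reduction to the diagonal case.
\<close>

theorem best_rank_approximation_leading_eigendata:
  fixes W :: "complex^'n::finite^'n" and U :: "complex^'r::finite^'n"
  assumes "leading_eigendata W S U"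
  shows "is_best_rank_approximation CARD('r) W (U ** S ** ctranspose U)"
proof -
  obtain V d and e :: "'r \<Rightarrow> 'n" where V: "V \<in> unitary_matrices" and WV: "W ** V = V ** diagonal_matrix d"
    and e: "inj e" and lead: "\<And>k j. j \<notin> range e \<Longrightarrow> cmod (d j) \<le> cmod (d (e k))"
    and S: "S = diagonal_matrix (\<lambda>k. d (e k))" and U: "U = (\<chi> i k. V $ i $ e k)"
    using assms unfolding leading_eigendata_def by blast
  have V1: "ctranspose V ** V = mat 1" using V by (simp add: unitary_matrices_def)
  then have V2: "V ** ctranspose V = mat 1" using matrix_left_right_inverse by blast
  then have V': "ctranspose V \<in> stiefel" by (simp add: stiefel_def)
  have iso: "norm (ctranspose V ** X ** V) = norm X" for X
    using norm_frame_conj[OF V', of X] by simp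
  have W: "ctranspose V ** W ** V = diagonal_matrix d"
    by (metis WV V1 matrix_mul_assoc matrix_mul_lid)
  define d' where "d' j = (if j \<in> range e then d j else 0)" for j
  have U_entry: "(U ** S ** ctranspose U) $ i $ j = (V ** diagonal_matrix d' ** ctranspose V) $ i $ j" for i j
  proof -
    have "(U ** S ** ctranspose U) $ i $ j = (\<Sum>k\<in>UNIV. V $ i $ e k * d (e k) * cnj (V $ j $ e k))"
      by (simp add: matrix_matrix_mult_def U S diagonal_matrix_def ctranspose_def if_distrib cong: if_cong)
    also have "\<dots> = (\<Sum>a\<in>range e. V $ i $ a * d a * cnj (V $ j $ a))"
      by (simp add: sum.reindex[OF e])
    also have "\<dots> = (\<Sum>a\<in>UNIV. V $ i $ a * d' a * cnj (V $ j $ a))"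
      by (rule sum.mono_neutral_cong_left) (auto simp: d'_def)
    also have "\<dots> = (V ** diagonal_matrix d' ** ctranspose V) $ i $ j"
      by (simp add: matrix_matrix_mult_def diagonal_matrix_def ctranspose_def if_distrib cong: if_cong)
    finally show ?thesis .
  qed
  then have Y: "U ** S ** ctranspose U = V ** diagonal_matrix d' ** ctranspose V"
    by (simp add: vec_eq_iff)
  have VY: "ctranspose V ** (U ** S ** ctranspose U) ** V = diagonal_matrix d'"
  proof -
    have "ctranspose V ** (U ** S ** ctranspose U) ** V
      = (ctranspose V ** V) ** diagonal_matrix d' ** (ctranspose V ** V)"
      unfolding Y by (simp only: matrix_mul_assoc)
    then show ?thesis by (simp add: V1)
  qed
  have card: "card (range e) = CARD('r)" by (rule card_image[OF e])
  have dist: "(norm (W - U ** S ** ctranspose U))\<^sup>2 = (\<Sum>j\<in>- range e. (cmod (d j))\<^sup>2)"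
  proof -
    have "norm (W - U ** S ** ctranspose U) = norm (diagonal_matrix (\<lambda>j. d j - d' j) :: complex^'n^'n)"
      using iso[of "W - U ** S ** ctranspose U"]
      by (simp add: matrix_ring_simps W VY) (simp add: diagonal_matrix_def vec_eq_iff minus_vec_def if_distrib if_distribR cong: if_cong)
    then have "(norm (W - U ** S ** ctranspose U))\<^sup>2 = (\<Sum>j\<in>UNIV. (cmod (d j - d' j))\<^sup>2)"
      by (simp add: norm_diagonal)
    also have "\<dots> = (\<Sum>j\<in>- range e. (cmod (d j))\<^sup>2)"
      by (rule sum.mono_neutral_cong_right) (auto simp: d'_def)
    finally show ?thesis .
  qed
  show ?thesis unfolding is_best_rank_approximation_def
  proof (intro conjI allI impI)
    show "rank (U ** S ** ctranspose U) \<le> CARD('r)"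
      using rank_mult_le(1)[of "U ** S" "ctranspose U"] rank_le_rows[of "ctranspose U"] by linarith
    fix Z :: "complex^'n^'n" assume "rank Z \<le> CARD('r)"
    then have "rank (ctranspose V ** Z ** V) \<le> card (range e)"
      using rank_mult_le(2)[of "ctranspose V ** Z" V] rank_mult_le(1)[of "ctranspose V" Z] card by linarith
    then have "(\<Sum>j\<in>- range e. (cmod (d j))\<^sup>2) \<le> (norm (diagonal_matrix d - ctranspose V ** Z ** V))\<^sup>2"
      by (rule diagonal_low_rank_distance) (use lead in auto)
    also have "diagonal_matrix d - ctranspose V ** Z ** V = ctranspose V ** (W - Z) ** V"
      by (simp add: matrix_ring_simps W)
    also have "norm \<dots> = norm (W - Z)" by (rule iso)
    finally show "norm (W - U ** S ** ctranspose U) \<le> norm (W - Z)"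
      unfolding dist[symmetric] by (rule power2_le_imp_le) simp
  qed
qed


section \<open>Ladder relations for Racah sums\<close>

text \<open>
  With value \<open>0\<close> outside \<open>{0..n}\<close>, also for negative lower index, the sums below need no
  summation limits that depend on \<open>x\<close>, \<open>y\<close>, and the ladder relations have no boundary cases.
\<close>

definition ibinom :: "nat \<Rightarrow> int \<Rightarrow> real" where
  "ibinom n k = (if k < 0 then 0 else real (n choose nat k))"

lemma ibinom_absorb: "of_int k * ibinom n k = (real n + 1 - of_int k) * ibinom n (k - 1)"
proof (cases "k \<le> 0")
  case True
  then show ?thesis by (auto simp: ibinom_def)
next
  case False
  define j where "j = nat (k - 1)"
  have k: "k = int (Suc j)" using False by (simp add: j_def)
  have "Suc j * (n choose Suc j) = (n - j) * (n choose j)"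
    by (simp only: binomial_absorption binomial_absorb_comp)
  then have "real (Suc j) * real (n choose Suc j) = real (n - j) * real (n choose j)"
    by (metis of_nat_mult)
  also have "\<dots> = (real n - real j) * real (n choose j)"
    by (cases "j \<le> n") (auto simp: of_nat_diff binomial_eq_0)
  finally show ?thesis unfolding k ibinom_def by (simp add: nat_add_distrib)
qed

lemma ibinom_eq_0: "k < 0 \<or> int n < k \<Longrightarrow> ibinom n k = 0"
  by (auto simp: ibinom_def binomial_eq_0)

text \<open>
  Summation by parts for alternating sums, from \<open>(l - t) (l choose t) = (t + 1) (l choose (t + 1))\<close>.
\<close>

lemma alternating_binomial_shift:
  "(\<Sum>t\<le>l. (-1) ^ t * ((real l - real t) * ibinom l (int t) * F (int t)))
   = - (\<Sum>t\<le>l. (-1) ^ t * (real t * ibinom l (int t) * F (int t - 1)))"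
proof -
  define h where "h t = (-1::real) ^ t * (real t * ibinom l (int t) * F (int t - 1))" for t :: nat
  have "h 0 + (\<Sum>t\<le>l. h (Suc t)) = (\<Sum>t\<le>l. h t) + h (Suc l)"
    by (metis sum.atMost_Suc sum.atMost_Suc_shift)
  moreover have "h 0 = 0" "h (Suc l) = 0" by (simp_all add: h_def ibinom_eq_0)
  moreover have h_Suc: "h (Suc t) = - ((-1) ^ t * ((real l - real t) * ibinom l (int t) * F (int t)))" for t
  proof -
    have "real (Suc t) * ibinom l (int (Suc t)) = (real l - real t) * ibinom l (int t)"
      using ibinom_absorb[of "int (Suc t)" l] by (simp add: add.commute)
    then show ?thesis by (simp add: h_def)
  qed
  ultimately have "(\<Sum>t\<le>l. h (Suc t)) = (\<Sum>t\<le>l. h t)" by simp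
  then show ?thesis unfolding h_Suc sum_negf by (simp add: h_def)
qed

text \<open>
  Racah's sum for the entry \<open>(x, y)\<close> of \<open>T\<^sub>l\<^sub>m\<close>, with the factorials collected into binomial
  coefficients, rows and columns counted from \<open>0\<close> to \<open>n = N - 1\<close>, and \<open>m = x - y\<close>.
\<close>

definition racah_sum :: "nat \<Rightarrow> nat \<Rightarrow> int \<Rightarrow> int \<Rightarrow> real" where
  "racah_sum n l x y =
     (\<Sum>t\<le>l. (-1) ^ t * (ibinom l (int t) * ibinom l (int t - x + y) * ibinom (n - l) (x - int t)))"

lemma racah_sum_outside:
  assumes "l \<le> n" and "x < 0 \<or> int n < x \<or> y < 0 \<or> int n < y"
  shows "racah_sum n l x y = 0"
proof -
  have "ibinom l (int t - x + y) = 0 \<or> ibinom (n - l) (x - int t) = 0" if "t \<le> l" for t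
  proof (rule ccontr)
    assume "\<not> ?thesis"
    then have "\<not> (int t - x + y < 0 \<or> int l < int t - x + y)"
      and "\<not> (x - int t < 0 \<or> int (n - l) < x - int t)"
      using ibinom_eq_0 by blast+
    then show False using assms that by (simp add: of_nat_diff)
  qed
  then show ?thesis unfolding racah_sum_def by (intro sum.neutral) fastforce
qed

text \<open>
  The coefficient form of the invariance of \<open>3j\<close>-symbols under the raising operator.  Absorption
  in the last binomial coefficient splits the first sum in two; summation by parts turns the
  second piece into a sum over the same terms \<open>(l choose t) (n - l choose x - t)\<close>, and what multiplies each of
  them vanishes by absorption in the middle coefficient.
\<close>

lemma racah_sum_raise:
  assumes "l \<le> n"
  shows "(real n - x + 1) * racah_sum n l (x - 1) y - (y + 1) * racah_sum n l x (y + 1)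
         = - (real l + x - y) * racah_sum n l x y"
proof -
  define b where "b = (\<lambda>t::nat. ibinom l (int t))"
  define c where "c = (\<lambda>t::int. ibinom l (t - x + y))"
  define p where "p = (\<lambda>t::int. ibinom (n - l) (x - t))"
  have p1: "(real n - x + 1) * p (t + 1) = (x - t) * p t + (real l - t) * p (t + 1)" for t :: int
    using ibinom_absorb[of "x - t" "n - l"] assms
    by (simp add: p_def of_nat_diff algebra_simps)
  have c1: "(t - x + y + 1) * c (t + 1) = (real l - (t - x + y)) * c t" for t :: int
    using ibinom_absorb[of "t - x + y + 1" l] by (simp add: c_def algebra_simps)
  have "(real n - x + 1) * racah_sum n l (x - 1) y
      = (\<Sum>t\<le>l. (-1) ^ t * (b t * c (int t + 1) * ((real n - x + 1) * p (int t + 1))))"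
    unfolding racah_sum_def sum_distrib_left b_def c_def p_def
    by (intro sum.cong) (simp_all add: algebra_simps)
  also have "\<dots> = (\<Sum>t\<le>l. (-1) ^ t * (b t * c (int t + 1) * ((x - t) * p t)))
     + (\<Sum>t\<le>l. (-1) ^ t * ((real l - real t) * b t * (c (int t + 1) * p (int t + 1))))"
    unfolding p1 sum.distrib[symmetric] by (intro sum.cong) (simp_all add: algebra_simps)
  finally have 0: "(real n - x + 1) * racah_sum n l (x - 1) y
      = (\<Sum>t\<le>l. (-1) ^ t * (b t * c (int t + 1) * ((x - t) * p t)))
     + (\<Sum>t\<le>l. (-1) ^ t * ((real l - real t) * b t * (c (int t + 1) * p (int t + 1))))" .
  have shift: "(\<Sum>t\<le>l. (-1) ^ t * ((real l - real t) * b t * (c (int t + 1) * p (int t + 1))))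
      = - (\<Sum>t\<le>l. (-1) ^ t * (real t * b t * (c (int t) * p (int t))))"
    using alternating_binomial_shift[of l "\<lambda>t. c (t + 1) * p (t + 1)"] by (simp add: b_def)
  have 2: "(y + 1) * racah_sum n l x (y + 1)
      = (\<Sum>t\<le>l. (-1) ^ t * ((y + 1) * b t * c (int t + 1) * p t))"
    unfolding racah_sum_def sum_distrib_left b_def c_def p_def
    by (intro sum.cong) (simp_all add: algebra_simps)
  have 3: "(real l + x - y) * racah_sum n l x y
      = (\<Sum>t\<le>l. (-1) ^ t * ((real l + x - y) * b t * c (int t) * p t))"
    unfolding racah_sum_def sum_distrib_left b_def c_def p_def
    by (intro sum.cong) (simp_all add: algebra_simps)
  have "(real n - x + 1) * racah_sum n l (x - 1) y - (y + 1) * racah_sum n l x (y + 1)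
         + (real l + x - y) * racah_sum n l x y
      = (\<Sum>t\<le>l. (-1) ^ t * b t * p t *
           ((real l - (int t - x + y)) * c (int t) - (int t - x + y + 1) * c (int t + 1)))"
    unfolding 0 shift 2 3 sum_negf[symmetric] sum.distrib[symmetric] sum_subtractf[symmetric]
    by (intro sum.cong) (simp_all add: algebra_simps)
  also have "\<dots> = 0"
  proof (intro sum.neutral ballI)
    fix t :: nat
    show "(-1) ^ t * b t * p t * ((real l - (int t - x + y)) * c (int t) - (int t - x + y + 1) * c (int t + 1)) = 0"
      using c1[of "int t"] by simp
  qed
  finally show ?thesis by (simp add: algebra_simps)
qed

text \<open>
  Reflecting the summation index at the other pair of binomial coefficients exchanges rows and
  columns.
\<close>

lemma racah_sum_swap: "racah_sum n l y x = (if even (x - y) then 1 else -1) * racah_sum n l x y"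
proof -
  let ?A = "\<lambda>x y. {t. t \<le> l \<and> 0 \<le> int t - x + y \<and> int t - x + y \<le> int l}"
  let ?f = "\<lambda>x y t. (-1::real) ^ t * (ibinom l (int t) * ibinom l (int t - x + y) * ibinom (n - l) (x - int t))"
  have restrict: "racah_sum n l x y = sum (?f x y) (?A x y)" for x y
    unfolding racah_sum_def
  proof (rule sum.mono_neutral_right)
    show "\<forall>t\<in>{..l} - ?A x y. ?f x y t = 0"
    proof
      fix t assume "t \<in> {..l} - ?A x y"
      then have "ibinom l (int t - x + y) = 0" by (intro ibinom_eq_0) auto
      then show "?f x y t = 0" by simp
    qed
  qed auto
  have flip: "?f y x (nat (int t - x + y)) = (if even (x - y) then 1 else -1) * ?f x y t" if "t \<in> ?A x y" for t
    using that by (auto simp: minus_one_power_iff even_nat_iff)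
  have "(\<Sum>t\<in>?A x y. (if even (x - y) then 1 else -1) * ?f x y t) = sum (?f y x) (?A y x)"
  proof (rule sum.reindex_bij_witness[of _ "\<lambda>t. nat (int t - y + x)" "\<lambda>t. nat (int t - x + y)"], goal_cases)
    case (5 t)
    then show ?case by (rule flip)
  qed auto
  then show ?thesis by (simp only: restrict sum_distrib_left)
qed

text \<open>
  On the border of the matrix only one term of the sum survives.
\<close>

lemma racah_sum_border:
  assumes "x \<le> l"
  shows "racah_sum n l (int x) 0 \<noteq> 0" "racah_sum n l 0 (int x) \<noteq> 0"
proof -
  have "racah_sum n l (int x) 0
      = (\<Sum>t\<in>{x}. (-1) ^ t * (ibinom l (int t) * ibinom l (int t - int x + 0) * ibinom (n - l) (int x - int t)))"
    unfolding racah_sum_def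
    by (rule sum.mono_neutral_right) (use assms in \<open>auto simp: ibinom_def\<close>)
  then show "racah_sum n l (int x) 0 \<noteq> 0" using assms by (simp add: ibinom_def)
  have "racah_sum n l 0 (int x)
      = (\<Sum>t\<in>{0}. (-1) ^ t * (ibinom l (int t) * ibinom l (int t - 0 + int x) * ibinom (n - l) (0 - int t)))"
    unfolding racah_sum_def
    by (rule sum.mono_neutral_right) (use assms in \<open>auto simp: ibinom_def\<close>)
  then show "racah_sum n l 0 (int x) \<noteq> 0" using assms by (simp add: ibinom_def)
qed


section \<open>Spin matrices and the Casimir operator\<close>

definition pos :: "'n::{finite,linorder} \<Rightarrow> nat" where
  "pos i = card {j. j < i}"

lemma pos_less: "i < j \<Longrightarrow> pos i < pos j"
  unfolding pos_def by (intro psubset_card_mono) (auto intro: order.strict_trans)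

lemma inj_pos: "inj pos"
  by (rule injI) (metis less_irrefl linorder_neqE pos_less)

lemma bij_pos: "bij_betw pos (UNIV :: 'n::{finite,linorder} set) {..<CARD('n)}"
proof -
  have "pos i < CARD('n)" for i :: 'n
    unfolding pos_def by (intro psubset_card_mono) auto
  then have "pos ` (UNIV :: 'n set) \<subseteq> {..<CARD('n)}" by auto
  then have "pos ` (UNIV :: 'n set) = {..<CARD('n)}"
    by (intro card_subset_eq) (auto simp: card_image[OF inj_pos])
  then show ?thesis using inj_pos by (simp add: bij_betw_def)
qed

lemma pos_bound: "pos (i :: 'n::{finite,linorder}) < CARD('n)"
  using bij_pos[where 'n='n] by (auto simp: bij_betw_def)

lemma pos_le: "pos (i :: 'n::{finite,linorder}) \<le> CARD('n) - 1"
  using pos_bound[of i] by simp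

lemma pos_surj: "x < CARD('n) \<Longrightarrow> \<exists>i :: 'n::{finite,linorder}. pos i = x"
  using bij_pos[where 'n='n] by (auto simp: bij_betw_def image_iff) (metis imageE lessThan_iff)

definition pos_matrix :: "(nat \<Rightarrow> nat \<Rightarrow> real) \<Rightarrow> 'n::{finite,linorder} cmatrix" where
  "pos_matrix f = (\<chi> i j. complex_of_real (f (pos i) (pos j)))"

lemma pos_matrix_mult:
  "(pos_matrix f :: 'n::{finite,linorder} cmatrix) ** pos_matrix g
     = pos_matrix (\<lambda>x y. \<Sum>k<CARD('n). f x k * g k y)"
proof -
  have "(\<Sum>k\<in>UNIV. f x (pos (k::'n)) * g (pos k) y) = (\<Sum>k<CARD('n). f x k * g k y)" for x y
    using sum.reindex_bij_betw[OF bij_pos] by fast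
  then show ?thesis
    by (simp add: vec_eq_iff pos_matrix_def matrix_matrix_mult_def flip: of_real_mult of_real_sum)
qed

lemma pos_matrix_diff: "pos_matrix f - pos_matrix g = pos_matrix (\<lambda>x y. f x y - g x y)"
  by (simp add: vec_eq_iff pos_matrix_def)

lemma pos_matrix_scaleR: "c *\<^sub>R pos_matrix f = pos_matrix (\<lambda>x y. c * f x y)"
  by (simp add: vec_eq_iff pos_matrix_def) (simp add: scaleR_conv_of_real)

lemma pos_matrix_cong:
  "(\<And>x y. x < CARD('n) \<Longrightarrow> y < CARD('n) \<Longrightarrow> f x y = g x y)
    \<Longrightarrow> (pos_matrix f :: 'n::{finite,linorder} cmatrix) = pos_matrix g"
  by (simp add: vec_eq_iff pos_matrix_def pos_bound)

definition commutator :: "complex^'n::finite^'n \<Rightarrow> complex^'n^'n \<Rightarrow> complex^'n^'n" where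
  "commutator A B = A ** B - B ** A"

text \<open>
  The entries of the raising operator of spin \<open>n/2\<close>: \<open>sqrt (s (s + 1) - \<mu> (\<mu> - 1))\<close> at
  \<open>\<mu> = x - n/2\<close>, \<open>s = n/2\<close>.
\<close>

definition ladder :: "nat \<Rightarrow> nat \<Rightarrow> real" where
  "ladder n x = sqrt (real x * (real n + 1 - real x))"

definition spin_raise :: "'n::{finite,linorder} cmatrix" where
  "spin_raise = pos_matrix (\<lambda>x y. if x = Suc y then ladder (CARD('n) - 1) x else 0)"

definition spin_lower :: "'n::{finite,linorder} cmatrix" where
  "spin_lower = pos_matrix (\<lambda>x y. if y = Suc x then ladder (CARD('n) - 1) y else 0)"

text \<open>
  Shifted by a multiple of the identity from the usual choice, which changes no commutator.
\<close>

definition spin_z :: "'n::{finite,linorder} cmatrix" where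
  "spin_z = pos_matrix (\<lambda>x y. if x = y then real x else 0)"

lemma ctranspose_commutator:
  "ctranspose (commutator A X) = - commutator (ctranspose A) (ctranspose X)"
  by (simp add: commutator_def ctranspose_mult)

lemma ctranspose_spin:
  "ctranspose spin_raise = spin_lower" "ctranspose spin_lower = spin_raise" "ctranspose spin_z = spin_z"
  by (auto simp: vec_eq_iff ctranspose_def spin_raise_def spin_lower_def spin_z_def pos_matrix_def)

lemma ladder_ends: "ladder n 0 = 0" "ladder n (Suc n) = 0"
  by (simp_all add: ladder_def)

text \<open>
  The truncated subtraction \<open>x - 1\<close> at \<open>x = 0\<close> and the argument \<open>Suc y\<close> in the last column are
  harmless: the ladder coefficient vanishes there.
\<close>

lemma commutator_spin_raise:
  "commutator (spin_raise :: 'n::{finite,linorder} cmatrix) (pos_matrix f)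
   = pos_matrix (\<lambda>x y. ladder (CARD('n) - 1) x * f (x - 1) y - ladder (CARD('n) - 1) (Suc y) * f x (Suc y))"
proof -
  let ?N = "CARD('n)"
  let ?a = "ladder (?N - 1)"
  have 1: "(\<Sum>k<?N. (if x = Suc k then ?a x else 0) * f k y) = ?a x * f (x - 1) y" if "x < ?N" for x y
  proof (cases x)
    case 0 then show ?thesis by (simp add: ladder_ends)
  next
    case (Suc x')
    have "(\<Sum>k<?N. (if x = Suc k then ?a x else 0) * f k y) = (\<Sum>k<?N. if k = x' then ?a x * f k y else 0)"
      using Suc by (intro sum.cong) auto
    then show ?thesis using Suc that by simp
  qed
  have 2: "(\<Sum>k<?N. f x k * (if k = Suc y then ?a k else 0)) = ?a (Suc y) * f x (Suc y)" if "y < ?N" for x y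
  proof -
    have "(\<Sum>k<?N. f x k * (if k = Suc y then ?a k else 0)) = (\<Sum>k<?N. if k = Suc y then ?a (Suc y) * f x k else 0)"
      by (intro sum.cong) auto
    also have "\<dots> = ?a (Suc y) * f x (Suc y)"
    proof (cases "Suc y < ?N")
      case False
      then have "Suc y = Suc (?N - 1)" using that by simp
      then show ?thesis using ladder_ends(2)[of "?N - 1"] by (simp del: diff_Suc_1 Suc_pred)
    qed simp
    finally show ?thesis .
  qed
  show ?thesis unfolding commutator_def spin_raise_def pos_matrix_mult pos_matrix_diff
    by (rule pos_matrix_cong) (simp only: 1 2)
qed

lemma commutator_spin_z:
  "commutator (spin_z :: 'n::{finite,linorder} cmatrix) (pos_matrix f)
   = pos_matrix (\<lambda>x y. (real x - real y) * f x y)"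
proof -
  have "(\<Sum>k<CARD('n). (if x = k then real x else 0) * f k y) = real x * f x y" if "x < CARD('n)" for x y
  proof -
    have "(\<Sum>k<CARD('n). (if x = k then real x else 0) * f k y) = (\<Sum>k<CARD('n). if k = x then real x * f k y else 0)"
      by (intro sum.cong) auto
    then show ?thesis using that by simp
  qed
  moreover have "(\<Sum>k<CARD('n). f x k * (if k = y then real k else 0)) = real y * f x y" if "y < CARD('n)" for x y
  proof -
    have "(\<Sum>k<CARD('n). f x k * (if k = y then real k else 0)) = (\<Sum>k<CARD('n). if k = y then real y * f x k else 0)"
      by (intro sum.cong) auto
    then show ?thesis using that by simp
  qed
  ultimately show ?thesis unfolding commutator_def spin_z_def pos_matrix_mult pos_matrix_diff
    by (intro pos_matrix_cong) (simp only: left_diff_distrib)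
qed

text \<open>
  The symmetrising weights: they turn the square roots of the ladder operators into the integer
  coefficients of the relations for \<open>racah_sum\<close>.
\<close>

definition ladder_weight :: "nat \<Rightarrow> nat \<Rightarrow> real" where
  "ladder_weight n x = sqrt (fact x * fact (n - x))"

lemma ladder_weight_pred:
  assumes "x \<le> n"
  shows "ladder n x * ladder_weight n (x - 1) * c = (if x = 0 then 0 else (real n - real x + 1) * ladder_weight n x * c)"
proof (cases x)
  case (Suc k)
  have "n - k = Suc (n - Suc k)" using assms Suc by simp
  then have f: "fact (n - k) = (real n - real k) * (fact (n - Suc k) :: real)"
    using assms Suc by (simp add: of_nat_diff)
  have "ladder n x * ladder_weight n (x - 1)
      = sqrt ((real n - real k)\<^sup>2 * (fact (Suc k) * fact (n - Suc k)))"
    unfolding ladder_def ladder_weight_def real_sqrt_mult[symmetric] Suc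
    by (simp add: f power2_eq_square algebra_simps)
  also have "\<dots> = (real n - real x + 1) * ladder_weight n x"
    unfolding real_sqrt_mult[of "(real n - real k)\<^sup>2"] real_sqrt_abs using assms Suc
    by (simp add: ladder_weight_def)
  finally show ?thesis using Suc by simp
qed (simp add: ladder_ends)

lemma ladder_weight_Suc:
  assumes "y \<le> n"
  shows "ladder n (Suc y) * ladder_weight n (Suc y) * c = (if y = n then 0 else (real y + 1) * ladder_weight n y * c)"
proof (cases "y = n")
  case False
  then have "n - y = Suc (n - Suc y)" using assms by simp
  then have f: "fact (n - y) = (real n - real y) * (fact (n - Suc y) :: real)"
    using assms False by (simp add: of_nat_diff)
  have "ladder n (Suc y) * ladder_weight n (Suc y)
      = sqrt ((real y + 1)\<^sup>2 * (fact y * fact (n - y)))"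
    unfolding ladder_def ladder_weight_def real_sqrt_mult[symmetric]
    by (simp add: f power2_eq_square algebra_simps)
  also have "\<dots> = (real y + 1) * ladder_weight n y"
    unfolding real_sqrt_mult[of "(real y + 1)\<^sup>2"] real_sqrt_abs
    by (simp add: ladder_weight_def)
  finally show ?thesis using False by simp
qed (simp add: ladder_ends)

definition harmonic_entry :: "nat \<Rightarrow> nat \<Rightarrow> int \<Rightarrow> nat \<Rightarrow> nat \<Rightarrow> real" where
  "harmonic_entry n l m x y =
     (if int x - int y = m then ladder_weight n x * ladder_weight n y * racah_sum n l (int x) (int y) else 0)"

text \<open>
  \<open>T\<^sub>l\<^sub>m\<close> up to a nonzero real factor.  It is defined for all \<open>m\<close> and vanishes for \<open>|m| > l\<close>.
\<close>

definition harmonic :: "nat \<Rightarrow> int \<Rightarrow> 'n::{finite,linorder} cmatrix" where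
  "harmonic l m = pos_matrix (harmonic_entry (CARD('n) - 1) l m)"

lemma harmonic_entry_raise:
  assumes "l \<le> n" "x \<le> n" "y \<le> n"
  shows "ladder n x * harmonic_entry n l m (x - 1) y - ladder n (Suc y) * harmonic_entry n l m x (Suc y)
       = - (real l + m + 1) * harmonic_entry n l (m + 1) x y"
proof (cases "int x - int y = m + 1")
  case False
  then show ?thesis by (cases x) (auto simp: harmonic_entry_def ladder_ends)
next
  case True
  have 1: "ladder n x * harmonic_entry n l m (x - 1) y
      = (real n - real x + 1) * ladder_weight n x * ladder_weight n y * racah_sum n l (int x - 1) (int y)"
  proof (cases x)
    case 0
    then show ?thesis using assms by (simp add: ladder_ends racah_sum_outside)
  next
    case (Suc k)
    then show ?thesis
      using True ladder_weight_pred[OF assms(2), of "ladder_weight n y * racah_sum n l (int x - 1) (int y)"]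
      by (simp add: harmonic_entry_def mult.assoc)
  qed
  have 2: "ladder n (Suc y) * harmonic_entry n l m x (Suc y)
      = (real y + 1) * ladder_weight n x * ladder_weight n y * racah_sum n l (int x) (int y + 1)"
  proof (cases "y = n")
    case True
    then show ?thesis using assms by (simp add: ladder_ends racah_sum_outside)
  next
    case False
    then show ?thesis
      using True ladder_weight_Suc[OF assms(3), of "ladder_weight n x * racah_sum n l (int x) (int y + 1)"]
      by (simp add: harmonic_entry_def mult.assoc mult.left_commute add.commute)
  qed
  have "(real n - real x + 1) * racah_sum n l (int x - 1) (int y)
      - (real y + 1) * racah_sum n l (int x) (int y + 1)
      = - (real l + real x - real y) * racah_sum n l (int x) (int y)"
    using racah_sum_raise[OF assms(1), of "int x" "int y"] by simp
  moreover have "real l + m + 1 = real l + real x - real y" using True by linarith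
  moreover have "A * ladder_weight n x * ladder_weight n y * u - B * ladder_weight n x * ladder_weight n y * v
      = - K * (ladder_weight n x * ladder_weight n y * w)" if "A * u - B * v = - K * w" for A B K u v w :: real
  proof -
    have "A * ladder_weight n x * ladder_weight n y * u - B * ladder_weight n x * ladder_weight n y * v
      = ladder_weight n x * ladder_weight n y * (A * u - B * v)" by (simp add: algebra_simps)
    then show ?thesis unfolding that by simp
  qed
  moreover have "harmonic_entry n l (m + 1) x y
      = ladder_weight n x * ladder_weight n y * racah_sum n l (int x) (int y)"
    using True by (simp add: harmonic_entry_def)
  ultimately show ?thesis unfolding 1 2 by metis
qed

lemma harmonic_raise:
  assumes "l < CARD('n)"
  shows "commutator spin_raise (harmonic l m :: 'n::{finite,linorder} cmatrix)
       = (- (real l + m + 1)) *\<^sub>R harmonic l (m + 1)"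
  unfolding harmonic_def commutator_spin_raise pos_matrix_scaleR
  by (intro pos_matrix_cong harmonic_entry_raise) (use assms in auto)

lemma commutator_simps:
  "commutator A (X + Y) = commutator A X + commutator A Y"
  "commutator A (X - Y) = commutator A X - commutator A Y"
  "commutator A (c *\<^sub>R X) = c *\<^sub>R commutator A X"
  "commutator A (cscale z X) = cscale z (commutator A X)"
  by (simp_all add: commutator_def matrix_ring_simps algebra_simps)
    (simp add: cscale_def matrix_matrix_mult_def vec_eq_iff sum_distrib_left algebra_simps)

text \<open>
  The analogue of the relation between a spherical harmonic and its complex conjugate; it reduces
  the lowering relation to the raising relation.
\<close>

lemma ctranspose_harmonic:
  "ctranspose (harmonic l m) = (if even m then 1 else -1) *\<^sub>R harmonic l (- m)"
proof -
  have "harmonic_entry n l m y x = (if even m then 1 else -1) * harmonic_entry n l (- m) x y" for n x y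
    using racah_sum_swap[of n l "int y" "int x"] by (auto simp: harmonic_entry_def)
  then show ?thesis
    by (simp add: harmonic_def pos_matrix_scaleR) (simp add: ctranspose_def pos_matrix_def vec_eq_iff)
qed

lemma harmonic_lower:
  assumes "l < CARD('n)"
  shows "commutator spin_lower (harmonic l m :: 'n::{finite,linorder} cmatrix)
       = (- (real l - m + 1)) *\<^sub>R harmonic l (m - 1)"
proof -
  have "commutator spin_lower (harmonic l m :: 'n cmatrix)
      = - ctranspose (commutator spin_raise (ctranspose (harmonic l m)))"
    by (simp add: ctranspose_commutator ctranspose_spin)
  also have "\<dots> = - ctranspose ((if even m then 1 else -1) *\<^sub>R (- (real l + of_int (- m) + 1)) *\<^sub>R harmonic l (- m + 1))"
    unfolding ctranspose_harmonic commutator_simps harmonic_raise[OF assms] ..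
  also have "\<dots> = (- (real l - m + 1)) *\<^sub>R harmonic l (m - 1)"
    by (simp add: ctranspose_harmonic algebra_simps)
  finally show ?thesis .
qed

lemma harmonic_z:
  "commutator spin_z (harmonic l m :: 'n::{finite,linorder} cmatrix) = real_of_int m *\<^sub>R harmonic l m"
  unfolding harmonic_def commutator_spin_z pos_matrix_scaleR
  by (intro pos_matrix_cong) (auto simp: harmonic_entry_def)

text \<open>
  Minus the Laplacian of Hoppe and Yau.  The symmetric form makes self-adjointness evident.
\<close>

definition casimir :: "'n::{finite,linorder} cmatrix \<Rightarrow> 'n cmatrix" where
  "casimir X = (1/2) *\<^sub>R (commutator spin_raise (commutator spin_lower X)
      + commutator spin_lower (commutator spin_raise X)) + commutator spin_z (commutator spin_z X)"

text \<open>
  The coefficients are \<open>(l - m + 1) (l + m)\<close> and \<open>(l + m + 1) (l - m)\<close>, with half sum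
  \<open>l (l + 1) - m\<^sup>2\<close>.
\<close>

lemma casimir_harmonic:
  assumes "l < CARD('n)"
  shows "casimir (harmonic l m :: 'n::{finite,linorder} cmatrix) = (real l * (real l + 1)) *\<^sub>R harmonic l m"
proof -
  have "commutator spin_raise (commutator spin_lower (harmonic l m :: 'n cmatrix))
      = ((real l - m + 1) * (real l + m)) *\<^sub>R harmonic l m"
    unfolding harmonic_lower[OF assms] commutator_simps harmonic_raise[OF assms] by (auto simp: algebra_simps)
  moreover have "commutator spin_lower (commutator spin_raise (harmonic l m :: 'n cmatrix))
      = ((real l + m + 1) * (real l - m)) *\<^sub>R harmonic l m"
    unfolding harmonic_raise[OF assms] commutator_simps harmonic_lower[OF assms] by (auto simp: algebra_simps)
  ultimately have "casimir (harmonic l m :: 'n cmatrix)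
      = ((1/2) * ((real l - m + 1) * (real l + m) + (real l + m + 1) * (real l - m)) + real_of_int m * m)
        *\<^sub>R harmonic l m"
    by (simp only: casimir_def harmonic_z commutator_simps scaleR_scaleR flip: scaleR_add_left)
  also have "(1/2) * ((real l - m + 1) * (real l + m) + (real l + m + 1) * (real l - m)) + real_of_int m * m
      = real l * (real l + 1)"
    by (simp add: field_simps)
  finally show ?thesis .
qed

lemma harmonic_nonzero:
  assumes "l < CARD('n)" "\<bar>m\<bar> \<le> int l"
  shows "(harmonic l m :: 'n::{finite,linorder} cmatrix) \<noteq> 0"
proof -
  let ?x = "if 0 \<le> m then nat m else 0" and ?y = "if 0 \<le> m then 0 else nat (- m)"
  have nm: "nat \<bar>m\<bar> \<le> l" using assms by linarith
  have w: "ladder_weight n x \<noteq> 0" for n x by (simp add: ladder_weight_def)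
  have "?x < CARD('n)" "?y < CARD('n)" using assms by auto
  then obtain i j :: 'n where ij: "pos i = ?x" "pos j = ?y" using pos_surj by metis
  have "harmonic_entry (CARD('n) - 1) l m ?x ?y \<noteq> 0"
    using racah_sum_border[OF nm, of "CARD('n) - 1"] assms w
    by (auto simp: harmonic_entry_def)
  then have "(harmonic l m :: 'n cmatrix) $ i $ j \<noteq> 0"
    by (simp only: harmonic_def pos_matrix_def vec_lambda_beta ij) simp
  then show ?thesis by auto
qed


section \<open>From Wigner symbols to spherical harmonic matrices\<close>

lemma rfact_of_nat: "z = real k \<Longrightarrow> rfact z = fact k"
  by (simp add: rfact_def)

lemma minus_one_powi: "(-1::real) powi k = (if even k then 1 else -1)"
  by (cases "k \<ge> 0") (auto simp: power_int_def even_nat_iff split: if_splits)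

lemma binomial_ratio: "k \<le> n \<Longrightarrow> real (n choose k) = fact n / (fact k * fact (n - k))"
  by (rule binomial_fact)

lemma racah_range_sum:
  assumes "l \<le> n" "int x - int y = m"
  shows "(\<Sum>t\<in>racah_range (real n / 2) (real l) (real n / 2) (real n / 2 - real x) (of_int m).
            (-1) ^ t / (fact t * rfact (real n / 2 - real l + real t + (real n / 2 - real x))
                   * rfact (real n / 2 - real n / 2 + real t - of_int m)
                   * rfact (real n / 2 + real l - real n / 2 - real t)
                   * rfact (real n / 2 - real t - (real n / 2 - real x))
                   * rfact (real l - real t + of_int m)))
    = racah_sum n l (int x) (int y) / (fact l * fact l * fact (n - l))"
    (is "sum ?f ?R = _")
proof -
  have R: "?R = {t. t \<le> l \<and> t \<le> x \<and> l + x \<le> n + t \<and> m \<le> int t \<and> int t \<le> int l + m}"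
    unfolding racah_range_def by (intro Collect_cong) linarith
  let ?g = "\<lambda>t. (-1) ^ t * (ibinom l (int t) * ibinom l (int t - int x + int y) * ibinom (n - l) (int x - int t))"
  have "?f t = ?g t / (fact l * fact l * fact (n - l))" if t: "t \<in> ?R" for t
  proof -
    have t': "t \<le> l" "t \<le> x" "l + x \<le> n + t" "m \<le> int t" "int t \<le> int l + m"
      using t unfolding R by auto
    have f1: "rfact (real n / 2 - real l + real t + (real n / 2 - real x)) = fact (n - l - (x - t))"
      using t' assms by (intro rfact_of_nat) (simp add: of_nat_diff)
    have f2: "rfact (real n / 2 - real n / 2 + real t - of_int m) = fact (nat (int t - m))"
      using t' by (intro rfact_of_nat) (simp add: of_nat_diff)
    have f3: "rfact (real n / 2 + real l - real n / 2 - real t) = fact (l - t)"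
      using t' by (intro rfact_of_nat) (simp add: of_nat_diff)
    have f4: "rfact (real n / 2 - real t - (real n / 2 - real x)) = fact (x - t)"
      using t' by (intro rfact_of_nat) (simp add: of_nat_diff)
    have f5: "rfact (real l - real t + of_int m) = fact (l - nat (int t - m))"
      using t' by (intro rfact_of_nat) (simp add: of_nat_diff nat_le_iff)
    have e: "int t - int x + int y = int t - m" using assms(2) by simp
    have b: "ibinom l (int t) = fact l / (fact t * fact (l - t))"
      "ibinom l (int t - m) = fact l / (fact (nat (int t - m)) * fact (l - nat (int t - m)))"
      "ibinom (n - l) (int x - int t) = fact (n - l) / (fact (x - t) * fact (n - l - (x - t)))"
      using t' assms(1) by (auto simp: ibinom_def binomial_ratio nat_le_iff nat_diff_distrib')
    show ?thesis unfolding f1 f2 f3 f4 f5 e b by (simp add: field_simps)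
  qed
  then have "sum ?f ?R = (\<Sum>t\<in>?R. ?g t / (fact l * fact l * fact (n - l)))" by (rule sum.cong[OF refl])
  also have "\<dots> = (\<Sum>t\<in>?R. ?g t) / (fact l * fact l * fact (n - l))"
    by (rule sum_divide_distrib[symmetric])
  also have "(\<Sum>t\<in>?R. ?g t) = (\<Sum>t\<le>l. ?g t)"
  proof (rule sum.mono_neutral_left)
    show "?R \<subseteq> {..l}" unfolding R by auto
    show "\<forall>t\<in>{..l} - ?R. ?g t = 0"
    proof
      fix t assume "t \<in> {..l} - ?R"
      then have "int t - int x + int y < 0 \<or> int l < int t - int x + int y
          \<or> int x - int t < 0 \<or> int (n - l) < int x - int t"
        unfolding R using assms by (auto simp: of_nat_diff)
      then show "?g t = 0" using ibinom_eq_0 by fastforce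
    qed
  qed simp
  finally show ?thesis by (simp add: racah_sum_def)
qed

text \<open>
  With \<open>s = n/2\<close>, the sign \<open>(-1)\<^sup>s\<^sup>-\<^sup>m\<^sup>1\<close> of the basis matrices and the sign of the
  \<open>3j\<close>-symbol combine to \<open>(-1)\<^sup>l\<^sup>+\<^sup>m\<close>, which is the same for all entries.
\<close>

lemma wigner3j_harmonic_entry:
  assumes "l \<le> n" "\<bar>m\<bar> \<le> int l"
  shows "\<exists>c\<noteq>0. \<forall>x\<le>n. \<forall>y\<le>n. (-1) powi (int n - int x) *
      wigner3j (real n / 2) (real l) (real n / 2) (real n / 2 - real x) (of_int m) (real y - real n / 2)
      = c * harmonic_entry n l m x y"
proof -
  define K where "K = sqrt (rfact (real n / 2 + real l - real n / 2) * rfact (real n / 2 - real l + real n / 2)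
      * rfact (- (real n / 2) + real l + real n / 2) / rfact (real n / 2 + real l + real n / 2 + 1))"
  define M where "M = sqrt (fact (nat (int l + m)) * fact (nat (int l - m)))"
  define c where "c = (-1) powi (int l + m) * K * M / (fact l * fact l * fact (n - l))"
  have "K \<noteq> 0" "M \<noteq> 0" by (simp_all add: K_def M_def rfact_def)
  then have "c \<noteq> 0" by (simp add: c_def minus_one_powi)
  moreover have "(-1) powi (int n - int x) *
      wigner3j (real n / 2) (real l) (real n / 2) (real n / 2 - real x) (of_int m) (real y - real n / 2)
      = c * harmonic_entry n l m x y" if xy: "x \<le> n" "y \<le> n" for x y
  proof (cases "int x - int y = m")
    case False
    then have "real n / 2 - real x + of_int m + (real y - real n / 2) \<noteq> 0" by linarith
    then show ?thesis using False by (simp add: wigner3j_def harmonic_entry_def)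
  next
    case True
    have rm: "real_of_int m = real x - real y" using True by linarith
    have ints: "real n / 2 + real l + real n / 2 \<in> \<int>" "real n / 2 - (real n / 2 - real x) \<in> \<int>"
      "real l - of_int m \<in> \<int>" "real n / 2 - (real y - real n / 2) \<in> \<int>"
      by (simp_all add: Ints_add Ints_diff)
    have guard: "real n / 2 - real x + of_int m + (real y - real n / 2) = 0"
      "\<bar>real n / 2 - real x\<bar> \<le> real n / 2" "\<bar>real_of_int m\<bar> \<le> real l"
      "\<bar>real y - real n / 2\<bar> \<le> real n / 2" "\<bar>real n / 2 - real l\<bar> \<le> real n / 2"
      "real n / 2 \<le> real n / 2 + real l"
      using xy assms rm by linarith+
    have fl: "\<lfloor>real n / 2 - real l - (real y - real n / 2)\<rfloor> = int n - int l - int y"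
      by (rule floor_unique) simp_all
    have w1: "rfact (real n / 2 + (real n / 2 - real x)) = fact (n - x)"
      "rfact (real n / 2 - (real n / 2 - real x)) = fact x"
      "rfact (real n / 2 + (real y - real n / 2)) = fact y"
      "rfact (real n / 2 - (real y - real n / 2)) = fact (n - y)"
      "rfact (real l + of_int m) = fact (nat (int l + m))"
      "rfact (real l - of_int m) = fact (nat (int l - m))"
      using xy assms by (auto intro!: rfact_of_nat simp: of_nat_diff)
    have w2: "sqrt (fact (n - x) * fact x * fact (nat (int l + m)) * fact (nat (int l - m))
        * fact y * fact (n - y)) = M * (ladder_weight n x * ladder_weight n y)"
      unfolding M_def ladder_weight_def real_sqrt_mult[symmetric] by (simp add: algebra_simps)
    have "wigner3j (real n / 2) (real l) (real n / 2) (real n / 2 - real x) (of_int m) (real y - real n / 2)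
       = (-1) powi (int n - int l - int y) * K * (M * (ladder_weight n x * ladder_weight n y))
         * (racah_sum n l (int x) (int y) / (fact l * fact l * fact (n - l)))"
      unfolding wigner3j_def fl w1 w2 racah_range_sum[OF assms(1) True] K_def
      using guard ints by simp
    moreover have "(-1) powi (int n - int x) * (-1) powi (int n - int l - int y) = ((-1) powi (int l + m) :: real)"
      using True by (auto simp: minus_one_powi)
    ultimately show ?thesis using True by (simp add: harmonic_entry_def c_def mult.assoc[symmetric])
  qed
  ultimately show ?thesis by blast
qed

lemma T_basis_harmonic:
  assumes "l < CARD('n)" "\<bar>m\<bar> \<le> int l"
  shows "\<exists>c\<noteq>0. (T_basis l m :: 'n::{finite,linorder} cmatrix) = c *\<^sub>R harmonic l m"
proof -
  define n where "n = CARD('n) - 1"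
  have s: "spin CARD('n) = real n / 2" by (simp add: spin_def n_def of_nat_diff)
  have mag: "magnetic i = real (pos i) - real n / 2" for i :: 'n
    by (simp add: magnetic_def pos_def s)
  have fl: "\<lfloor>real n - real x\<rfloor> = int n - int x" for x
    by (rule floor_unique) simp_all
  have ln: "l \<le> n" using assms by (simp add: n_def)
  obtain c where "c \<noteq> 0" and c: "\<And>x y. x \<le> n \<Longrightarrow> y \<le> n \<Longrightarrow> (-1) powi (int n - int x) *
      wigner3j (real n / 2) (real l) (real n / 2) (real n / 2 - real x) (of_int m) (real y - real n / 2)
      = c * harmonic_entry n l m x y"
    using wigner3j_harmonic_entry[of l n m] assms ln by blast
  define b where "b = sqrt (real CARD('n) / (4 * pi)) * sqrt (2 * real l + 1) * c"
  have "b \<noteq> 0" using \<open>c \<noteq> 0\<close> by (simp add: b_def)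
  moreover have "T_basis l m $ i $ j = (b *\<^sub>R harmonic l m :: 'n cmatrix) $ i $ j" for i j :: 'n
  proof -
    have "(T_basis l m :: 'n cmatrix) $ i $ j = complex_of_real (sqrt (real CARD('n) / (4 * pi)) * sqrt (2 * real l + 1)
      * ((-1) powi (int n - int (pos i)) *
      wigner3j (real n / 2) (real l) (real n / 2) (real n / 2 - real (pos i)) (of_int m) (real (pos j) - real n / 2)))"
      by (simp add: T_basis_def Let_def s mag fl)
    also have "\<dots> = complex_of_real (b * harmonic_entry n l m (pos i) (pos j))"
      using c[of "pos i" "pos j"] pos_le[of i] pos_le[of j] by (simp add: n_def b_def)
    finally show ?thesis by (simp add: harmonic_def pos_matrix_def n_def) (simp add: scaleR_conv_of_real)
  qed
  ultimately show ?thesis by (metis vec_eq_iff)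
qed


section \<open>The discrete Laplacian as a Casimir operator\<close>

text \<open>
  The adjoint of a commutator is the commutator with the conjugate transpose, so that taking
  commutators with \<open>S\<^sub>+\<close> and \<open>S\<^sub>-\<close> are mutually adjoint operations.
\<close>

lemma inner_commutator: "commutator A X \<bullet> Y = X \<bullet> commutator (ctranspose A) Y"
proof -
  have "trace (ctranspose A ** ctranspose X ** Y) = trace (ctranspose X ** (Y ** ctranspose A))"
    by (metis matrix_mul_assoc trace_mul_sym)
  then show ?thesis
    by (simp add: inner_eq_trace commutator_def ctranspose_mult matrix_ring_simps trace_add trace_sub
        matrix_mul_assoc)
qed

lemma trace_commutator: "trace (commutator A X ** Y) = - trace (X ** commutator A Y)"
proof -
  have "trace (A ** X ** Y) = trace (X ** (Y ** A))" by (metis matrix_mul_assoc trace_mul_sym)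
  then show ?thesis
    by (simp add: commutator_def matrix_ring_simps trace_sub matrix_mul_assoc)
qed

lemma trace_commutator_0: "trace (commutator A X) = 0"
  by (simp add: commutator_def trace_sub trace_mul_sym[of A X])

lemma casimir_simps:
  "casimir (X + Y) = casimir X + casimir Y"
  "casimir (X - Y) = casimir X - casimir Y"
  "casimir (cscale z X) = cscale z (casimir X)"
  "casimir (c *\<^sub>R X) = c *\<^sub>R casimir X"
proof -
  show "casimir (cscale z X) = cscale z (casimir X)"
    by (simp add: casimir_def commutator_simps)
      (simp add: cscale_def vec_eq_iff scaleR_conv_of_real algebra_simps)
qed (simp_all add: casimir_def commutator_simps algebra_simps)

lemma casimir_0: "casimir 0 = 0"
  using casimir_simps(4)[of 0 0] by simp

lemma casimir_ctranspose: "casimir (ctranspose X) = ctranspose (casimir X)"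
  by (simp add: casimir_def ctranspose_commutator ctranspose_spin commutator_simps)
    (simp add: commutator_def algebra_simps matrix_ring_simps)

lemma casimir_inner: "casimir X \<bullet> Y = X \<bullet> casimir Y"
  by (simp add: casimir_def inner_simps inner_commutator ctranspose_spin add.commute)

lemma casimir_trace: "trace (casimir X ** Y) = trace (X ** casimir Y)"
  by (simp add: casimir_def matrix_ring_simps trace_add trace_linear_simps trace_commutator add.commute)

lemma casimir_traceless: "trace (casimir X) = 0"
  by (simp add: casimir_def trace_add trace_linear_simps trace_commutator_0)

lemma casimir_inner_self:
  "X \<bullet> casimir X = (1/2) * ((norm (commutator spin_lower X))\<^sup>2 + (norm (commutator spin_raise X))\<^sup>2)
     + (norm (commutator spin_z X))\<^sup>2"
proof -
  have "X \<bullet> commutator spin_raise Y = commutator spin_lower X \<bullet> Y"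
    "X \<bullet> commutator spin_lower Y = commutator spin_raise X \<bullet> Y"
    "X \<bullet> commutator spin_z Y = commutator spin_z X \<bullet> Y" for Y
    by (simp_all add: inner_commutator ctranspose_spin)
  then show ?thesis by (simp add: casimir_def inner_simps power2_norm_eq_inner)
qed

text \<open>
  The quadratic form of the Casimir operator is a sum of squares, so a matrix in the kernel
  commutes with \<open>S\<^sub>z\<close>, hence is diagonal, and with \<open>S\<^sub>+\<close>, hence is scalar.
\<close>

lemma casimir_kernel:
  assumes "casimir X = 0" "trace X = 0"
  shows "(X :: 'n::{finite,linorder} cmatrix) = 0"
proof -
  have 0: "(1/2) * ((norm (commutator spin_lower X))\<^sup>2 + (norm (commutator spin_raise X))\<^sup>2)
     + (norm (commutator spin_z X))\<^sup>2 = 0"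
    using casimir_inner_self[of X] assms by simp
  have "(norm (commutator spin_z X))\<^sup>2 = 0" "(norm (commutator spin_raise X))\<^sup>2 = 0"
    using 0 by (simp_all add: add_nonneg_eq_0_iff)
  then have z: "commutator spin_z X = 0" and r: "spin_raise ** X = X ** spin_raise"
    by (simp_all add: commutator_def)
  have "commutator spin_z X $ i $ j = of_real (real (pos i) - real (pos j)) * X $ i $ j" for i j
  proof -
    have "(spin_z ** X) $ i $ j = (\<Sum>k\<in>UNIV. if k = i then of_nat (pos i) * X $ k $ j else 0)"
      unfolding matrix_matrix_mult_def spin_z_def pos_matrix_def vec_lambda_beta
      by (intro sum.cong) (auto simp: inj_eq[OF inj_pos])
    moreover have "(X ** spin_z) $ i $ j = (\<Sum>k\<in>UNIV. if k = j then of_nat (pos j) * X $ i $ k else 0)"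
      unfolding matrix_matrix_mult_def spin_z_def pos_matrix_def vec_lambda_beta
      by (intro sum.cong) (auto simp: inj_eq[OF inj_pos])
    ultimately show ?thesis by (simp add: commutator_def algebra_simps)
  qed
  note entry = this
  have diag: "X $ i $ j = 0" if "i \<noteq> j" for i j
  proof -
    have "pos i \<noteq> pos j" using that by (simp add: inj_eq[OF inj_pos])
    moreover have "of_real (real (pos i) - real (pos j)) * X $ i $ j = 0"
      using entry[of i j] z by simp
    ultimately show ?thesis by simp
  qed
  have step: "X $ j $ j = X $ i $ i" if "pos i = Suc (pos j)" for i j :: 'n
  proof -
    have "(spin_raise ** X) $ i $ j = (\<Sum>k\<in>UNIV. if k = j then (spin_raise :: 'n cmatrix) $ i $ j * X $ j $ j else 0)"
      unfolding matrix_matrix_mult_def vec_lambda_beta by (intro sum.cong) (auto simp: diag)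
    moreover have "(X ** spin_raise) $ i $ j = (\<Sum>k\<in>UNIV. if k = i then (spin_raise :: 'n cmatrix) $ i $ j * X $ i $ i else 0)"
      unfolding matrix_matrix_mult_def vec_lambda_beta by (intro sum.cong) (auto simp: diag)
    ultimately have "(spin_raise :: 'n cmatrix) $ i $ j * X $ j $ j = (spin_raise :: 'n cmatrix) $ i $ j * X $ i $ i"
      using r by auto
    moreover have "(spin_raise :: 'n cmatrix) $ i $ j \<noteq> 0"
      using that pos_bound[of i] by (simp add: spin_raise_def pos_matrix_def ladder_def of_nat_diff)
    ultimately show ?thesis by simp
  qed
  obtain i0 :: 'n where i0: "pos i0 = 0" using pos_surj[of 0] by auto
  have const: "X $ i $ i = X $ i0 $ i0" for i
  proof (induction "pos i" arbitrary: i)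
    case 0
    then show ?case using i0 inj_pos by (metis injD)
  next
    case (Suc k)
    then obtain j :: 'n where "pos j = k" using pos_surj[of k, where 'n='n] pos_bound[of i] by auto
    then show ?case using Suc.hyps(1)[of j] Suc.hyps(2) step[of i j] by simp
  qed
  have "of_nat CARD('n) * X $ i0 $ i0 = trace X"
    unfolding trace_def by (subst const) simp
  then have "X $ i0 $ i0 = 0" using assms(2) by simp
  then show ?thesis using diag const by (metis vec_eq_iff zero_index)
qed

lemma inner_cscale_ii:
  "cscale \<i> X \<bullet> cscale \<i> Y = X \<bullet> (Y :: complex^'n::finite^'m::finite)"
  by (simp add: inner_vec_def cscale_def inner_complex_def add.commute)

lemma inner_pos_matrix_ii:
  "pos_matrix f \<bullet> cscale \<i> (pos_matrix g) = 0" "cscale \<i> (pos_matrix f) \<bullet> pos_matrix g = 0"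
  by (simp_all add: inner_vec_def cscale_def inner_complex_def pos_matrix_def)

text \<open>
  For equal \<open>l\<close> the matrices live on different diagonals; for different \<open>l\<close> they are eigenvectors
  of a self-adjoint operator for different eigenvalues.
\<close>

lemma harmonic_orthogonal:
  assumes "l < CARD('n)" "l' < CARD('n)" "(l, m) \<noteq> (l', m')"
  shows "(harmonic l m :: 'n::{finite,linorder} cmatrix) \<bullet> harmonic l' m' = 0"
proof (cases "l = l'")
  case True
  then have "harmonic_entry (CARD('n) - 1) l m x y * harmonic_entry (CARD('n) - 1) l' m' x y = 0" for x y
    using assms by (auto simp: harmonic_entry_def)
  then show ?thesis
    by (auto simp: harmonic_def pos_matrix_def inner_vec_def inner_complex_def intro!: sum.neutral)
next
  case False
  have "real l * (real l + 1) * (harmonic l m \<bullet> (harmonic l' m' :: 'n cmatrix))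
      = real l' * (real l' + 1) * (harmonic l m \<bullet> (harmonic l' m' :: 'n cmatrix))"
    using casimir_inner[of "harmonic l m :: 'n cmatrix" "harmonic l' m'"]
    by (simp add: casimir_harmonic assms)
  moreover have "real l * (real l + 1) \<noteq> real l' * (real l' + 1)"
  proof -
    have "(real l - real l') * (real l + real l' + 1) \<noteq> 0" using False
      by (simp add: add_nonneg_eq_0_iff)
    then show ?thesis by (auto simp: algebra_simps)
  qed
  ultimately show ?thesis by simp
qed

definition harmonic_index :: "nat \<Rightarrow> (nat \<times> int) set" where
  "harmonic_index N = (SIGMA l:{..<N}. {- int l..int l})"

lemma card_harmonic_index: "card (harmonic_index N) = N * N"
proof -
  have "card (harmonic_index N) = (\<Sum>l<N. 2 * l + 1)"
    unfolding harmonic_index_def by (subst card_SigmaI) (auto intro!: sum.cong)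
  also have "\<dots> = N * N" by (induction N) auto
  finally show ?thesis .
qed

text \<open>
  A dimension count over the reals, where the space has dimension \<open>2 N\<^sup>2\<close>: the \<open>N\<^sup>2\<close> harmonic
  matrices are supplemented by their multiples by \<open>\<i>\<close>, orthogonal to them since all
  entries are real.
\<close>

lemma span_harmonic:
  "span ((\<lambda>(b, l, m). if b then harmonic l m else cscale \<i> (harmonic l m))
      ` (UNIV \<times> harmonic_index CARD('n))) = (UNIV :: 'n::{finite,linorder} cmatrix set)"
  (is "span (?f ` ?I) = _")
proof -
  have orth: "?f p \<bullet> ?f q = 0" if "p \<in> ?I" "q \<in> ?I" "p \<noteq> q" for p q
  proof -
    obtain b l m where p: "p = (b, l, m)" by (cases p)
    obtain b' l' m' where q: "q = (b', l', m')" by (cases q)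
    show ?thesis
    proof (cases "(l, m) = (l', m')")
      case True
      then show ?thesis using that p q by (auto simp: harmonic_def inner_pos_matrix_ii)
    next
      case False
      then have "(harmonic l m :: 'n cmatrix) \<bullet> harmonic l' m' = 0"
        using that p q by (intro harmonic_orthogonal) (auto simp: harmonic_index_def)
      then show ?thesis unfolding p q
        by (auto simp: inner_cscale_ii) (auto simp: harmonic_def inner_pos_matrix_ii)
    qed
  qed
  have nz: "?f p \<noteq> 0" if "p \<in> ?I" for p
  proof -
    obtain b l m where p: "p = (b, l, m)" by (cases p)
    have "(harmonic l m :: 'n cmatrix) \<noteq> 0"
      using that p by (intro harmonic_nonzero) (auto simp: harmonic_index_def)
    then show ?thesis unfolding p using inner_cscale_ii[of "harmonic l m :: 'n cmatrix" "harmonic l m"]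
      by auto
  qed
  define f where "f = ?f"
  have orth_f: "orthogonal (f p) (f q)" if "p \<in> ?I" "q \<in> ?I" "p \<noteq> q" for p q
    unfolding f_def orthogonal_def using that by (rule orth)
  have nz_f: "f p \<noteq> 0" if "p \<in> ?I" for p unfolding f_def using that by (rule nz)
  have inj: "inj_on f ?I"
  proof (rule inj_onI, rule ccontr)
    fix p q assume pq: "p \<in> ?I" "q \<in> ?I" "f p = f q" "p \<noteq> q"
    then have "orthogonal (f p) (f p)" using orth_f[of p q] by simp
    then show False using nz_f[OF pq(1)] by (simp add: orthogonal_self)
  qed
  have "independent (f ` ?I)"
  proof (rule pairwise_orthogonal_independent)
    show "pairwise orthogonal (f ` ?I)"
    proof (rule pairwiseI)
      fix x y assume "x \<in> f ` ?I" "y \<in> f ` ?I" and ne: "x \<noteq> y"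
      then obtain p q where "p \<in> ?I" "q \<in> ?I" and xy: "x = f p" "y = f q" by blast
      moreover have "p \<noteq> q" using ne xy by blast
      ultimately show "orthogonal x y" using orth_f by simp
    qed
    show "0 \<notin> f ` ?I" using nz_f by force
  qed
  then have "dim (f ` ?I) = card (f ` ?I)" by (rule dim_eq_card_independent)
  also have "\<dots> = card ?I" by (rule card_image[OF inj])
  also have "\<dots> = DIM('n cmatrix)"
    by (simp add: card_harmonic_index card_cartesian_product)
  finally show ?thesis by (simp only: dim_eq_full f_def)
qed

lemma vector_space_cscale: "vector_space (cscale :: complex \<Rightarrow> complex^'n::finite^'m::finite \<Rightarrow> _)"
  by unfold_locales (simp_all add: cscale_def vec_eq_iff algebra_simps)

text \<open>
  The basis property is what makes the defining description of the Laplacian unique.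
\<close>

lemma discrete_laplacian_casimir:
  "(discrete_laplacian :: 'n::{finite,linorder} cmatrix \<Rightarrow> _) = (\<lambda>X. - casimir X)"
proof -
  let ?P = "\<lambda>L :: 'n cmatrix \<Rightarrow> 'n cmatrix. Vector_Spaces.linear cscale cscale L \<and>
        (\<forall>l m. l < CARD('n) \<and> \<bar>m\<bar> \<le> int l \<longrightarrow>
           L (T_basis l m) = cscale (- (of_nat l * (of_nat l + 1))) (T_basis l m))"
  have cR: "cscale (of_real r) X = r *\<^sub>R X" for r and X :: "'n cmatrix"
    by (simp add: cscale_def vec_eq_iff) (simp add: scaleR_conv_of_real)
  have lin: "Vector_Spaces.linear cscale cscale (\<lambda>X :: 'n cmatrix. - casimir X)"
    unfolding Vector_Spaces.linear_iff
    by (simp add: vector_space_cscale casimir_simps) (simp add: cscale_def vec_eq_iff)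
  have eig: "- casimir (T_basis l m :: 'n cmatrix) = cscale (- (of_nat l * (of_nat l + 1))) (T_basis l m)"
    if lm: "l < CARD('n)" "\<bar>m\<bar> \<le> int l" for l m
  proof -
    obtain c where "(T_basis l m :: 'n cmatrix) = c *\<^sub>R harmonic l m"
      using T_basis_harmonic[OF lm] by blast
    then have "- casimir (T_basis l m :: 'n cmatrix) = (- (real l * (real l + 1))) *\<^sub>R T_basis l m"
      by (simp add: casimir_simps casimir_harmonic[OF lm(1)])
    also have "\<dots> = cscale (of_real (- (real l * (real l + 1)))) (T_basis l m)" by (rule cR[symmetric])
    finally show ?thesis by simp
  qed
  have uniq: "L = (\<lambda>X. - casimir X)" if L: "?P L" for L
  proof -
    interpret L: module_hom cscale cscale L
      using L by (simp add: module_hom_iff_linear)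
    have Lr: "L (r *\<^sub>R X) = r *\<^sub>R L X" for r X
      using L.scale[of "of_real r" X] by (simp only: cR)
    define K where "K = {X. L X = - casimir X}"
    have sub: "subspace K"
      unfolding K_def subspace_def by (simp add: L.zero L.add Lr casimir_simps casimir_0)
    have h: "harmonic l m \<in> K" if "(l, m) \<in> harmonic_index CARD('n)" for l m
    proof -
      have lm: "l < CARD('n)" "\<bar>m\<bar> \<le> int l" using that by (auto simp: harmonic_index_def)
      obtain c where c: "c \<noteq> 0" "(T_basis l m :: 'n cmatrix) = c *\<^sub>R harmonic l m"
        using T_basis_harmonic[OF lm] by blast
      have "T_basis l m \<in> K" using L lm eig unfolding K_def by auto
      then have "(1 / c) *\<^sub>R T_basis l m \<in> K" using sub by (simp add: subspace_def)
      then show ?thesis using c by simp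
    qed
    have hi: "cscale \<i> X \<in> K" if "X \<in> K" for X
      using that unfolding K_def mem_Collect_eq L.scale casimir_simps
      by (simp only:) (simp add: cscale_def vec_eq_iff)
    have "X \<in> K" for X
    proof -
      have "span ((\<lambda>(b, l, m). if b then harmonic l m else cscale \<i> (harmonic l m))
         ` (UNIV \<times> harmonic_index CARD('n))) \<subseteq> K"
        by (intro span_minimal sub) (use h hi in auto)
      then show ?thesis unfolding span_harmonic by auto
    qed
    then show ?thesis unfolding K_def by auto
  qed
  show ?thesis unfolding discrete_laplacian_def
    by (rule the_equality) (use lin eig uniq in blast)+
qed

section \<open>The stream matrix\<close>

text \<open>
  Commutators are traceless, and injectivity suffices in finite dimension.
\<close>

lemma laplacian_bij_traceless:
  "bij_betw (discrete_laplacian :: 'n::{finite,linorder} cmatrix \<Rightarrow> _) {A. trace A = 0} {A. trace A = 0}"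
proof -
  let ?Z = "{A :: 'n cmatrix. trace A = 0}" and ?L = "\<lambda>X :: 'n cmatrix. - casimir X"
  have lin: "linear ?L" by (auto intro!: linearI simp: casimir_simps)
  have subZ: "subspace ?Z" by (simp add: subspace_def trace_add trace_linear_simps)
  have inj: "inj_on ?L ?Z"
  proof (rule inj_onI)
    fix X Y :: "'n cmatrix" assume "X \<in> ?Z" "Y \<in> ?Z" "- casimir X = - casimir Y"
    then have "casimir (X - Y) = 0" "trace (X - Y) = 0" by (simp_all add: casimir_simps trace_sub)
    then show "X = Y" using casimir_kernel[of "X - Y"] by simp
  qed
  have sub: "?L ` ?Z \<subseteq> ?Z" by (auto simp: trace_linear_simps casimir_traceless)
  have "dim (?L ` ?Z) = dim ?Z"
    by (rule dim_image_eq[OF lin]) (simp only: span_eq_iff[THEN iffD2, OF subZ] inj)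
  then have "?L ` ?Z = ?Z"
    using subspace_dim_equal[OF linear_subspace_image[OF lin subZ] subZ sub] by simp
  then show ?thesis using inj by (simp add: bij_betw_def discrete_laplacian_casimir)
qed

lemma stream_matrix_spec:
  fixes X :: "'n::{finite,linorder} cmatrix"
  shows "trace (stream_matrix X) = 0"
    and "- casimir (stream_matrix X) = X - cscale (trace X / of_nat CARD('n)) (mat 1)"
proof -
  let ?Y = "X - cscale (trace X / of_nat CARD('n)) (mat 1)"
  have tr: "trace (cscale c (mat 1) :: 'n cmatrix) = c * of_nat CARD('n)" for c
    by (simp add: trace_def cscale_def mat_def)
  have Y: "?Y \<in> {A. trace A = 0}" by (simp add: trace_sub tr)
  note bij = laplacian_bij_traceless[where 'n='n, unfolded bij_betw_def]
  show "trace (stream_matrix X) = 0"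
    using the_inv_into_into[of discrete_laplacian "{A. trace A = 0}" ?Y "{A. trace A = 0}"] bij Y
    by (simp add: stream_matrix_def)
  have "discrete_laplacian (stream_matrix X) = ?Y"
    using f_the_inv_into_f[of discrete_laplacian "{A. trace A = 0}" ?Y] bij Y
    by (simp add: stream_matrix_def)
  then show "- casimir (stream_matrix X) = ?Y" by (simp add: discrete_laplacian_casimir)
qed

lemma stream_matrix_unique:
  fixes X :: "'n::{finite,linorder} cmatrix"
  assumes "trace A = 0" "- casimir A = X - cscale (trace X / of_nat CARD('n)) (mat 1)"
  shows "stream_matrix X = A"
proof -
  have "casimir (stream_matrix X - A) = 0"
    using stream_matrix_spec(2)[of X] assms(2) by (simp add: casimir_simps) (metis neg_equal_iff_equal)
  moreover have "trace (stream_matrix X - A) = 0"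
    by (simp add: trace_sub assms stream_matrix_spec)
  ultimately show ?thesis using casimir_kernel by (metis eq_iff_diff_eq_0)
qed

lemma linear_stream_matrix: "linear (stream_matrix :: 'n::{finite,linorder} cmatrix \<Rightarrow> _)"
proof (rule linearI)
  fix X Y :: "'n cmatrix" and r :: real
  show "stream_matrix (X + Y) = stream_matrix X + stream_matrix Y"
  proof (rule stream_matrix_unique)
    show "- casimir (stream_matrix X + stream_matrix Y)
        = X + Y - cscale (trace (X + Y) / of_nat CARD('n)) (mat 1)"
      using stream_matrix_spec(2)[of X] stream_matrix_spec(2)[of Y]
      by (simp add: casimir_simps trace_add add_divide_distrib cscale_def vec_eq_iff algebra_simps)
  qed (simp add: trace_add stream_matrix_spec)
  show "stream_matrix (r *\<^sub>R X) = r *\<^sub>R stream_matrix X"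
  proof (rule stream_matrix_unique)
    have "- casimir (r *\<^sub>R stream_matrix X) = r *\<^sub>R (- casimir (stream_matrix X))"
      by (simp add: casimir_simps)
    then show "- casimir (r *\<^sub>R stream_matrix X)
        = r *\<^sub>R X - cscale (trace (r *\<^sub>R X) / of_nat CARD('n)) (mat 1)"
      unfolding stream_matrix_spec(2)
      by (simp add: trace_linear_simps cscale_def vec_eq_iff scaleR_diff_right)
        (simp add: scaleR_conv_of_real)
  qed (simp add: trace_linear_simps stream_matrix_spec)
qed

lemma ctranspose_cscale: "ctranspose (cscale c A) = cscale (cnj c) (ctranspose A)"
  by (simp add: ctranspose_def cscale_def vec_eq_iff)

lemma matrix_mult_cscale: "A ** cscale c B = cscale c (A ** B)" "cscale c A ** B = cscale c (A ** B)"
  by (simp_all add: cscale_def matrix_matrix_mult_def vec_eq_iff sum_distrib_left algebra_simps)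

lemma stream_matrix_ctranspose: "stream_matrix (ctranspose X) = ctranspose (stream_matrix X)"
proof (rule stream_matrix_unique)
  have "- casimir (ctranspose (stream_matrix X)) = ctranspose (- casimir (stream_matrix X))"
    by (simp add: casimir_ctranspose)
  then show "- casimir (ctranspose (stream_matrix X))
      = ctranspose X - cscale (trace (ctranspose X) / of_nat CARD('a)) (mat 1)"
    unfolding stream_matrix_spec(2) by (simp add: trace_ctranspose ctranspose_cscale)
qed (simp add: trace_ctranspose stream_matrix_spec)

text \<open>
  Inherited from the Casimir operator; the scalar parts of \<open>X\<close> and \<open>Y\<close> do not contribute,
  since stream matrices are traceless.
\<close>

lemma stream_matrix_trace:
  fixes X Y :: "'n::{finite,linorder} cmatrix"
  shows "trace (stream_matrix X ** Y) = trace (X ** stream_matrix Y)"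
proof -
  let ?A = "stream_matrix X" and ?B = "stream_matrix Y"
  have Y: "Y = - casimir ?B + cscale (trace Y / of_nat CARD('n)) (mat 1)"
    and X: "X = - casimir ?A + cscale (trace X / of_nat CARD('n)) (mat 1)"
    by (simp_all add: stream_matrix_spec)
  have s: "trace (cscale c Z) = c * trace Z" for c and Z :: "'n cmatrix"
    by (simp add: cscale_def trace_def sum_distrib_left)
  have "trace (?A ** Y) = - trace (?A ** casimir ?B)"
    by (subst Y) (simp add: matrix_ring_simps trace_sub trace_add trace_linear_simps s matrix_mult_cscale stream_matrix_spec(1))
  moreover have "trace (X ** ?B) = - trace (casimir ?A ** ?B)"
    by (subst X) (simp add: matrix_ring_simps trace_sub trace_add trace_linear_simps s matrix_mult_cscale stream_matrix_spec(1))
  ultimately show ?thesis by (simp add: casimir_trace)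
qed


section \<open>Small perturbations of the identity\<close>

text \<open>
  The vector fields are polynomial, and this is the regularity that the uniform estimates
  use.
\<close>

definition lipschitz_on_balls :: "('a::real_normed_vector \<Rightarrow> 'b::real_normed_vector) \<Rightarrow> bool" where
  "lipschitz_on_balls f \<longleftrightarrow>
     (\<forall>R. \<exists>L\<ge>0. \<forall>x y. norm x \<le> R \<and> norm y \<le> R \<longrightarrow> norm (f x - f y) \<le> L * norm (x - y))"

lemma lipschitz_on_ballsE:
  assumes "lipschitz_on_balls f"
  obtains L where "L \<ge> 0" "\<And>x y. norm x \<le> R \<Longrightarrow> norm y \<le> R \<Longrightarrow> norm (f x - f y) \<le> L * norm (x - y)"
  using assms unfolding lipschitz_on_balls_def by metis

lemma lipschitz_on_balls_bounded:
  assumes "lipschitz_on_balls f"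
  obtains B where "B > 0" "\<And>x. norm x \<le> R \<Longrightarrow> norm (f x) \<le> B"
proof -
  obtain L where L: "L \<ge> 0" "\<And>x y. norm x \<le> R \<Longrightarrow> norm y \<le> R \<Longrightarrow> norm (f x - f y) \<le> L * norm (x - y)"
    using lipschitz_on_ballsE[OF assms, of R] by blast
  have "norm (f x) \<le> L * \<bar>R\<bar> + norm (f 0) + 1" if x: "norm x \<le> R" for x
  proof -
    have "0 \<le> R" using x norm_ge_zero[of x] by linarith
    then have "norm (f x - f 0) \<le> L * norm x" using L(2)[of x 0] x by simp
    also have "\<dots> \<le> L * \<bar>R\<bar>" using x L(1) by (intro mult_left_mono) auto
    finally show ?thesis using norm_triangle_ineq2[of "f x" "f 0"] by linarith
  qed
  moreover have "L * \<bar>R\<bar> + norm (f 0) + 1 > 0" using L(1)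
    by (intro add_nonneg_pos add_nonneg_nonneg mult_nonneg_nonneg) auto
  ultimately show thesis using that by blast
qed

lemma lipschitz_on_balls_linear:
  assumes "bounded_linear f" shows "lipschitz_on_balls f"
proof -
  interpret bounded_linear f by fact
  obtain K where "K \<ge> 0" "\<And>x. norm (f x) \<le> norm x * K" using nonneg_bounded by blast
  then show ?thesis unfolding lipschitz_on_balls_def by (metis diff mult.commute)
qed

lemma lipschitz_on_balls_const: "lipschitz_on_balls (\<lambda>_. c)"
  unfolding lipschitz_on_balls_def by (auto intro: exI[of _ 0])

lemma lipschitz_on_balls_bilinear:
  assumes "bounded_bilinear pr" and f: "lipschitz_on_balls f" and g: "lipschitz_on_balls g"
  shows "lipschitz_on_balls (\<lambda>x. pr (f x) (g x))"
  unfolding lipschitz_on_balls_def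
proof
  fix R
  interpret bounded_bilinear "pr" by fact
  obtain K where K: "K \<ge> 0" "\<And>a b. norm (pr a b) \<le> norm a * norm b * K" using nonneg_bounded by blast
  obtain L1 where L1: "L1 \<ge> 0" "\<And>x y. norm x \<le> R \<Longrightarrow> norm y \<le> R \<Longrightarrow> norm (f x - f y) \<le> L1 * norm (x - y)"
    using lipschitz_on_ballsE[OF f, of R] by blast
  obtain L2 where L2: "L2 \<ge> 0" "\<And>x y. norm x \<le> R \<Longrightarrow> norm y \<le> R \<Longrightarrow> norm (g x - g y) \<le> L2 * norm (x - y)"
    using lipschitz_on_ballsE[OF g, of R] by blast
  obtain B1 where B1: "B1 > 0" "\<And>x. norm x \<le> R \<Longrightarrow> norm (f x) \<le> B1" using lipschitz_on_balls_bounded[OF f, of R] by blast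
  obtain B2 where B2: "B2 > 0" "\<And>x. norm x \<le> R \<Longrightarrow> norm (g x) \<le> B2" using lipschitz_on_balls_bounded[OF g, of R] by blast
  have "norm (pr (f x) (g x) - pr (f y) (g y)) \<le> (L1 * B2 * K + B1 * L2 * K) * norm (x - y)"
    if "norm x \<le> R" "norm y \<le> R" for x y
  proof -
    have "pr (f x) (g x) - pr (f y) (g y) = pr (f x - f y) (g x) + pr (f y) (g x - g y)"
      by (simp add: diff_left diff_right)
    also have "norm \<dots> \<le> norm (f x - f y) * norm (g x) * K + norm (f y) * norm (g x - g y) * K"
      by (intro norm_triangle_le add_mono K)
    also have "\<dots> \<le> (L1 * norm (x - y)) * B2 * K + B1 * (L2 * norm (x - y)) * K"
      using L1 L2 B1 B2 K that by (intro add_mono mult_mono mult_nonneg_nonneg) (auto simp: less_imp_le)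
    finally show ?thesis by (simp add: algebra_simps)
  qed
  moreover have "L1 * B2 * K + B1 * L2 * K \<ge> 0" using L1 L2 B1 B2 K by (simp add: less_imp_le)
  ultimately show "\<exists>L\<ge>0. \<forall>x y. norm x \<le> R \<and> norm y \<le> R \<longrightarrow> norm (pr (f x) (g x) - pr (f y) (g y)) \<le> L * norm (x - y)"
    by blast
qed

lemma lipschitz_on_balls_compose_linear:
  assumes "bounded_linear h" "lipschitz_on_balls f"
  shows "lipschitz_on_balls (\<lambda>x. h (f x))"
  unfolding lipschitz_on_balls_def
proof
  fix R
  interpret h: bounded_linear h by fact
  obtain K where K: "K \<ge> 0" "\<And>x. norm (h x) \<le> norm x * K" using h.nonneg_bounded by blast
  obtain L where L: "L \<ge> 0" "\<And>x y. norm x \<le> R \<Longrightarrow> norm y \<le> R \<Longrightarrow> norm (f x - f y) \<le> L * norm (x - y)"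
    using lipschitz_on_ballsE[OF assms(2), of R] by blast
  have "norm (h (f x) - h (f y)) \<le> (L * K) * norm (x - y)" if "norm x \<le> R" "norm y \<le> R" for x y
  proof -
    have "norm (h (f x - f y)) \<le> norm (f x - f y) * K" by (rule K)
    also have "\<dots> \<le> (L * norm (x - y)) * K" using L that K by (intro mult_right_mono) auto
    finally show ?thesis by (simp add: h.diff algebra_simps)
  qed
  then show "\<exists>L\<ge>0. \<forall>x y. norm x \<le> R \<and> norm y \<le> R \<longrightarrow> norm (h (f x) - h (f y)) \<le> L * norm (x - y)"
    using L K by (intro exI[of _ "L * K"]) auto
qed

lemma lipschitz_on_balls_diff:
  assumes f: "lipschitz_on_balls f" and g: "lipschitz_on_balls g"
  shows "lipschitz_on_balls (\<lambda>x. f x - g x)"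
  unfolding lipschitz_on_balls_def
proof
  fix R
  obtain L1 where L1: "L1 \<ge> 0" "\<And>x y. norm x \<le> R \<Longrightarrow> norm y \<le> R \<Longrightarrow> norm (f x - f y) \<le> L1 * norm (x - y)"
    using lipschitz_on_ballsE[OF f, of R] by blast
  obtain L2 where L2: "L2 \<ge> 0" "\<And>x y. norm x \<le> R \<Longrightarrow> norm y \<le> R \<Longrightarrow> norm (g x - g y) \<le> L2 * norm (x - y)"
    using lipschitz_on_ballsE[OF g, of R] by blast
  have "norm ((f x - g x) - (f y - g y)) \<le> (L1 + L2) * norm (x - y)" if "norm x \<le> R" "norm y \<le> R" for x y
  proof -
    have "norm ((f x - g x) - (f y - g y)) \<le> norm (f x - f y) + norm (g x - g y)"
      using norm_triangle_ineq4[of "f x - f y" "g x - g y"] by (simp add: algebra_simps)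
    then show ?thesis using L1(2)[OF that] L2(2)[OF that] by (simp add: algebra_simps)
  qed
  then show "\<exists>L\<ge>0. \<forall>x y. norm x \<le> R \<and> norm y \<le> R \<longrightarrow> norm ((f x - g x) - (f y - g y)) \<le> L * norm (x - y)"
    using L1 L2 by (intro exI[of _ "L1 + L2"]) auto
qed

text \<open>
  Written for the ball on which the perturbation is controlled; \<open>\<delta>\<close> is the radius in
  which the perturbed equation is to be solved.
\<close>

definition small_perturbation :: "real \<Rightarrow> real \<Rightarrow> ('a::real_normed_vector \<Rightarrow> 'a) \<Rightarrow> bool" where
  "small_perturbation R \<delta> g \<longleftrightarrow>
     (\<forall>x y. norm x \<le> R \<and> norm y \<le> R \<longrightarrow> norm (g x - g y) \<le> 1/2 * norm (x - y)) \<and>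
     (\<forall>x. norm x \<le> R \<longrightarrow> norm (g x) < \<delta>)"

lemma small_perturbation_small_step:
  fixes g1 g2 :: "'a::real_normed_vector \<Rightarrow> 'a"
  assumes g1: "lipschitz_on_balls g1" and g2: "lipschitz_on_balls g2" and "\<delta> > 0"
  shows "\<exists>a0>0. \<forall>a. \<bar>a\<bar> < a0 \<longrightarrow> small_perturbation R \<delta> (\<lambda>z. a *\<^sub>R g1 z + a\<^sup>2 *\<^sub>R g2 z)"
proof -
  obtain L1 where L1: "L1 \<ge> 0" "\<And>x y. norm x \<le> R \<Longrightarrow> norm y \<le> R \<Longrightarrow> norm (g1 x - g1 y) \<le> L1 * norm (x - y)"
    using lipschitz_on_ballsE[OF g1, of R] by blast
  obtain L2 where L2: "L2 \<ge> 0" "\<And>x y. norm x \<le> R \<Longrightarrow> norm y \<le> R \<Longrightarrow> norm (g2 x - g2 y) \<le> L2 * norm (x - y)"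
    using lipschitz_on_ballsE[OF g2, of R] by blast
  obtain B1 where B1: "B1 > 0" "\<And>x. norm x \<le> R \<Longrightarrow> norm (g1 x) \<le> B1" using lipschitz_on_balls_bounded[OF g1, of R] by blast
  obtain B2 where B2: "B2 > 0" "\<And>x. norm x \<le> R \<Longrightarrow> norm (g2 x) \<le> B2" using lipschitz_on_balls_bounded[OF g2, of R] by blast
  \<comment> \<open>\<open>|a| \<le> 1\<close> makes the quadratic term no larger than the linear one; the other two bounds give
    the contraction constant and the size\<close>
  define a0 where "a0 = min 1 (min (1 / (2 * (L1 + L2 + 1))) (\<delta> / (B1 + B2)))"
  have pos: "a0 > 0" using L1 L2 B1 B2 assms(3) by (auto simp: a0_def intro!: divide_pos_pos)
  have "small_perturbation R \<delta> (\<lambda>z. a *\<^sub>R g1 z + a\<^sup>2 *\<^sub>R g2 z)" if a: "\<bar>a\<bar> < a0" for a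
    unfolding small_perturbation_def
  proof (intro conjI allI impI)
    have sq: "a\<^sup>2 \<le> \<bar>a\<bar>" using a mult_left_le[of "\<bar>a\<bar>" "\<bar>a\<bar>"] by (simp add: a0_def power2_eq_square flip: abs_mult)
    fix x y :: 'a assume xy: "norm x \<le> R \<and> norm y \<le> R"
    have "norm ((a *\<^sub>R g1 x + a\<^sup>2 *\<^sub>R g2 x) - (a *\<^sub>R g1 y + a\<^sup>2 *\<^sub>R g2 y))
      = norm (a *\<^sub>R (g1 x - g1 y) + a\<^sup>2 *\<^sub>R (g2 x - g2 y))" by (simp add: algebra_simps)
    also have "\<dots> \<le> \<bar>a\<bar> * norm (g1 x - g1 y) + a\<^sup>2 * norm (g2 x - g2 y)"
      by (intro norm_triangle_le) simp
    also have "\<dots> \<le> \<bar>a\<bar> * (L1 * norm (x - y)) + \<bar>a\<bar> * (L2 * norm (x - y))"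
      using L1 L2 xy sq by (intro add_mono mult_mono) auto
    also have "\<dots> = (\<bar>a\<bar> * (L1 + L2)) * norm (x - y)" by (simp add: algebra_simps)
    also have "\<dots> \<le> 1/2 * norm (x - y)"
    proof (rule mult_right_mono)
      have "\<bar>a\<bar> * (L1 + L2) \<le> \<bar>a\<bar> * (L1 + L2 + 1)" by (intro mult_left_mono) auto
      also have "\<dots> \<le> 1 / (2 * (L1 + L2 + 1)) * (L1 + L2 + 1)"
        using a L1 L2 by (intro mult_right_mono) (auto simp: a0_def)
      also have "\<dots> = 1/2" using L1 L2 by (simp add: field_simps)
      finally show "\<bar>a\<bar> * (L1 + L2) \<le> 1/2" .
    qed simp
    finally show "norm ((a *\<^sub>R g1 x + a\<^sup>2 *\<^sub>R g2 x) - (a *\<^sub>R g1 y + a\<^sup>2 *\<^sub>R g2 y)) \<le> 1/2 * norm (x - y)" .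
  next
    have sq: "a\<^sup>2 \<le> \<bar>a\<bar>" using a mult_left_le[of "\<bar>a\<bar>" "\<bar>a\<bar>"] by (simp add: a0_def power2_eq_square flip: abs_mult)
    fix x :: 'a assume x: "norm x \<le> R"
    have "norm (a *\<^sub>R g1 x + a\<^sup>2 *\<^sub>R g2 x) \<le> \<bar>a\<bar> * norm (g1 x) + a\<^sup>2 * norm (g2 x)"
      by (intro norm_triangle_le) simp
    also have "\<dots> \<le> \<bar>a\<bar> * B1 + \<bar>a\<bar> * B2"
      using B1 B2 x sq by (intro add_mono mult_mono) auto
    also have "\<dots> = \<bar>a\<bar> * (B1 + B2)" by (simp add: algebra_simps)
    also have "\<dots> < \<delta> / (B1 + B2) * (B1 + B2)"
      using a B1 B2 by (intro mult_strict_right_mono) (auto simp: a0_def)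
    also have "\<dots> = \<delta>" using B1 B2 by simp
    finally show "norm (a *\<^sub>R g1 x + a\<^sup>2 *\<^sub>R g2 x) < \<delta>" .
  qed
  then show ?thesis using pos by blast
qed

text \<open>
  So the inverse of a small perturbation of the identity is Lipschitz continuous with
  constant \<open>2\<close>.
\<close>

lemma small_perturbation_contract:
  assumes "small_perturbation R \<delta> g" "norm x \<le> R" "norm y \<le> R"
  shows "norm (x - y) \<le> 2 * norm ((x - g x) - (y - g y))"
proof -
  have "x - y = ((x - g x) - (y - g y)) + (g x - g y)" by simp
  then have "norm (x - y) \<le> norm ((x - g x) - (y - g y)) + norm (g x - g y)"
    by (metis norm_triangle_ineq)
  moreover have "norm (g x - g y) \<le> 1/2 * norm (x - y)"
    using assms by (auto simp: small_perturbation_def)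
  ultimately show ?thesis by linarith
qed

lemma small_perturbation_unique_solution:
  fixes g :: "'a::banach \<Rightarrow> 'a"
  assumes g: "small_perturbation (R + \<delta>) \<delta> g" and y: "norm y \<le> R" and "\<delta> > 0"
  shows "\<exists>!z. dist z y < \<delta> \<and> z = y + g z"
proof -
  have ball: "norm z \<le> R + \<delta>" if "z \<in> cball y \<delta>" for z
    using that y norm_triangle_ineq2[of z y] by (simp add: dist_norm norm_minus_commute)
  have "\<exists>!z\<in>cball y \<delta>. y + g z = z"
  proof (rule Banach_fix)
    show "complete (cball y \<delta>)" by (simp add: complete_eq_closed)
    show "cball y \<delta> \<noteq> {}" using \<open>\<delta> > 0\<close> by simp
    show "(\<lambda>z. y + g z) ` cball y \<delta> \<subseteq> cball y \<delta>"
      using g ball by (force simp: small_perturbation_def dist_norm)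
    show "dist (y + g x) (y + g z) \<le> 1/2 * dist x z" if "x \<in> cball y \<delta>" "z \<in> cball y \<delta>" for x z
      using g ball[OF that(1)] ball[OF that(2)] by (simp add: small_perturbation_def dist_norm)
  qed simp_all
  then obtain z where z: "z \<in> cball y \<delta>" "z = y + g z"
    and uniq: "\<And>w. w \<in> cball y \<delta> \<Longrightarrow> y + g w = w \<Longrightarrow> w = z" by metis
  have "norm (g z) < \<delta>" using g ball[OF z(1)] by (auto simp: small_perturbation_def)
  then have "dist z y < \<delta>" using z(2) by (metis add_diff_cancel_left' dist_norm)
  then show ?thesis using z uniq by (intro ex1I[of _ z]) (auto simp: dist_commute less_imp_le)
qed

text \<open>
  If \<open>f' v = 0\<close>, then \<open>f\<close> grows less than linearly along \<open>v\<close>.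
\<close>

lemma derivative_injective_expanding:
  fixes f :: "'a::real_normed_vector \<Rightarrow> 'b::real_normed_vector"
  assumes f: "(f has_derivative f') (at z)" and "r > 0" "c > 0"
    and exp: "\<And>x. dist x z < r \<Longrightarrow> c * norm (x - z) \<le> norm (f x - f z)"
  shows "inj f'"
proof -
  interpret f': bounded_linear f' using f by (rule has_derivative_bounded_linear)
  have "v = 0" if v: "f' v = 0" for v
  proof (rule ccontr)
    assume "v \<noteq> 0"
    obtain d where "d > 0" and d: "\<And>y. norm (y - z) < d \<Longrightarrow> norm (f y - f z - f' (y - z)) \<le> c / 2 * norm (y - z)"
      using f \<open>c > 0\<close> unfolding has_derivative_at_alt by (metis half_gt_zero)
    define t where "t = min d r / (2 * norm v)"
    have t: "t > 0" "t * norm v < d" "t * norm v < r"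
      using \<open>d > 0\<close> \<open>r > 0\<close> \<open>v \<noteq> 0\<close> by (auto simp: t_def)
    have "norm (f (z + t *\<^sub>R v) - f z) \<le> c / 2 * (t * norm v)"
      using d[of "z + t *\<^sub>R v"] t v by (simp add: f'.scaleR)
    moreover have "c * (t * norm v) \<le> norm (f (z + t *\<^sub>R v) - f z)"
      using exp[of "z + t *\<^sub>R v"] t by (simp add: dist_norm)
    moreover have "c * (t * norm v) > 0" using \<open>c > 0\<close> t \<open>v \<noteq> 0\<close> by simp
    ultimately show False by linarith
  qed
  then show ?thesis by (simp add: f'.linear_axioms linear_injective_0)
qed

lemma vector_derivative_increment_bound:
  fixes y :: "real \<Rightarrow> 'a::real_normed_vector"
  assumes "\<And>s. s \<in> {0..T} \<Longrightarrow> (y has_vector_derivative y' s) (at s within {0..T})"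
    and "0 \<le> t" "t \<le> T" and B: "\<And>s. 0 \<le> s \<Longrightarrow> s \<le> t \<Longrightarrow> norm (y' s) \<le> B"
  shows "norm (y t - y 0) \<le> B * t"
proof -
  have "norm (y t - y 0) \<le> B * norm (t - 0)"
  proof (rule differentiable_bound[of "{0..t}"])
    fix s assume s: "s \<in> {0..t}"
    then have "(y has_vector_derivative y' s) (at s within {0..t})"
      using assms by (intro has_vector_derivative_within_subset[OF assms(1)]) auto
    then show "(y has_derivative (\<lambda>u. u *\<^sub>R y' s)) (at s within {0..t})"
      by (simp add: has_vector_derivative_def)
    show "onorm (\<lambda>u. u *\<^sub>R y' s) \<le> B"
      by (rule onorm_le) (use B[of s] s in \<open>auto simp: mult.commute[of B] intro: mult_left_mono\<close>)
  qed (use assms in auto)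
  then show ?thesis using assms by simp
qed

text \<open>
  A solution cannot double its size in a time shorter than the time scale of the quadratic
  field: consider the first time at which the norm reaches \<open>2 \<rho>\<close>.
\<close>

lemma bilinear_flow_bounded:
  fixes b :: "'a::real_normed_vector \<Rightarrow> 'a \<Rightarrow> 'a"
  assumes K: "K \<ge> 0" "\<And>x y. norm (b x y) \<le> norm x * norm y * K"
    and der: "\<And>s. s \<in> {0..T} \<Longrightarrow> (y has_vector_derivative b (y s) (y s)) (at s within {0..T})"
    and y0: "norm (y 0) < \<rho>" and T: "T * (4 * \<rho>\<^sup>2 * K) < \<rho>" and t: "0 \<le> t" "t \<le> T"
  shows "norm (y t) \<le> 2 * \<rho>"
proof (rule ccontr)
  assume "\<not> ?thesis"
  then have large: "2 * \<rho> \<le> norm (y t)" by simp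
  have "\<rho> > 0" using y0 norm_ge_zero[of "y 0"] by linarith
  \<comment> \<open>\<open>m\<close> will be the first time at which the norm reaches \<open>2 \<rho>\<close>\<close>
  have cont: "continuous_on {0..T} (\<lambda>s. norm (y s))"
    using der by (intro continuous_on_norm) (meson continuous_on_eq_continuous_within has_vector_derivative_continuous)
  define S where "S = {0..T} \<inter> (\<lambda>s. norm (y s)) -` {2 * \<rho>..}"
  have "closed S" unfolding S_def using cont by (intro continuous_closed_preimage) auto
  then have "compact S" by (auto simp: S_def compact_eq_bounded_closed intro: bounded_subset[OF bounded_closed_interval])
  moreover have "S \<noteq> {}" using large t by (auto simp: S_def)
  ultimately obtain m where m: "m \<in> S" and least: "\<And>s. s \<in> S \<Longrightarrow> m \<le> s"
    using compact_attains_inf by metis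
  have "0 \<le> m" "m \<le> T" "2 * \<rho> \<le> norm (y m)" using m by (auto simp: S_def)
  obtain s where s: "0 \<le> s" "s \<le> m" "norm (y s) = 2 * \<rho>"
    using IVT'[of "\<lambda>s. norm (y s)" 0 "2 * \<rho>" m] continuous_on_subset[OF cont, of "{0..m}"]
      \<open>0 \<le> m\<close> \<open>m \<le> T\<close> \<open>2 * \<rho> \<le> norm (y m)\<close> y0 \<open>\<rho> > 0\<close> by auto
  then have "s \<in> S" using \<open>m \<le> T\<close> by (auto simp: S_def)
  then have sm: "s = m" using least s by force
  have "norm (b (y r) (y r)) \<le> 4 * \<rho>\<^sup>2 * K" if r: "0 \<le> r" "r \<le> s" for r
  proof -
    have "norm (y r) \<le> 2 * \<rho>"
      using least[of r] r sm s \<open>m \<le> T\<close> by (cases "r = s") (force simp: S_def)+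
    then have "norm (y r) * norm (y r) * K \<le> (2 * \<rho>) * (2 * \<rho>) * K"
      using K \<open>\<rho> > 0\<close> by (intro mult_mono) auto
    then show ?thesis using K(2)[of "y r" "y r"] by (simp add: power2_eq_square)
  qed
  then have "norm (y s - y 0) \<le> (4 * \<rho>\<^sup>2 * K) * s"
    using s \<open>m \<le> T\<close> by (intro vector_derivative_increment_bound[OF der]) auto
  also have "\<dots> \<le> (4 * \<rho>\<^sup>2 * K) * T" using s \<open>m \<le> T\<close> K by (intro mult_left_mono) auto
  also have "\<dots> < \<rho>" using T by (simp add: mult.commute)
  finally show False using s y0 norm_triangle_ineq2[of "y s" "y 0"] by linarith
qed

text \<open>
  For a quadratic field \<open>f x = b x x\<close> with derivative \<open>D\<close> at the initial value and \<open>f\<^sub>0 = f (y 0)\<close>,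
  both the exact solution and \<open>y 0 + h f z\<close> are \<open>y 0 + h f\<^sub>0 + h\<^sup>2/2 D f\<^sub>0 + O(h\<^sup>3)\<close>.  The hypothesis
  on \<open>z\<close> leaves room for an error of second order, because \<open>f z\<close> is multiplied by \<open>h\<close>.
\<close>

lemma midpoint_local_error:
  fixes b :: "'a::real_normed_vector \<Rightarrow> 'a \<Rightarrow> 'a"
  assumes "bounded_bilinear b" and K: "K \<ge> 0" "\<And>x y. norm (b x y) \<le> norm x * norm y * K" and "R \<ge> 0" "c \<ge> 0"
  shows "\<exists>C. \<forall>h y z. 0 < h \<and> h \<le> 1 \<and>
     (\<forall>s\<in>{0..h}. (y has_vector_derivative b (y s) (y s)) (at s within {0..h})) \<and>
     (\<forall>s\<in>{0..h}. norm (y s) \<le> R) \<and> norm z \<le> R \<and>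
     norm (z - y 0 - (h/2) *\<^sub>R b z z) \<le> c * h\<^sup>2 \<longrightarrow>
     norm (y 0 + h *\<^sub>R b z z - y h) \<le> C * h ^ 3"
proof -
  interpret b: bounded_bilinear b by fact
  \<comment> \<open>\<open>M\<close> bounds the field and \<open>L\<close> is its Lipschitz constant on the ball of radius \<open>R\<close>.\<close>
  define M where "M = R * R * K"
  define L where "L = 2 * R * K"
  define c1 where "c1 = L * (L * M) + M * M * K"
  define c2 where "c2 = M / 2 + c"
  define c3 where "c3 = L * c2 / 2 + c"
  define c4 where "c4 = L * c3 + c2 * c2 * K"
  have nn: "M \<ge> 0" "L \<ge> 0" "c2 \<ge> 0" "c3 \<ge> 0" using K assms(4,5)
    by (simp_all add: M_def L_def c2_def c3_def)
  have bM: "norm (b x x) \<le> M" if "norm x \<le> R" for x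
  proof -
    have "norm x * norm x * K \<le> R * R * K" using that K assms(4) by (intro mult_mono) auto
    then show ?thesis using K(2)[of x x] by (simp add: M_def)
  qed
  have bL: "norm (b x v + b v w) \<le> L * norm v" if "norm x \<le> R" "norm w \<le> R" for x v w
  proof -
    have "norm (b x v + b v w) \<le> norm x * norm v * K + norm v * norm w * K"
      by (intro norm_triangle_le add_mono K)
    also have "\<dots> \<le> R * norm v * K + norm v * R * K"
      using that K assms(4) by (intro add_mono mult_mono mult_nonneg_nonneg) auto
    finally show ?thesis by (simp add: L_def algebra_simps)
  qed
  have bLip: "norm (b x x - b w w) \<le> L * norm (x - w)" if "norm x \<le> R" "norm w \<le> R" for x w
  proof -
    have "b x x - b w w = b x (x - w) + b (x - w) w" by (simp add: b.diff_left b.diff_right)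
    then show ?thesis using bL[OF that] by simp
  qed
  have "norm (y 0 + h *\<^sub>R b z z - y h) \<le> (c1 + c4) * h ^ 3"
    if h: "0 < h" "h \<le> 1"
      and der: "\<And>s. s \<in> {0..h} \<Longrightarrow> (y has_vector_derivative b (y s) (y s)) (at s within {0..h})"
      and yR: "\<And>s. 0 \<le> s \<Longrightarrow> s \<le> h \<Longrightarrow> norm (y s) \<le> R" and zR: "norm z \<le> R"
      and z: "norm (z - y 0 - (h/2) *\<^sub>R b z z) \<le> c * h\<^sup>2" for h y z
  proof -
    define f0 where "f0 = b (y 0) (y 0)"
    define D where "D v = b (y 0) v + b v (y 0)" for v
    have y0R: "norm (y 0) \<le> R" using yR[of 0] h by simp
    have D: "norm (D v) \<le> L * norm v" for v unfolding D_def using bL[OF y0R y0R] .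
    have Dlin: "D (v - w) = D v - D w" "D (r *\<^sub>R v) = r *\<^sub>R D v" for v w r
      by (simp_all add: D_def b.diff_left b.diff_right b.scaleR_left b.scaleR_right scaleR_add_right)
    have expand: "b x x = f0 + D (x - y 0) + b (x - y 0) (x - y 0)" for x
      by (simp add: f0_def D_def b.diff_left b.diff_right)
    have e1: "norm (y t - y 0) \<le> M * t" if "0 \<le> t" "t \<le> h" for t
      using that by (intro vector_derivative_increment_bound[OF der]) (auto intro!: bM yR)
    have e2: "norm (y t - y 0 - t *\<^sub>R f0) \<le> L * M * t * t" if t: "0 \<le> t" "t \<le> h" for t
    proof -
      have "norm ((y t - t *\<^sub>R f0) - (y 0 - 0 *\<^sub>R f0)) \<le> (L * M * t) * t"
      proof (rule vector_derivative_increment_bound[where T = h and y' = "\<lambda>s. b (y s) (y s) - f0"])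
        show "((\<lambda>t. y t - t *\<^sub>R f0) has_vector_derivative b (y s) (y s) - f0) (at s within {0..h})"
          if "s \<in> {0..h}" for s
          using der[OF that] by (auto intro!: derivative_eq_intros)
        show "norm (b (y s) (y s) - f0) \<le> L * M * t" if s: "0 \<le> s" "s \<le> t" for s
        proof -
          have "norm (b (y s) (y s) - f0) \<le> L * norm (y s - y 0)"
            unfolding f0_def using s t by (intro bLip yR y0R) auto
          also have "\<dots> \<le> L * (M * s)" using e1[of s] s t nn by (intro mult_left_mono) auto
          also have "\<dots> \<le> L * (M * t)" using s nn by (intro mult_left_mono) auto
          finally show ?thesis by (simp add: mult.assoc)
        qed
      qed (use t in auto)
      then show ?thesis by (simp add: algebra_simps)
    qed
    have e3: "norm (y h - y 0 - h *\<^sub>R f0 - (h\<^sup>2/2) *\<^sub>R D f0) \<le> c1 * h ^ 3"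
    proof -
      have "norm ((y h - h *\<^sub>R f0 - (h\<^sup>2/2) *\<^sub>R D f0) - (y 0 - 0 *\<^sub>R f0 - (0\<^sup>2/2) *\<^sub>R D f0)) \<le> (c1 * h\<^sup>2) * h"
      proof (rule vector_derivative_increment_bound[where T = h and y' = "\<lambda>s. b (y s) (y s) - f0 - s *\<^sub>R D f0"])
        show "((\<lambda>t. y t - t *\<^sub>R f0 - (t\<^sup>2/2) *\<^sub>R D f0) has_vector_derivative b (y s) (y s) - f0 - s *\<^sub>R D f0)
            (at s within {0..h})" if "s \<in> {0..h}" for s
          using der[OF that] by (auto intro!: derivative_eq_intros simp: has_real_derivative_iff_has_vector_derivative[symmetric])
        show "norm (b (y s) (y s) - f0 - s *\<^sub>R D f0) \<le> c1 * h\<^sup>2" if s: "0 \<le> s" "s \<le> h" for s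
        proof -
          have "b (y s) (y s) - f0 - s *\<^sub>R D f0 = D (y s - y 0 - s *\<^sub>R f0) + b (y s - y 0) (y s - y 0)"
            unfolding expand[of "y s"] Dlin by simp
          also have "norm \<dots> \<le> L * norm (y s - y 0 - s *\<^sub>R f0) + norm (y s - y 0) * norm (y s - y 0) * K"
            by (intro norm_triangle_le add_mono D K)
          also have "\<dots> \<le> L * (L * M * s * s) + (M * s) * (M * s) * K"
            using e1[OF s] e2[OF s] nn K s by (intro add_mono mult_left_mono mult_right_mono mult_mono) auto
          also have "\<dots> = c1 * s\<^sup>2" by (simp add: c1_def power2_eq_square algebra_simps)
          also have "\<dots> \<le> c1 * h\<^sup>2" using s nn K by (intro mult_left_mono power_mono) (auto simp: c1_def)
          finally show ?thesis .
        qed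
      qed (use h in auto)
      then show ?thesis by (simp add: algebra_simps power2_eq_square power3_eq_cube)
    qed
    have hh: "h\<^sup>2 \<le> h" using h by (simp add: power2_eq_square mult_left_le)
    have e4: "norm (z - y 0) \<le> c2 * h"
    proof -
      have "norm (z - y 0) \<le> norm (z - y 0 - (h/2) *\<^sub>R b z z) + norm ((h/2) *\<^sub>R b z z)"
        by (metis norm_triangle_sub add.commute)
      also have "\<dots> \<le> c * h\<^sup>2 + h/2 * M" using z bM[OF zR] h by (intro add_mono) (auto intro: mult_left_mono)
      also have "\<dots> \<le> c * h + h/2 * M" using hh h assms(5) by (intro add_mono mult_left_mono) auto
      finally show ?thesis by (simp add: c2_def algebra_simps)
    qed
    have e5: "norm (z - y 0 - (h/2) *\<^sub>R f0) \<le> c3 * h\<^sup>2"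
    proof -
      have "z - y 0 - (h/2) *\<^sub>R f0 = (z - y 0 - (h/2) *\<^sub>R b z z) + (h/2) *\<^sub>R (b z z - f0)"
        by (simp add: algebra_simps)
      also have "norm \<dots> \<le> c * h\<^sup>2 + h/2 * (L * (c2 * h))"
      proof (intro norm_triangle_le add_mono z)
        have "norm (b z z - f0) \<le> L * norm (z - y 0)" unfolding f0_def by (rule bLip[OF zR y0R])
        also have "\<dots> \<le> L * (c2 * h)" using e4 nn by (intro mult_left_mono) auto
        finally show "norm ((h/2) *\<^sub>R (b z z - f0)) \<le> h/2 * (L * (c2 * h))" using h by (simp add: mult_left_mono)
      qed
      finally show ?thesis by (simp add: c3_def power2_eq_square algebra_simps)
    qed
    have e6: "norm (b z z - f0 - (h/2) *\<^sub>R D f0) \<le> c4 * h\<^sup>2"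
    proof -
      have "b z z - f0 - (h/2) *\<^sub>R D f0 = D (z - y 0 - (h/2) *\<^sub>R f0) + b (z - y 0) (z - y 0)"
        unfolding expand[of z] Dlin by simp
      also have "norm \<dots> \<le> L * norm (z - y 0 - (h/2) *\<^sub>R f0) + norm (z - y 0) * norm (z - y 0) * K"
        by (intro norm_triangle_le add_mono D K)
      also have "\<dots> \<le> L * (c3 * h\<^sup>2) + (c2 * h) * (c2 * h) * K"
        using e4 e5 nn K h by (intro add_mono mult_left_mono mult_right_mono mult_mono) auto
      also have "\<dots> = c4 * h\<^sup>2" by (simp add: c4_def power2_eq_square algebra_simps)
      finally show ?thesis .
    qed
    have "y 0 + h *\<^sub>R b z z - y h
        = h *\<^sub>R (b z z - f0 - (h/2) *\<^sub>R D f0) - (y h - y 0 - h *\<^sub>R f0 - (h\<^sup>2/2) *\<^sub>R D f0)"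
      by (simp add: algebra_simps power2_eq_square)
    also have "norm \<dots> \<le> norm (h *\<^sub>R (b z z - f0 - (h/2) *\<^sub>R D f0)) + norm (y h - y 0 - h *\<^sub>R f0 - (h\<^sup>2/2) *\<^sub>R D f0)"
      by (rule norm_triangle_ineq4)
    also have "\<dots> \<le> h * (c4 * h\<^sup>2) + c1 * h ^ 3"
      using e3 e6 h by (intro add_mono) (auto intro: mult_left_mono)
    also have "\<dots> = (c1 + c4) * h ^ 3" by (simp add: power2_eq_square power3_eq_cube algebra_simps)
    finally show ?thesis .
  qed
  then show ?thesis by (intro exI[of _ "c1 + c4"]) auto
qed


section \<open>Cayley conjugation and the Lie--Poisson bracket\<close>

text \<open>
  One half of the antisymmetrised trace identity.  With \<open>p = M \<alpha>\<close>, \<open>p' = N A\<close>, \<open>q = \<beta> N\<close>,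
  \<open>q' = B M\<close> the hypotheses say that \<open>p - p'\<close> and \<open>q - q'\<close> equal \<open>- (p + p') K\<close> and
  \<open>K (q + q')\<close> up to the correction terms \<open>Q\<alpha>\<close> and \<open>Q\<beta>\<close>.  The terms with \<open>K\<close> cancel in
  \<open>2 (p q - p' q') = (p + p') (q - q') + (p - p') (q + q')\<close>.
\<close>

lemma cayley_trace_half:
  fixes Z K \<alpha> \<beta> A B Q\<alpha> Q\<beta> :: "complex^'n::finite^'n"
  defines "M \<equiv> mat 1 - K" and "N \<equiv> mat 1 + K"
  assumes a: "M ** \<alpha> ** N - N ** A ** M = - Q\<alpha>" and b: "M ** \<beta> ** N - N ** B ** M = - Q\<beta>"
  shows "2 * (trace (N ** Z ** M ** (\<alpha> ** \<beta>)) - trace (M ** Z ** N ** (A ** B)))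
     = - trace (Z ** (M ** \<alpha> + N ** A) ** Q\<beta>) - trace (Q\<alpha> ** (\<beta> ** N + B ** M) ** Z)"
proof -
  define p p' q q' where "p = M ** \<alpha>" and "p' = N ** A" and "q = \<beta> ** N" and "q' = B ** M"
  have "p ** N - p' ** M = - Q\<alpha>" using a by (simp add: p_def p'_def)
  then have u: "p - p' = - ((p + p') ** K) - Q\<alpha>"
    by (simp add: M_def N_def matrix_ring_simps algebra_simps)
  have "M ** q - N ** q' = - Q\<beta>" using b by (simp add: q_def q'_def matrix_mul_assoc)
  then have v: "q - q' = K ** (q + q') - Q\<beta>"
    by (simp add: M_def N_def matrix_ring_simps algebra_simps)
  have "2 *\<^sub>R (p ** q - p' ** q') = (p + p') ** (q - q') + (p - p') ** (q + q')"
    by (simp add: matrix_ring_simps scaleR_2 algebra_simps)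
  also have "\<dots> = - ((p + p') ** Q\<beta>) - Q\<alpha> ** (q + q')"
    unfolding u v by (simp add: matrix_ring_simps matrix_mul_assoc algebra_simps)
  finally have pq: "2 *\<^sub>R (p ** q - p' ** q') = - ((p + p') ** Q\<beta>) - Q\<alpha> ** (q + q')" .
  have "trace (N ** Z ** M ** (\<alpha> ** \<beta>)) = trace (Z ** (p ** q))"
    using trace_mul_sym[of N "Z ** M ** (\<alpha> ** \<beta>)"] by (simp add: p_def q_def matrix_mul_assoc)
  moreover have "trace (M ** Z ** N ** (A ** B)) = trace (Z ** (p' ** q'))"
    using trace_mul_sym[of M "Z ** N ** (A ** B)"] by (simp add: p'_def q'_def matrix_mul_assoc)
  ultimately have "2 * (trace (N ** Z ** M ** (\<alpha> ** \<beta>)) - trace (M ** Z ** N ** (A ** B)))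
      = trace (Z ** (2 *\<^sub>R (p ** q - p' ** q')))"
    by (simp add: matrix_ring_simps trace_sub trace_linear_simps) (simp add: scaleR_conv_of_real)
  also have "\<dots> = - trace (Z ** (p + p') ** Q\<beta>) - trace (Z ** (Q\<alpha> ** (q + q')))"
    unfolding pq by (simp add: mm.diff_right mm.minus_right trace_sub trace_linear_simps matrix_mul_assoc)
  also have "trace (Z ** (Q\<alpha> ** (q + q'))) = trace (Q\<alpha> ** (q + q') ** Z)" by (rule trace_mul_sym)
  finally show ?thesis by (simp add: p_def p'_def q_def q'_def)
qed

text \<open>
  Here \<open>Q\<alpha>\<close> and \<open>Q\<beta>\<close> stand for the stream matrices of the two expressions in the last
  hypothesis, which is their self-adjointness.  It cancels what remains after antisymmetrising
  the preceding identity in the two pairs.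
\<close>

lemma cayley_trace_identity:
  fixes Z K \<alpha> \<beta> A B Q\<alpha> Q\<beta> :: "complex^'n::finite^'n"
  defines "M \<equiv> mat 1 - K" and "N \<equiv> mat 1 + K"
  assumes a: "M ** \<alpha> ** N - N ** A ** M = - Q\<alpha>" and b: "M ** \<beta> ** N - N ** B ** M = - Q\<beta>"
    and sym: "trace (Q\<alpha> ** (Z ** (M ** \<beta> + N ** B) - (\<beta> ** N + B ** M) ** Z))
            = trace ((Z ** (M ** \<alpha> + N ** A) - (\<alpha> ** N + A ** M) ** Z) ** Q\<beta>)"
  shows "trace (N ** Z ** M ** (\<alpha> ** \<beta> - \<beta> ** \<alpha>)) = trace (M ** Z ** N ** (A ** B - B ** A))"
proof -
  define \<sigma>\<alpha> \<sigma>\<beta> \<tau>\<alpha> \<tau>\<beta> where "\<sigma>\<alpha> = M ** \<alpha> + N ** A" and "\<sigma>\<beta> = M ** \<beta> + N ** B"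
    and "\<tau>\<alpha> = \<alpha> ** N + A ** M" and "\<tau>\<beta> = \<beta> ** N + B ** M"
  note d = \<sigma>\<alpha>_def[symmetric] \<sigma>\<beta>_def[symmetric] \<tau>\<alpha>_def[symmetric] \<tau>\<beta>_def[symmetric]
  have s: "trace (Q\<alpha> ** (Z ** \<sigma>\<beta> - \<tau>\<beta> ** Z)) = trace ((Z ** \<sigma>\<alpha> - \<tau>\<alpha> ** Z) ** Q\<beta>)"
    using sym unfolding d .
  have h: "2 * (trace (N ** Z ** M ** (\<alpha> ** \<beta>)) - trace (M ** Z ** N ** (A ** B)))
     = - trace (Z ** \<sigma>\<alpha> ** Q\<beta>) - trace (Q\<alpha> ** \<tau>\<beta> ** Z)"
    using cayley_trace_half[OF a[unfolded M_def N_def] b[unfolded M_def N_def], of Z]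
    unfolding M_def[symmetric] N_def[symmetric] d .
  have h': "2 * (trace (N ** Z ** M ** (\<beta> ** \<alpha>)) - trace (M ** Z ** N ** (B ** A)))
     = - trace (Z ** \<sigma>\<beta> ** Q\<alpha>) - trace (Q\<beta> ** \<tau>\<alpha> ** Z)"
    using cayley_trace_half[OF b[unfolded M_def N_def] a[unfolded M_def N_def], of Z]
    unfolding M_def[symmetric] N_def[symmetric] d .
  have "trace (Q\<alpha> ** (Z ** \<sigma>\<beta>)) - trace (Q\<alpha> ** \<tau>\<beta> ** Z) = trace (Z ** \<sigma>\<alpha> ** Q\<beta>) - trace (\<tau>\<alpha> ** Z ** Q\<beta>)"
    using s by (simp add: mm.diff_left mm.diff_right trace_sub matrix_mul_assoc)
  moreover have "trace (Q\<alpha> ** (Z ** \<sigma>\<beta>)) = trace (Z ** \<sigma>\<beta> ** Q\<alpha>)" by (rule trace_mul_sym)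
  moreover have "trace (\<tau>\<alpha> ** Z ** Q\<beta>) = trace (Q\<beta> ** \<tau>\<alpha> ** Z)"
    using trace_mul_sym[of "\<tau>\<alpha> ** Z" Q\<beta>] by (simp add: matrix_mul_assoc)
  ultimately have "2 * (trace (N ** Z ** M ** (\<alpha> ** \<beta>)) - trace (M ** Z ** N ** (A ** B)))
      = 2 * (trace (N ** Z ** M ** (\<beta> ** \<alpha>)) - trace (M ** Z ** N ** (B ** A)))"
    unfolding h h' by (simp add: algebra_simps)
  then have "trace (N ** Z ** M ** (\<alpha> ** \<beta>)) - trace (M ** Z ** N ** (A ** B))
      = trace (N ** Z ** M ** (\<beta> ** \<alpha>)) - trace (M ** Z ** N ** (B ** A))"
    by (simp only: mult_cancel_left) simp
  then show ?thesis by (simp add: mm.diff_right trace_sub algebra_simps)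
qed

definition cayley_conj :: "(complex^'n::finite^'n \<Rightarrow> complex^'n^'n) \<Rightarrow> complex^'n^'n \<Rightarrow> complex^'n^'n" where
  "cayley_conj Q Z = (mat 1 + Q Z) ** Z ** (mat 1 - Q Z)"

text \<open>
  The derivative of \<open>cayley_conj Q\<close> at \<open>Z\<close> in the direction \<open>W\<close>.
\<close>

definition cayley_conj' :: "(complex^'n::finite^'n \<Rightarrow> complex^'n^'n) \<Rightarrow> complex^'n^'n \<Rightarrow> complex^'n^'n \<Rightarrow> complex^'n^'n" where
  "cayley_conj' Q Z W = (mat 1 + Q Z) ** W ** (mat 1 - Q Z)
     + (Q W ** (Z ** (mat 1 - Q Z)) - (mat 1 + Q Z) ** Z ** Q W)"

lemma has_derivative_cayley_conj:
  assumes "bounded_linear Q"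
  shows "(cayley_conj Q has_derivative cayley_conj' Q Z) (at Z)"
proof -
  have Q: "(Q has_derivative Q) (at Z)" using assms by (rule bounded_linear_imp_has_derivative)
  have 1: "((\<lambda>Z. mat 1 + Q Z) has_derivative Q) (at Z)"
    using has_derivative_add[OF has_derivative_const Q] by simp
  have 2: "((\<lambda>Z. mat 1 - Q Z) has_derivative (\<lambda>W. - Q W)) (at Z)"
    using has_derivative_diff[OF has_derivative_const Q] by simp
  have "((\<lambda>Z. (mat 1 + Q Z) ** Z ** (mat 1 - Q Z)) has_derivative
      (\<lambda>W. (mat 1 + Q Z) ** Z ** (- Q W) + ((mat 1 + Q Z) ** W + Q W ** Z) ** (mat 1 - Q Z))) (at Z)"
    by (intro mm.FDERIV 1 2 has_derivative_ident)
  then show ?thesis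
    unfolding cayley_conj_def[abs_def] cayley_conj'_def[abs_def]
    by (rule has_derivative_eq_rhs) (simp add: fun_eq_iff matrix_ring_simps matrix_mul_assoc algebra_simps)
qed

lemma cayley_conj_skew:
  assumes "Z \<in> skew_hermitian" "Q Z \<in> skew_hermitian"
  shows "cayley_conj Q Z \<in> skew_hermitian"
  by (rule skewI) (simp add: cayley_conj_def ctranspose_mult skewD[OF assms(1)] skewD[OF assms(2)]
      matrix_ring_simps matrix_mul_assoc)

lemma cayley_conj_minus: "cayley_conj (\<lambda>X. - Q X) Z = (mat 1 - Q Z) ** Z ** (mat 1 + Q Z)"
  by (simp add: cayley_conj_def)

text \<open>
  What the algebra of the scheme uses of the map from a matrix to its stream matrix, scaled by
  the step size.
\<close>

locale self_adjoint_stream =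
  fixes Q :: "complex^'n::finite^'n \<Rightarrow> complex^'n^'n"
  assumes lin: "linear Q"
    and ct: "Q (ctranspose X) = ctranspose (Q X)"
    and sym: "trace (Q X ** Y) = trace (X ** Q Y)"
begin

lemma bounded: "bounded_linear Q" using lin linear_conv_bounded_linear by blast

lemma skew: "X \<in> skew_hermitian \<Longrightarrow> Q X \<in> skew_hermitian"
  using ct[of X] linear_neg[OF lin, of X] by (auto simp: skew_hermitian_def)

text \<open>
  The transpose of the derivative, with respect to the trace form.
\<close>

lemma trace_cayley_conj':
  defines "M Z \<equiv> mat 1 - Q Z" and "N Z \<equiv> mat 1 + Q Z"
  shows "trace (\<alpha> ** cayley_conj' Q Z W) = trace ((M Z ** \<alpha> ** N Z + Q (Z ** M Z ** \<alpha> - \<alpha> ** N Z ** Z)) ** W)"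
proof -
  have "trace (\<alpha> ** cayley_conj' Q Z W)
      = trace (\<alpha> ** N Z ** W ** M Z) + trace (\<alpha> ** (Q W ** (Z ** M Z))) - trace (\<alpha> ** N Z ** Z ** Q W)"
    by (simp add: cayley_conj'_def M_def[symmetric] N_def[symmetric] mm.add_right mm.diff_right
        trace_add trace_sub matrix_mul_assoc)
  also have "trace (\<alpha> ** N Z ** W ** M Z) = trace (M Z ** \<alpha> ** N Z ** W)"
    using trace_mul_sym[of "\<alpha> ** N Z ** W" "M Z"] by (simp add: matrix_mul_assoc)
  also have "trace (\<alpha> ** (Q W ** (Z ** M Z))) = trace ((Z ** M Z ** \<alpha>) ** Q W)"
    using trace_mul_sym[of "\<alpha> ** Q W" "Z ** M Z"] by (simp add: matrix_mul_assoc)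
  finally have "trace (\<alpha> ** cayley_conj' Q Z W)
      = trace (M Z ** \<alpha> ** N Z ** W) + trace (Q (Z ** M Z ** \<alpha> - \<alpha> ** N Z ** Z) ** W)"
    unfolding sym[of _ W] by (simp add: mm.diff_left trace_sub)
  then show ?thesis by (simp add: mm.add_left trace_add)
qed

lemma negative: "self_adjoint_stream (\<lambda>X. - Q X)"
proof (rule self_adjoint_stream.intro)
  show "linear (\<lambda>X. - Q X)"
    by (rule linearI) (simp_all add: linear_add[OF lin] linear_scale[OF lin])
qed (simp_all add: ct sym matrix_ring_simps trace_linear_simps)

text \<open>
  The difference \<open>G\<close> of the two transposed derivatives is again skew-Hermitian, so it may be
  tested against itself.
\<close>

lemma pullback_condition:
  assumes skews: "Z \<in> skew_hermitian" "\<alpha> \<in> skew_hermitian" "A \<in> skew_hermitian"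
    and eq: "\<And>W. W \<in> skew_hermitian \<Longrightarrow> \<alpha> \<bullet> cayley_conj' Q Z W = A \<bullet> cayley_conj' (\<lambda>X. - Q X) Z W"
  defines "M \<equiv> mat 1 - Q Z" and "N \<equiv> mat 1 + Q Z"
  shows "M ** \<alpha> ** N - N ** A ** M = - Q (Z ** (M ** \<alpha> + N ** A) - (\<alpha> ** N + A ** M) ** Z)"
proof -
  define E where "E = Z ** (M ** \<alpha> + N ** A) - (\<alpha> ** N + A ** M) ** Z"
  define G where "G = M ** \<alpha> ** N - N ** A ** M + Q E"
  interpret m: self_adjoint_stream "\<lambda>X. - Q X" by (rule negative)
  have sQ: "ctranspose (Q Z) = - Q Z" using skew[OF skews(1)] by (rule skewD)
  have cM: "ctranspose M = N" and cN: "ctranspose N = M" by (simp_all add: M_def N_def sQ)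
  note sk = skewD[OF skews(1)] skewD[OF skews(2)] skewD[OF skews(3)]
  have "E \<in> skew_hermitian"
    by (rule skewI) (simp add: E_def ctranspose_mult cM cN sk matrix_ring_simps matrix_mul_assoc)
  then have "ctranspose (Q E) = - Q E" using skew skewD by blast
  then have G: "G \<in> skew_hermitian"
    by (intro skewI) (simp add: G_def ctranspose_mult cM cN sk matrix_ring_simps matrix_mul_assoc)
  have Gtr: "trace (G ** W) = trace (\<alpha> ** cayley_conj' Q Z W) - trace (A ** cayley_conj' (\<lambda>X. - Q X) Z W)" for W
  proof -
    have "E = (Z ** M ** \<alpha> - \<alpha> ** N ** Z) + (Z ** N ** A - A ** M ** Z)"
      by (simp add: E_def matrix_ring_simps matrix_mul_assoc)
    then have "Q E = Q (Z ** M ** \<alpha> - \<alpha> ** N ** Z) + Q (Z ** N ** A - A ** M ** Z)"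
      by (simp only: linear_add[OF lin])
    then have "G = (M ** \<alpha> ** N + Q (Z ** M ** \<alpha> - \<alpha> ** N ** Z))
        - (N ** A ** M - Q (Z ** N ** A - A ** M ** Z))"
      by (simp add: G_def)
    moreover have "trace (A ** cayley_conj' (\<lambda>X. - Q X) Z W)
        = trace ((N ** A ** M - Q (Z ** N ** A - A ** M ** Z)) ** W)"
      using m.trace_cayley_conj'[of A Z W] by (simp add: M_def N_def)
    ultimately show ?thesis
      using trace_cayley_conj'[of \<alpha> Z W] by (simp add: M_def N_def mm.diff_left trace_sub)
  qed
  have "Re (trace (G ** G)) = 0"
    using eq[OF G] unfolding Gtr by (simp add: inner_skew_left skews)
  then have "G \<bullet> G = 0" by (simp add: inner_skew_left G)
  then have "G = 0" by simp
  then show ?thesis by (simp add: G_def E_def eq_neg_iff_add_eq_0)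
qed

lemma cayley_conj_poisson:
  assumes Z: "Z \<in> skew_hermitian"
    and skews: "\<alpha> \<in> skew_hermitian" "A \<in> skew_hermitian" "\<beta> \<in> skew_hermitian" "B \<in> skew_hermitian"
    and "\<And>W. W \<in> skew_hermitian \<Longrightarrow> \<alpha> \<bullet> cayley_conj' Q Z W = A \<bullet> cayley_conj' (\<lambda>X. - Q X) Z W"
    and "\<And>W. W \<in> skew_hermitian \<Longrightarrow> \<beta> \<bullet> cayley_conj' Q Z W = B \<bullet> cayley_conj' (\<lambda>X. - Q X) Z W"
  shows "cayley_conj Q Z \<bullet> (\<alpha> ** \<beta> - \<beta> ** \<alpha>) = cayley_conj (\<lambda>X. - Q X) Z \<bullet> (A ** B - B ** A)"
proof -
  note a = pullback_condition[OF Z skews(1,2) assms(6)] and b = pullback_condition[OF Z skews(3,4) assms(7)]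
  have "trace ((mat 1 + Q Z) ** Z ** (mat 1 - Q Z) ** (\<alpha> ** \<beta> - \<beta> ** \<alpha>))
      = trace ((mat 1 - Q Z) ** Z ** (mat 1 + Q Z) ** (A ** B - B ** A))"
    by (rule cayley_trace_identity[OF a b sym])
  moreover have "cayley_conj Q Z \<in> skew_hermitian" "cayley_conj (\<lambda>X. - Q X) Z \<in> skew_hermitian"
    using cayley_conj_skew[of Z Q, OF Z skew[OF Z]]
      cayley_conj_skew[of Z "\<lambda>X. - Q X", OF Z self_adjoint_stream.skew[OF negative Z]]
    by simp_all
  ultimately show ?thesis
    by (simp add: inner_skew_left) (simp add: cayley_conj_def)
qed

text \<open>
  The Cayley transform.  \<open>I + Q Z\<close> is invertible since a skew-Hermitian matrix has no
  eigenvalue \<open>-1\<close>.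
\<close>

lemma cayley_conj_unitary_orbit:
  assumes Z: "Z \<in> skew_hermitian"
  shows "cayley_conj (\<lambda>X. - Q X) Z \<in> unitary_orbit (cayley_conj Q Z)"
proof -
  define M N where "M = mat 1 - Q Z" and "N = mat 1 + Q Z"
  have sQ: "ctranspose (Q Z) = - Q Z" using skew[OF Z] by (rule skewD)
  have cM: "ctranspose M = N" and cN: "ctranspose N = M" by (simp_all add: M_def N_def sQ)
  have comm: "M ** N = N ** M" by (simp add: M_def N_def matrix_ring_simps)
  have "x = 0" if x: "N *v x = 0" for x
  proof -
    have Qx: "Q Z *v x = - x"
      using x by (simp add: N_def matrix_vector_mult_add_rdistrib eq_neg_iff_add_eq_0 add.commute)
    have adj: "Re (hinner (K *v y) y) = Re (hinner y (ctranspose K *v y))" for K :: "complex^'n^'n" and y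
    proof -
      have "hinner (K *v y) y = (\<Sum>i\<in>UNIV. \<Sum>j\<in>UNIV. K $ i $ j * y $ j * cnj (y $ i))"
        by (simp add: hinner_def matrix_vector_mult_def sum_distrib_right)
      also have "\<dots> = (\<Sum>j\<in>UNIV. \<Sum>i\<in>UNIV. K $ i $ j * y $ j * cnj (y $ i))" by (rule sum.swap)
      also have "\<dots> = hinner y (ctranspose K *v y)"
        by (simp add: hinner_def matrix_vector_mult_def ctranspose_def sum_distrib_left algebra_simps)
      finally show ?thesis by simp
    qed
    have m: "- Q Z *v x = x"
      using Qx matrix_vector_mult_diff_rdistrib[of 0 "Q Z" x] by simp
    have "Re (hinner (- x) x) = Re (hinner x x)"
      using adj[of "Q Z" x] unfolding sQ Qx m .
    moreover have "Re (hinner (- x) x) = - Re (hinner x x)"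
      by (simp add: hinner_def sum_negf)
    ultimately have "Re (hinner x x) = 0" by simp
    then show ?thesis by (simp add: hinner_self)
  qed
  then obtain K where K: "K ** N = mat 1"
    using matrix_left_invertible_ker[of N] by blast
  then have NK: "N ** K = mat 1" using matrix_left_right_inverse by blast
  have cK: "M ** ctranspose K = mat 1" "ctranspose K ** M = mat 1"
    using arg_cong[OF K, of ctranspose] arg_cong[OF NK, of ctranspose]
    by (simp_all add: ctranspose_mult cN)
  define R where "R = M ** K"
  have cR: "ctranspose R = ctranspose K ** N" by (simp add: R_def ctranspose_mult cM)
  have "ctranspose R ** R = ctranspose K ** (N ** M) ** K"
    unfolding cR by (simp add: R_def matrix_mul_assoc)
  also have "\<dots> = (ctranspose K ** M) ** (N ** K)" by (simp only: comm[symmetric] matrix_mul_assoc)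
  also have "\<dots> = mat 1" by (simp add: cK NK)
  finally have "R \<in> unitary_matrices" by (simp add: unitary_matrices_def)
  moreover have "R ** cayley_conj Q Z ** ctranspose R = M ** (K ** N) ** Z ** (M ** ctranspose K) ** N"
    by (simp only: cR) (simp only: R_def cayley_conj_def M_def[symmetric] N_def[symmetric] matrix_mul_assoc)
  then have "R ** cayley_conj Q Z ** ctranspose R = cayley_conj (\<lambda>X. - Q X) Z"
    unfolding K cK by (simp add: cayley_conj_minus M_def N_def)
  ultimately show ?thesis unfolding unitary_orbit_def by force
qed

end

lemma cayley_conj'_skew:
  assumes "self_adjoint_stream Q" "Z \<in> skew_hermitian" "W \<in> skew_hermitian"
  shows "cayley_conj' Q Z W \<in> skew_hermitian"
proof -
  interpret self_adjoint_stream Q by fact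
  note sk = skewD[OF assms(2)] skewD[OF assms(3)] skewD[OF skew[OF assms(2)]] skewD[OF skew[OF assms(3)]]
  show ?thesis
    by (rule skewI) (simp add: cayley_conj'_def ctranspose_mult sk matrix_ring_simps matrix_mul_assoc)
qed

section \<open>Gradients on the skew-Hermitian matrices\<close>

text \<open>
  Within a subspace only the values of the derivative on that subspace matter.
\<close>

lemma has_derivative_within_subspace_cong:
  assumes "subspace S" "x \<in> S" "(f has_derivative L) (at x within S)" "bounded_linear L'"
    and "\<And>v. v \<in> S \<Longrightarrow> L v = L' v"
  shows "(f has_derivative L') (at x within S)"
proof -
  have "y - x \<in> S" if "y \<in> S" for y by (rule subspace_diff[OF assms(1) that assms(2)])
  then show ?thesis using assms(3,4,5) unfolding has_derivative_within_alt by simp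
qed

lemma has_derivative_within_subspace_unique:
  assumes S: "subspace S" "x \<in> S" and L: "(f has_derivative L) (at x within S)" "(f has_derivative L') (at x within S)"
    and v: "v \<in> S"
  shows "L v = L' v"
proof (rule ccontr)
  assume ne: "L v \<noteq> L' v"
  have D: "((\<lambda>x. f x - f x) has_derivative (\<lambda>v. L v - L' v)) (at x within S)"
    by (rule has_derivative_diff[OF L])
  interpret D: bounded_linear "\<lambda>v. L v - L' v" using D by (rule has_derivative_bounded_linear)
  have "v \<noteq> 0" using ne D.zero by (metis right_minus_eq)
  define e where "e = norm (L v - L' v) / (2 * norm v)"
  have "e > 0" using ne \<open>v \<noteq> 0\<close> by (simp add: e_def)
  then obtain d where "d > 0" and d: "\<And>y. y \<in> S \<Longrightarrow> norm (y - x) < d \<Longrightarrow> norm (L (y - x) - L' (y - x)) \<le> e * norm (y - x)"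
    using D unfolding has_derivative_within_alt by (force simp: norm_minus_commute)
  define t where "t = d / (2 * norm v)"
  have t: "t > 0" "t * norm v < d" using \<open>d > 0\<close> \<open>v \<noteq> 0\<close> by (auto simp: t_def)
  have "x + t *\<^sub>R v \<in> S" using S v by (intro subspace_add subspace_scale)
  then have "norm (t *\<^sub>R (L v - L' v)) \<le> e * (t * norm v)"
    using d[of "x + t *\<^sub>R v"] t D.scaleR[of t v] by simp
  then have "t * norm (L v - L' v) \<le> t * (e * norm v)"
    using t unfolding norm_scaleR by (simp add: mult.left_commute)
  then have "norm (L v - L' v) \<le> e * norm v" using t by simp
  also have "\<dots> = norm (L v - L' v) / 2" using \<open>v \<noteq> 0\<close> by (simp add: e_def)
  finally show False using ne by simp
qed

text \<open>
  The Riesz representative of the derivative, projected orthogonally to the skew-Hermitian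
  matrices.
\<close>

lemma lp_gradient:
  fixes F :: "complex^'n::finite^'n \<Rightarrow> real"
  assumes Y: "Y \<in> skew_hermitian" and F: "(F has_derivative L) (at Y within skew_hermitian)"
  shows "lp_gradient F Y \<in> skew_hermitian" and "\<And>V. V \<in> skew_hermitian \<Longrightarrow> lp_gradient F Y \<bullet> V = L V"
proof -
  interpret L: bounded_linear L using F by (rule has_derivative_bounded_linear)
  define g where "g = adjoint L 1"
  have g: "g \<bullet> V = L V" for V
    using adjoint_works[OF L.linear_axioms, of V 1] by (simp add: g_def inner_commute)
  define A where "A = (1/2) *\<^sub>R (g - ctranspose g)"
  have A: "A \<in> skew_hermitian" by (rule skewI) (simp add: A_def algebra_simps)
  have AV: "A \<bullet> V = L V" if "V \<in> skew_hermitian" for V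
  proof -
    have "ctranspose g \<bullet> V = - (g \<bullet> V)"
    proof -
      have "ctranspose g \<bullet> V = Re (cnj (trace (ctranspose V ** ctranspose g)))"
        by (simp add: inner_eq_trace trace_ctranspose[symmetric] ctranspose_mult trace_mul_sym[of g V])
      also have "\<dots> = - (g \<bullet> V)"
        by (simp add: inner_eq_trace skewD[OF that] matrix_ring_simps trace_linear_simps trace_mul_sym[of V])
      finally show ?thesis .
    qed
    then show ?thesis by (simp add: A_def inner_simps g)
  qed
  have FA: "(F has_derivative (\<lambda>V. A \<bullet> V)) (at Y within skew_hermitian)"
    by (rule has_derivative_within_subspace_cong[OF subspace_skew_hermitian Y F bounded_linear_inner_right])
      (simp add: AV)
  have "lp_gradient F Y = A"
    unfolding lp_gradient_def
  proof (rule the_equality)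
    show "A \<in> skew_hermitian \<and> (F has_derivative (\<lambda>V. A \<bullet> V)) (at Y within skew_hermitian)" using A FA by simp
    fix B assume B: "B \<in> skew_hermitian \<and> (F has_derivative (\<lambda>V. B \<bullet> V)) (at Y within skew_hermitian)"
    have "B - A \<in> skew_hermitian" using A B subspace_skew_hermitian by (intro subspace_diff) auto
    then have "B \<bullet> (B - A) = A \<bullet> (B - A)"
      using has_derivative_within_subspace_unique[OF subspace_skew_hermitian Y conjunct2[OF B] FA] by blast
    then have "(B - A) \<bullet> (B - A) = 0" by (simp add: inner_simps)
    then show "B = A" by simp
  qed
  then show "lp_gradient F Y \<in> skew_hermitian" "\<And>V. V \<in> skew_hermitian \<Longrightarrow> lp_gradient F Y \<bullet> V = L V"
    using A AV by auto
qed


section \<open>The isospectral midpoint step\<close>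

lemma hbar_pos: "2 \<le> N \<Longrightarrow> hbar N > 0"
proof -
  assume "2 \<le> N"
  then have "(1::real) < real N ^ 2" by (intro one_less_power) auto
  then show ?thesis by (simp add: hbar_def)
qed

lemma bounded_linear_stream: "bounded_linear stream_matrix"
  using linear_stream_matrix linear_conv_bounded_linear by blast

lemma scaled_stream_self_adjoint: "self_adjoint_stream (\<lambda>X. a *\<^sub>R stream_matrix X)"
proof (rule self_adjoint_stream.intro)
  show "linear (\<lambda>X. a *\<^sub>R stream_matrix X)"
    by (rule linearI)
      (simp_all add: linear_add[OF linear_stream_matrix] linear_scale[OF linear_stream_matrix] scaleR_add_right)
qed (simp_all add: stream_matrix_ctranspose stream_matrix_trace matrix_ring_simps trace_linear_simps)

lemma mv_conj_cayley:
  "mv_conj a = cayley_conj (\<lambda>X. a *\<^sub>R stream_matrix X)"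
  "mv_conj (- a) = cayley_conj (\<lambda>X. - (a *\<^sub>R stream_matrix X))"
  by (simp_all add: fun_eq_iff mv_conj_def cayley_conj_def)

text \<open>
  Half of the change of \<open>Y\<close> in one step, divided by \<open>a\<close>.
\<close>

definition mv_linear_part :: "'n::{finite,linorder} cmatrix \<Rightarrow> 'n cmatrix" where
  "mv_linear_part Z = Z ** stream_matrix Z - stream_matrix Z ** Z"

definition mv_quadratic_part :: "'n::{finite,linorder} cmatrix \<Rightarrow> 'n cmatrix" where
  "mv_quadratic_part Z = stream_matrix Z ** Z ** stream_matrix Z"

text \<open>
  The implicit equation of the scheme reads \<open>Z = Y + mv_perturbation a Z\<close>.
\<close>

definition mv_perturbation :: "real \<Rightarrow> 'n::{finite,linorder} cmatrix \<Rightarrow> 'n cmatrix" where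
  "mv_perturbation a Z = a *\<^sub>R mv_linear_part Z + a\<^sup>2 *\<^sub>R mv_quadratic_part Z"

lemma mv_conj_expand:
  "mv_conj a Z = Z - mv_perturbation a Z"
  "mv_conj (- a) Z = Z + a *\<^sub>R mv_linear_part Z - a\<^sup>2 *\<^sub>R mv_quadratic_part Z"
  by (simp_all add: mv_conj_def mv_perturbation_def mv_linear_part_def mv_quadratic_part_def
      matrix_ring_simps matrix_mul_assoc power2_eq_square algebra_simps)

lemma mv_near_iff:
  "mv_near \<delta> h Y Z \<longleftrightarrow> dist Z Y < \<delta> \<and> Z = Y + mv_perturbation (h / (2 * hbar CARD('n))) Z"
  for Y :: "'n::{finite,linorder} cmatrix"
  unfolding mv_near_def mv_conj_expand by (auto simp: algebra_simps)

lemma lipschitz_stream: "lipschitz_on_balls stream_matrix"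
  by (rule lipschitz_on_balls_linear[OF bounded_linear_stream])

lemma lipschitz_mv_linear_part: "lipschitz_on_balls mv_linear_part"
  unfolding mv_linear_part_def[abs_def]
  by (intro lipschitz_on_balls_diff lipschitz_on_balls_bilinear[OF mm.bounded_bilinear_axioms]
      lipschitz_stream lipschitz_on_balls_linear[OF bounded_linear_ident])

lemma lipschitz_mv_quadratic_part: "lipschitz_on_balls mv_quadratic_part"
  unfolding mv_quadratic_part_def[abs_def]
  by (intro lipschitz_on_balls_bilinear[OF mm.bounded_bilinear_axioms]
      lipschitz_stream lipschitz_on_balls_linear[OF bounded_linear_ident])

lemma mv_perturbation_small:
  assumes "\<delta> > 0"
  shows "\<exists>a0>0. \<forall>a. \<bar>a\<bar> < a0 \<longrightarrow> small_perturbation R \<delta> (mv_perturbation a)"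
  using small_perturbation_small_step[OF lipschitz_mv_linear_part lipschitz_mv_quadratic_part assms]
  unfolding mv_perturbation_def[abs_def] .

text \<open>
  A step size for which the implicit equation is uniquely solvable near every matrix in the ball
  of radius \<open>R\<close>.
\<close>

locale mv_small_step =
  fixes h \<delta> R :: real and a :: real and Q :: "'n::{finite,linorder} cmatrix \<Rightarrow> 'n cmatrix"
  defines "a \<equiv> h / (2 * hbar CARD('n))" and "Q \<equiv> (\<lambda>X. a *\<^sub>R stream_matrix X)"
  assumes \<delta>: "\<delta> > 0"
    and small: "small_perturbation (R + \<delta>) \<delta> (mv_perturbation a :: 'n cmatrix \<Rightarrow> _)"
begin

sublocale Q: self_adjoint_stream Q
  unfolding Q_def by (rule scaled_stream_self_adjoint)

lemma unique: "norm (Y :: 'n cmatrix) \<le> R \<Longrightarrow> \<exists>!Z. mv_near \<delta> h Y Z"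
  unfolding mv_near_iff a_def[symmetric]
  by (rule small_perturbation_unique_solution[OF small _ \<delta>])

text \<open>
  The matrix written with a tilde in the scheme.
\<close>

definition sol :: "'n cmatrix \<Rightarrow> 'n cmatrix" where "sol Y = (THE Z. mv_near \<delta> h Y Z)"

lemma sol: "norm Y \<le> R \<Longrightarrow> mv_near \<delta> h Y (sol Y)"
  unfolding sol_def by (rule theI') (rule unique)

lemma sol_eq: "norm Y \<le> R \<Longrightarrow> mv_near \<delta> h Y Z \<Longrightarrow> sol Y = Z"
  using unique sol by blast

lemma sol_conj: "norm Y \<le> R \<Longrightarrow> cayley_conj Q (sol Y) = Y"
  using sol[of Y] by (simp add: mv_near_def mv_conj_cayley Q_def a_def)

lemma step: "mv_step \<delta> h Y = cayley_conj (\<lambda>X. - Q X) (sol Y)"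
  unfolding mv_step_def sol_def[symmetric] a_def[symmetric] mv_conj_cayley Q_def by simp

lemma sol_bound: "norm Y \<le> R \<Longrightarrow> norm (sol Y) < norm Y + \<delta>"
  using sol[of Y] norm_triangle_sub[of "sol Y" Y] by (simp add: mv_near_def dist_norm)

lemma conj_Q: "cayley_conj Q Z = Z - mv_perturbation a Z"
  using mv_conj_expand(1)[of a Z] by (simp add: mv_conj_cayley Q_def)

lemma sol_lipschitz:
  assumes "norm Y \<le> R" "norm Y' \<le> R"
  shows "norm (sol Y - sol Y') \<le> 2 * norm (Y - Y')"
  using small_perturbation_contract[OF small, of "sol Y" "sol Y'"] sol_bound[OF assms(1)] sol_bound[OF assms(2)]
    sol_conj[OF assms(1)] sol_conj[OF assms(2)] assms unfolding conj_Q by simp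

text \<open>
  By uniqueness: the negative conjugate transpose of the solution solves the same equation.
\<close>

lemma sol_skew:
  assumes "Y \<in> skew_hermitian" "norm Y \<le> R"
  shows "sol Y \<in> skew_hermitian"
proof -
  let ?Z = "- ctranspose (sol Y)"
  have Q: "Q ?Z = - ctranspose (Q (sol Y))" using Q.ct[of "sol Y"] linear_neg[OF Q.lin] by simp
  have "cayley_conj Q ?Z = - ctranspose (cayley_conj Q (sol Y))"
    by (simp add: cayley_conj_def Q ctranspose_mult matrix_ring_simps matrix_mul_assoc)
  then have "cayley_conj Q ?Z = Y" using sol_conj[OF assms(2)] skewD[OF assms(1)] by simp
  moreover have "norm (?Z - Y) = norm (sol Y - Y)"
  proof -
    have "?Z - Y = - ctranspose (sol Y - Y)" using skewD[OF assms(1)] by simp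
    then show ?thesis by (simp only: norm_minus_cancel norm_ctranspose)
  qed
  then have "dist ?Z Y < \<delta>" using sol[OF assms(2)] by (simp add: mv_near_def dist_norm)
  ultimately have "mv_near \<delta> h Y ?Z" by (simp add: mv_near_def mv_conj_cayley Q_def a_def)
  then have "sol Y = ?Z" by (rule sol_eq[OF assms(2)])
  then show ?thesis by (intro skewI) (metis minus_minus)
qed

lemma step_orbit:
  fixes Y :: "'n cmatrix"
  assumes "Y \<in> skew_hermitian" "norm Y \<le> R"
  shows "mv_step \<delta> h Y \<in> unitary_orbit Y"
  using Q.cayley_conj_unitary_orbit[OF sol_skew[OF assms]] by (simp add: step sol_conj assms)

lemma step_skew:
  fixes Y :: "'n cmatrix"
  assumes "Y \<in> skew_hermitian" "norm Y \<le> R"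
  shows "mv_step \<delta> h Y \<in> skew_hermitian"
  unfolding step using sol_skew[OF assms]
  by (intro cayley_conj_skew self_adjoint_stream.skew[OF Q.negative])

text \<open>
  The implicit function theorem, by hand: the inverse of \<open>cayley_conj Q\<close> is Lipschitz
  continuous, and the derivative of \<open>cayley_conj Q\<close> is injective since this map expands
  distances by at least \<open>1/2\<close>.
\<close>

lemma step_derivative:
  assumes "norm Y < R"
  shows "\<exists>\<phi>'. (mv_step \<delta> h has_derivative \<phi>') (at Y) \<and>
     (\<forall>W. \<phi>' (cayley_conj' Q (sol Y) W) = cayley_conj' (\<lambda>X. - Q X) (sol Y) W)"
proof -
  let ?Z = "sol Y" and ?K = "cayley_conj' Q (sol Y)" and ?K2 = "cayley_conj' (\<lambda>X. - Q X) (sol Y)"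
  have YR: "norm Y \<le> R" using assms by simp
  have K: "(cayley_conj Q has_derivative ?K) (at ?Z)" by (rule has_derivative_cayley_conj[OF Q.bounded])
  have Z: "norm ?Z < R + \<delta>" using sol_bound[OF YR] YR by linarith
  have "inj ?K"
  proof (rule derivative_injective_expanding[OF K])
    show "R + \<delta> - norm ?Z > 0" using Z by simp
    show "(1/2 :: real) > 0" by simp
    fix X assume "dist X ?Z < R + \<delta> - norm ?Z"
    then have "norm X \<le> R + \<delta>" using norm_triangle_sub[of X ?Z] by (simp add: dist_norm)
    then show "1/2 * norm (X - ?Z) \<le> norm (cayley_conj Q X - cayley_conj Q ?Z)"
      using small_perturbation_contract[OF small, of X ?Z] Z unfolding conj_Q by simp
  qed
  moreover have "linear ?K" using has_derivative_linear[OF K] .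
  ultimately obtain g' where g': "linear g'" "g' \<circ> ?K = id"
    using linear_injective_left_inverse by blast
  have cont: "continuous (at Y) sol"
    unfolding continuous_at_eps_delta
  proof (intro allI impI)
    fix e :: real assume "e > 0"
    show "\<exists>d>0. \<forall>x'. dist x' Y < d \<longrightarrow> dist (sol x') (sol Y) < e"
    proof (intro exI[of _ "min (e/2) (R - norm Y)"] conjI allI impI)
      show "0 < min (e/2) (R - norm Y)" using \<open>e > 0\<close> assms by simp
      fix X assume X: "dist X Y < min (e/2) (R - norm Y)"
      then have "norm X \<le> R" using norm_triangle_sub[of X Y] by (simp add: dist_norm)
      then show "dist (sol X) (sol Y) < e" using sol_lipschitz[of X Y] YR X by (simp add: dist_norm)
    qed
  qed
  have "(sol has_derivative g') (at Y)"
  proof (rule has_derivative_inverse_basic[OF _ _ g'(2) cont])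
    show "(cayley_conj Q has_derivative ?K) (at (sol Y))" by (rule K)
    show "bounded_linear g'" using g'(1) linear_conv_bounded_linear by blast
    show "open (ball (0 :: 'n cmatrix) R)" by simp
    show "Y \<in> ball 0 R" using assms by simp
    show "cayley_conj Q (sol X) = X" if "X \<in> ball 0 R" for X using that by (intro sol_conj) simp
  qed
  then have "((\<lambda>Y. cayley_conj (\<lambda>X. - Q X) (sol Y)) has_derivative (\<lambda>V. ?K2 (g' V))) (at Y)"
    by (rule has_derivative_compose) (rule has_derivative_cayley_conj[OF bounded_linear_minus[OF Q.bounded]])
  then have "(mv_step \<delta> h has_derivative (\<lambda>V. ?K2 (g' V))) (at Y)"
    by (simp add: step[abs_def])
  moreover have "g' (?K W) = W" for W using g'(2) by (metis comp_apply id_apply)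
  ultimately show ?thesis by (intro exI[of _ "\<lambda>V. ?K2 (g' V)"]) simp
qed

text \<open>
  By the chain rule, the gradients before and after the step are related as in
  \<open>pullback_condition\<close>.
\<close>

lemma step_lie_poisson:
  assumes "\<rho> \<le> R"
  shows "lie_poisson_on {Y :: 'n cmatrix. Y \<in> skew_hermitian \<and> norm Y < \<rho>} (mv_step \<delta> h)"
  unfolding lie_poisson_on_def
proof (intro ballI conjI allI impI)
  let ?D = "{Y :: 'n cmatrix. Y \<in> skew_hermitian \<and> norm Y < \<rho>}" and ?\<phi> = "mv_step \<delta> h"
  fix Y assume "Y \<in> ?D"
  then have Y: "Y \<in> skew_hermitian" "norm Y < \<rho>" "norm Y \<le> R" "norm Y < R" using assms by auto
  obtain \<phi>' where phi: "(?\<phi> has_derivative \<phi>') (at Y)"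
    and phiK: "\<And>W. \<phi>' (cayley_conj' Q (sol Y) W) = cayley_conj' (\<lambda>X. - Q X) (sol Y) W"
    using step_derivative[OF Y(4)] by blast
  show phiY: "?\<phi> Y \<in> skew_hermitian" by (rule step_skew[OF Y(1,3)])
  show "?\<phi> differentiable (at Y within skew_hermitian)"
    using phi by (meson differentiable_def has_derivative_at_withinI)
  have at_eq: "at Y within skew_hermitian = at Y within ?D"
    by (rule at_within_nhd[of _ "ball 0 \<rho>"]) (use Y in auto)
  have grad: "lp_gradient (F \<circ> ?\<phi>) Y \<in> skew_hermitian \<and> lp_gradient F (?\<phi> Y) \<in> skew_hermitian \<and>
      (\<forall>W\<in>skew_hermitian. lp_gradient (F \<circ> ?\<phi>) Y \<bullet> cayley_conj' Q (sol Y) W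
         = lp_gradient F (?\<phi> Y) \<bullet> cayley_conj' (\<lambda>X. - Q X) (sol Y) W)"
    if F: "F differentiable_on skew_hermitian" for F
  proof -
    obtain L where L: "(F has_derivative L) (at (?\<phi> Y) within skew_hermitian)"
      using F phiY unfolding differentiable_on_def differentiable_def by blast
    have "?\<phi> ` ?D \<subseteq> skew_hermitian" using step_skew assms by auto
    then have "(F has_derivative L) (at (?\<phi> Y) within ?\<phi> ` ?D)" using L by (rule has_derivative_subset[rotated])
    then have "((\<lambda>x. F (?\<phi> x)) has_derivative (\<lambda>V. L (\<phi>' V))) (at Y within ?D)"
      by (rule has_derivative_in_compose[OF has_derivative_at_withinI[OF phi]])
    then have FL: "(F \<circ> ?\<phi> has_derivative (\<lambda>V. L (\<phi>' V))) (at Y within skew_hermitian)"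
      unfolding at_eq by (simp add: comp_def)
    have "lp_gradient (F \<circ> ?\<phi>) Y \<bullet> cayley_conj' Q (sol Y) W
         = lp_gradient F (?\<phi> Y) \<bullet> cayley_conj' (\<lambda>X. - Q X) (sol Y) W" if W: "W \<in> skew_hermitian" for W
    proof -
      have sZ: "sol Y \<in> skew_hermitian" by (rule sol_skew[OF Y(1,3)])
      have "cayley_conj' Q (sol Y) W \<in> skew_hermitian"
        by (rule cayley_conj'_skew[OF Q.self_adjoint_stream_axioms sZ W])
      moreover have "cayley_conj' (\<lambda>X. - Q X) (sol Y) W \<in> skew_hermitian"
        by (rule cayley_conj'_skew[OF Q.negative sZ W])
      ultimately show ?thesis
        using lp_gradient(2)[OF Y(1) FL] lp_gradient(2)[OF phiY L] by (simp add: phiK)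
    qed
    then show ?thesis using lp_gradient(1)[OF Y(1) FL] lp_gradient(1)[OF phiY L] by blast
  qed
  fix F G :: "'n cmatrix \<Rightarrow> real"
  assume FG: "F differentiable_on skew_hermitian \<and> G differentiable_on skew_hermitian"
  note F = grad[OF conjunct1[OF FG]] and G = grad[OF conjunct2[OF FG]]
  have "cayley_conj Q (sol Y) \<bullet> (lp_gradient (F \<circ> ?\<phi>) Y ** lp_gradient (G \<circ> ?\<phi>) Y
        - lp_gradient (G \<circ> ?\<phi>) Y ** lp_gradient (F \<circ> ?\<phi>) Y)
      = cayley_conj (\<lambda>X. - Q X) (sol Y) \<bullet> (lp_gradient F (?\<phi> Y) ** lp_gradient G (?\<phi> Y)
        - lp_gradient G (?\<phi> Y) ** lp_gradient F (?\<phi> Y))"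
    by (rule Q.cayley_conj_poisson[OF sol_skew[OF Y(1,3)]]) (use F G in blast)+
  then show "lp_bracket (F \<circ> ?\<phi>) (G \<circ> ?\<phi>) Y = lp_bracket F G (?\<phi> Y)"
    unfolding sol_conj[OF Y(3)] step[symmetric]
    by (simp add: lp_bracket_def bracketN_def)
qed

end

section \<open>Second order of consistency\<close>

text \<open>
  The numerical solution is \<open>y 0 + h f z\<close> exactly, where \<open>z\<close> solves \<open>z = y 0 + (h/2) f z\<close> up to the
  quadratic term, which is of size \<open>O(h\<^sup>2)\<close>.
\<close>

lemma mv_step_order_two:
  fixes \<delta> \<rho> :: real
  assumes N: "2 \<le> CARD('n)" and "\<delta> > 0" "\<rho> > 0"
  shows "zeitlin_order_on 2 {Y :: 'n::{finite,linorder} cmatrix. Y \<in> skew_hermitian \<and> norm Y < \<rho>} (mv_step \<delta>)"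
proof -
  define \<h> where "\<h> = hbar CARD('n)"
  have "\<h> > 0" using hbar_pos[OF N] by (simp add: \<h>_def)
  define b where "b X Y = (1/\<h>) *\<^sub>R (Y ** stream_matrix X - stream_matrix X ** Y)" for X Y :: "'n cmatrix"
  have bb: "bounded_bilinear b"
    unfolding bilinear_conv_bounded_bilinear[symmetric] bilinear_def b_def
    by (auto intro!: linearI simp: matrix_ring_simps linear_add[OF linear_stream_matrix]
        linear_scale[OF linear_stream_matrix] algebra_simps)
  obtain K where K: "K \<ge> 0" "\<And>x y. norm (b x y) \<le> norm x * norm y * K"
    using bounded_bilinear.nonneg_bounded[OF bb] by blast
  obtain a0 where "a0 > 0" and a0: "\<And>a. \<bar>a\<bar> < a0 \<Longrightarrow> small_perturbation (\<rho> + \<delta>) \<delta> (mv_perturbation a :: 'n cmatrix \<Rightarrow> _)"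
    using mv_perturbation_small[OF \<open>\<delta> > 0\<close>] by blast
  define R where "R = 2 * \<rho> + \<delta>"
  obtain B where B: "B > 0" "\<And>Z :: 'n cmatrix. norm Z \<le> R \<Longrightarrow> norm (mv_quadratic_part Z) \<le> B"
    using lipschitz_on_balls_bounded[OF lipschitz_mv_quadratic_part, of R] by blast
  define c where "c = B / (4 * \<h>\<^sup>2)"
  have "c \<ge> 0" "R \<ge> 0" using B assms by (simp_all add: c_def R_def)
  obtain C where C: "\<And>h y z. 0 < h \<Longrightarrow> h \<le> 1 \<Longrightarrow>
     (\<And>s. s \<in> {0..h} \<Longrightarrow> (y has_vector_derivative b (y s) (y s)) (at s within {0..h})) \<Longrightarrow>
     (\<And>s. s \<in> {0..h} \<Longrightarrow> norm (y s) \<le> R) \<Longrightarrow> norm z \<le> R \<Longrightarrow>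
     norm (z - y 0 - (h/2) *\<^sub>R b z z) \<le> c * h\<^sup>2 \<Longrightarrow>
     norm (y 0 + h *\<^sub>R b z z - y h) \<le> C * h ^ 3"
    using midpoint_local_error[OF bb K \<open>R \<ge> 0\<close> \<open>c \<ge> 0\<close>] by blast
  \<comment> \<open>The second bound makes the scheme solvable, the third keeps the flow within twice the radius.\<close>
  define h0 where "h0 = min 1 (min (2 * \<h> * a0) (\<rho> / (4 * \<rho>\<^sup>2 * K + 1)))"
  have den: "4 * \<rho>\<^sup>2 * K + 1 > 0" using K(1) by (intro add_nonneg_pos) auto
  have "h0 > 0" using \<open>\<h> > 0\<close> \<open>a0 > 0\<close> \<open>\<rho> > 0\<close> den by (simp add: h0_def)
  moreover have "norm (mv_step \<delta> h (y 0) - y h) \<le> C * h ^ (2 + 1)"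
    if h: "0 < h" "h < h0" and y: "zeitlin_solution h y" and y0: "norm (y 0) < \<rho>" for h and y :: "real \<Rightarrow> 'n cmatrix"
  proof -
    define a where "a = h / (2 * \<h>)"
    have a: "\<bar>a\<bar> < a0" using h \<open>\<h> > 0\<close> by (simp add: a_def h0_def pos_divide_less_eq mult.commute mult.left_commute)
    interpret mv_small_step h \<delta> \<rho> a "\<lambda>X :: 'n cmatrix. a *\<^sub>R stream_matrix X"
      by unfold_locales (use a0[OF a] \<open>\<delta> > 0\<close> in \<open>simp_all add: a_def \<h>_def\<close>)
    define z where "z = sol (y 0)"
    have near: "dist z (y 0) < \<delta>" "z = y 0 + mv_perturbation a z"
      using sol[of "y 0"] y0 by (simp_all add: mv_near_iff z_def a_def \<h>_def)
    have zR: "norm z \<le> R" using sol_bound[of "y 0"] y0 \<open>\<rho> > 0\<close> by (simp add: z_def R_def)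
    have bz: "(h/2) *\<^sub>R b z z = a *\<^sub>R mv_linear_part z"
      by (simp add: b_def mv_linear_part_def a_def \<h>_def)
    have der: "(y has_vector_derivative b (y s) (y s)) (at s within {0..h})" if "s \<in> {0..h}" for s
    proof -
      have f: "- bracketN (stream_matrix (y s)) (y s) = b (y s) (y s)"
        by (simp add: b_def bracketN_def \<h>_def scaleR_right_diff_distrib)
      have "(y has_vector_derivative - bracketN (stream_matrix (y s)) (y s)) (at s within {0..h})"
        using y that unfolding zeitlin_solution_def by blast
      then show ?thesis unfolding f .
    qed
    have "h * (4 * \<rho>\<^sup>2 * K) \<le> h * (4 * \<rho>\<^sup>2 * K + 1)" using h by (intro mult_left_mono) auto
    also have "\<dots> < \<rho>" using h den by (simp add: h0_def pos_less_divide_eq)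
    finally have "norm (y s) \<le> 2 * \<rho>" if "s \<in> {0..h}" for s
      using bilinear_flow_bounded[OF K der y0] that by simp
    then have yR: "norm (y s) \<le> R" if "s \<in> {0..h}" for s using that \<open>\<delta> > 0\<close> by (fastforce simp: R_def)
    have "z - y 0 - (h/2) *\<^sub>R b z z = a\<^sup>2 *\<^sub>R mv_quadratic_part z"
      using near(2) unfolding bz mv_perturbation_def by (metis add_diff_cancel_left' add_diff_cancel_left)
    then have "norm (z - y 0 - (h/2) *\<^sub>R b z z) \<le> a\<^sup>2 * B"
      using B(2)[OF zR] by (simp add: mult_left_mono)
    also have "a\<^sup>2 * B = c * h\<^sup>2" by (simp add: a_def c_def \<h>_def power_divide power_mult_distrib)
    finally have res: "norm (z - y 0 - (h/2) *\<^sub>R b z z) \<le> c * h\<^sup>2" .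
    have "mv_step \<delta> h (y 0) = z + a *\<^sub>R mv_linear_part z - a\<^sup>2 *\<^sub>R mv_quadratic_part z"
      using step[of "y 0"] mv_conj_expand(2)[of a z] by (simp add: mv_conj_cayley z_def)
    also have "\<dots> = y 0 + (a *\<^sub>R mv_linear_part z + a *\<^sub>R mv_linear_part z)"
    proof -
      have "w + u - q = x + (u + u)" if "w = x + (u + q)" for w x u q :: "'n cmatrix"
        unfolding that by simp
      then show ?thesis using near(2) unfolding mv_perturbation_def .
    qed
    also have "\<dots> = y 0 + h *\<^sub>R b z z" unfolding bz[symmetric]
      by (simp flip: scaleR_add_left)
    finally show ?thesis using C[OF h(1) _ der yR zR res] h by (simp add: h0_def)
  qed
  ultimately show ?thesis unfolding zeitlin_order_on_def by blast
qed

section \<open>The midpoint rule on frames\<close>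

lemma lipschitz_frame_conj:
  "lipschitz_on_balls (\<lambda>U :: complex^'r::finite^'n::finite. U ** S ** ctranspose U)"
  by (intro lipschitz_on_balls_bilinear[OF mm.bounded_bilinear_axioms] lipschitz_on_balls_const
      lipschitz_on_balls_linear[OF bounded_linear_ident] lipschitz_on_balls_linear[OF bounded_linear_ctranspose])

lemma lipschitz_reconstruction_field:
  "lipschitz_on_balls (reconstruction_field S :: ('r::finite, 'n::{finite,linorder}) cframe \<Rightarrow> _)"
proof -
  have "lipschitz_on_balls (\<lambda>U :: ('r, 'n) cframe. (- (1 / hbar CARD('n))) *\<^sub>R
      (stream_matrix (U ** S ** ctranspose U) ** U))"
    by (intro lipschitz_on_balls_compose_linear[OF bounded_linear_scaleR_right]
       lipschitz_on_balls_bilinear[OF mm.bounded_bilinear_axioms]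
       lipschitz_on_balls_compose_linear[OF bounded_linear_stream]
       lipschitz_frame_conj lipschitz_on_balls_linear[OF bounded_linear_ident])
  then show ?thesis by (simp add: reconstruction_field_def[abs_def])
qed

text \<open>
  In terms of the midpoint, the rule is an implicit Euler step of half the size.
\<close>

lemma midpoint_iff:
  fixes u u' :: "'a::real_normed_vector"
  shows "dist u' u < \<delta> \<and> implicit_midpoint_rule f h u u' \<longleftrightarrow>
     dist ((1/2) *\<^sub>R (u' + u)) u < \<delta> / 2 \<and> (1/2) *\<^sub>R (u' + u) = u + (h/2) *\<^sub>R f ((1/2) *\<^sub>R (u' + u))"
proof -
  let ?m = "(1/2) *\<^sub>R (u' + u)"
  have d: "?m - u = (1/2) *\<^sub>R (u' - u)" by (simp add: algebra_simps flip: scaleR_add_left)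
  have "dist ?m u = dist u' u / 2" unfolding dist_norm d by simp
  moreover have "u' - u = h *\<^sub>R f ?m \<longleftrightarrow> ?m - u = (h/2) *\<^sub>R f ?m"
  proof -
    have "(h/2) *\<^sub>R f ?m = (1/2) *\<^sub>R (h *\<^sub>R f ?m)" by simp
    then show ?thesis unfolding d by (metis scaleR_cancel_left zero_neq_numeral divide_eq_0_iff zero_neq_one)
  qed
  ultimately show ?thesis unfolding implicit_midpoint_rule_def by (auto simp: algebra_simps)
qed

lemma midpoint_unique:
  fixes u :: "'a::banach"
  assumes "small_perturbation (R + \<delta>/2) (\<delta>/2) (\<lambda>z. (h/2) *\<^sub>R f z)" "norm u \<le> R" "\<delta> > 0"
  shows "\<exists>!u'. dist u' u < \<delta> \<and> implicit_midpoint_rule f h u u'"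
proof -
  have ex1: "\<exists>!z. dist z u < \<delta>/2 \<and> z = u + (h/2) *\<^sub>R f z"
    by (rule small_perturbation_unique_solution[OF assms(1,2)]) (use assms(3) in simp)
  then obtain z where z: "dist z u < \<delta>/2" "z = u + (h/2) *\<^sub>R f z"
    and uniq: "\<And>w. dist w u < \<delta>/2 \<Longrightarrow> w = u + (h/2) *\<^sub>R f w \<Longrightarrow> w = z" by blast
  have mid_back: "(1/2) *\<^sub>R (2 *\<^sub>R z - u + u) = z" by simp
  show ?thesis unfolding midpoint_iff
  proof (intro ex1I[of _ "2 *\<^sub>R z - u"])
    show "dist ((1/2) *\<^sub>R (2 *\<^sub>R z - u + u)) u < \<delta> / 2 \<and>
      (1/2) *\<^sub>R (2 *\<^sub>R z - u + u) = u + (h/2) *\<^sub>R f ((1/2) *\<^sub>R (2 *\<^sub>R z - u + u))"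
      unfolding mid_back using z by simp
    fix u' assume "dist ((1/2) *\<^sub>R (u' + u)) u < \<delta> / 2 \<and> (1/2) *\<^sub>R (u' + u) = u + (h/2) *\<^sub>R f ((1/2) *\<^sub>R (u' + u))"
    then have "(1/2) *\<^sub>R (u' + u) = z" using uniq by blast
    then have "2 *\<^sub>R z = u' + u" by (simp flip: \<open>(1/2) *\<^sub>R (u' + u) = z\<close>)
    then show "u' = 2 *\<^sub>R z - u" by simp
  qed
qed

text \<open>
  Since \<open>U' - U = - 2 K m\<close> and \<open>U' + U = 2 m\<close>, the two ends of the step are \<open>(I \<plusminus> K) m\<close>.
  The columns stay orthonormal because \<open>(I + K) (I - K) = (I - K) (I + K)\<close>.
\<close>

lemma midpoint_frames:
  fixes U U' :: "('r::finite, 'n::{finite,linorder}) cframe"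
  assumes S: "S \<in> skew_hermitian"
    and mid: "implicit_midpoint_rule (reconstruction_field S) h U U'"
  defines "m \<equiv> (1/2) *\<^sub>R (U' + U)" and "a \<equiv> h / (2 * hbar CARD('n))"
  defines "Z \<equiv> m ** S ** ctranspose m"
  shows "mv_conj a Z = U ** S ** ctranspose U" and "mv_conj (- a) Z = U' ** S ** ctranspose U'"
    and "ctranspose U' ** U' = ctranspose U ** U"
proof -
  define K where "K = a *\<^sub>R stream_matrix Z"
  interpret self_adjoint_stream "\<lambda>X :: 'n cmatrix. a *\<^sub>R stream_matrix X" by (rule scaled_stream_self_adjoint)
  have "Z \<in> skew_hermitian" unfolding Z_def by (rule frame_conj_skew[OF S])
  then have cK: "ctranspose K = - K" unfolding K_def by (intro skewD skew)
  have "U' - U = h *\<^sub>R reconstruction_field S m"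
    using mid by (simp add: implicit_midpoint_rule_def m_def)
  also have "\<dots> = - (2 *\<^sub>R (K ** m))"
    by (simp add: reconstruction_field_def K_def a_def Z_def matrix_ring_simps)
  finally have d: "U' - U = - (2 *\<^sub>R (K ** m))" .
  have s: "U' + U = 2 *\<^sub>R m" by (simp add: m_def)
  have "2 *\<^sub>R U = (U' + U) - (U' - U)" by (simp add: scaleR_2)
  also have "\<dots> = 2 *\<^sub>R (m + K ** m)" unfolding s d by (simp add: scaleR_add_right)
  finally have U: "U = (mat 1 + K) ** m" by (simp add: matrix_ring_simps)
  have "2 *\<^sub>R U' = (U' + U) + (U' - U)" by (simp add: scaleR_2)
  also have "\<dots> = 2 *\<^sub>R (m - K ** m)" unfolding s d by (simp add: scaleR_diff_right)
  finally have U': "U' = (mat 1 - K) ** m" by (simp add: matrix_ring_simps)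
  show "mv_conj a Z = U ** S ** ctranspose U"
    unfolding mv_conj_def K_def[symmetric] U by (simp add: Z_def ctranspose_mult cK matrix_mul_assoc)
  show "mv_conj (- a) Z = U' ** S ** ctranspose U'"
    unfolding mv_conj_def scaleR_minus_left K_def[symmetric] U'
    by (simp add: Z_def ctranspose_mult cK matrix_mul_assoc)
  have "ctranspose U' ** U' = ctranspose m ** ((mat 1 + K) ** (mat 1 - K)) ** m"
    unfolding U' by (simp add: ctranspose_mult cK matrix_mul_assoc)
  also have "(mat 1 + K) ** (mat 1 - K) = (mat 1 - K) ** (mat 1 + K)" by (simp add: matrix_ring_simps)
  also have "ctranspose m ** \<dots> ** m = ctranspose U ** U"
    unfolding U by (simp add: ctranspose_mult cK matrix_mul_assoc)
  finally show "ctranspose U' ** U' = ctranspose U ** U" .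
qed

lemma leading_eigendata_skew:
  assumes W: "W \<in> skew_hermitian" and lead: "leading_eigendata W S U"
  shows "S \<in> skew_hermitian" "U \<in> stiefel"
proof -
  obtain V d e where V: "V \<in> unitary_matrices" and WV: "W ** V = V ** diagonal_matrix d"
    and e: "inj e" and S: "S = diagonal_matrix (\<lambda>k. d (e k))" and U: "U = (\<chi> i k. V $ i $ e k)"
    using lead unfolding leading_eigendata_def by blast
  have V1: "ctranspose V ** V = mat 1" using V by (simp add: unitary_matrices_def)
  have "diagonal_matrix d = ctranspose V ** W ** V"
    by (metis WV V1 matrix_mul_assoc matrix_mul_lid)
  then have "ctranspose (diagonal_matrix d) = - diagonal_matrix d"
    by (simp add: ctranspose_mult skewD[OF W] matrix_ring_simps matrix_mul_assoc)
  then have "ctranspose (diagonal_matrix d) $ j $ j = (- diagonal_matrix d) $ j $ j" for j by simp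
  then have "cnj (d j) = - d j" for j
    by (simp add: ctranspose_def diagonal_matrix_def)
  then show "S \<in> skew_hermitian"
    by (intro skewI) (simp add: S vec_eq_iff ctranspose_def diagonal_matrix_def)
  have "(ctranspose U ** U) $ k $ l = (ctranspose V ** V) $ e k $ e l" for k l
    by (simp add: U matrix_matrix_mult_def ctranspose_def)
  then show "U \<in> stiefel"
    unfolding stiefel_def V1 by (simp add: vec_eq_iff mat_def inj_eq[OF e])
qed

lemma unitary_orbit_refl: "Y \<in> unitary_orbit Y"
  unfolding unitary_orbit_def unitary_matrices_def
  by (auto intro!: exI[of _ "mat 1"])

lemma unitary_orbit_trans: "X \<in> unitary_orbit Y \<Longrightarrow> Y \<in> unitary_orbit Z \<Longrightarrow> X \<in> unitary_orbit Z"
proof -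
  assume "X \<in> unitary_orbit Y" "Y \<in> unitary_orbit Z"
  then obtain R R' where R: "ctranspose R ** R = mat 1" "X = R ** Y ** ctranspose R"
    and R': "ctranspose R' ** R' = mat 1" "Y = R' ** Z ** ctranspose R'"
    unfolding unitary_orbit_def unitary_matrices_def by blast
  have "ctranspose (R ** R') ** (R ** R') = ctranspose R' ** (ctranspose R ** R) ** R'"
    by (simp add: ctranspose_mult matrix_mul_assoc)
  then have "R ** R' \<in> unitary_matrices" by (simp add: unitary_matrices_def R R')
  moreover have "X = (R ** R') ** Z ** ctranspose (R ** R')"
    by (simp add: R(2) R'(2) ctranspose_mult matrix_mul_assoc)
  ultimately show "X \<in> unitary_orbit Z" unfolding unitary_orbit_def by blast
qed

lemma midpoint_small:
  fixes S :: "complex^'r::finite^'r"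
  assumes "\<delta> > 0"
  shows "\<exists>a0>0. \<forall>h. \<bar>h\<bar> < a0 \<longrightarrow> small_perturbation (sqrt (real CARD('r)) + \<delta>/2) (\<delta>/2)
     (\<lambda>U :: ('r, 'n::{finite,linorder}) cframe. (h/2) *\<^sub>R reconstruction_field S U)"
proof -
  obtain a0 where "a0 > 0" and a0: "\<And>a. \<bar>a\<bar> < a0 \<Longrightarrow> small_perturbation (sqrt (real CARD('r)) + \<delta>/2) (\<delta>/2)
     (\<lambda>U :: ('r, 'n) cframe. a *\<^sub>R reconstruction_field S U + a\<^sup>2 *\<^sub>R 0)"
    using small_perturbation_small_step[OF lipschitz_reconstruction_field lipschitz_on_balls_const half_gt_zero[OF assms]]
    by blast
  show ?thesis
    by (rule exI[of _ "2 * a0"]) (use \<open>a0 > 0\<close> a0 in \<open>force simp: abs_divide\<close>)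
qed

text \<open>
  Applied to \<open>c = hbar N\<close>.  For one-by-one matrices this constant comes out as \<open>0\<close>, and so does
  the quotient.
\<close>

lemma step_size_small:
  assumes "a0 > (0::real)"
  shows "\<exists>h0>0. \<forall>h. 0 < h \<and> h < h0 \<longrightarrow> \<bar>h / (2 * c)\<bar> < a0"
proof (cases "c = 0")
  case True
  then show ?thesis using assms by (intro exI[of _ 1]) simp
next
  case False
  then show ?thesis using assms
    by (intro exI[of _ "2 * a0 * \<bar>c\<bar>"]) (simp add: abs_mult pos_divide_less_eq mult.left_commute mult.commute)
qed

lemma mv_step_isospectral_lie_poisson:
  fixes \<delta> \<rho> :: real
  assumes \<delta>: "\<delta> > 0"
  defines "D \<equiv> {Y :: 'n::{finite,linorder} cmatrix. Y \<in> skew_hermitian \<and> norm Y < \<rho>}"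
  shows "\<exists>h0>0. \<forall>h. 0 < h \<and> h < h0 \<longrightarrow>
     (\<forall>Y\<in>D. \<exists>!Z. mv_near \<delta> h Y Z) \<and> isospectral_on D (mv_step \<delta> h) \<and> lie_poisson_on D (mv_step \<delta> h)"
proof -
  obtain a0 where "a0 > 0" and a0: "\<And>a. \<bar>a\<bar> < a0 \<Longrightarrow> small_perturbation (\<rho> + \<delta>) \<delta> (mv_perturbation a :: 'n cmatrix \<Rightarrow> _)"
    using mv_perturbation_small[OF \<delta>] by blast
  obtain h0 where "h0 > 0" and h0: "\<And>h. 0 < h \<Longrightarrow> h < h0 \<Longrightarrow> \<bar>h / (2 * hbar CARD('n))\<bar> < a0"
    using step_size_small[OF \<open>a0 > 0\<close>] by metis
  have "(\<forall>Y\<in>D. \<exists>!Z. mv_near \<delta> h Y Z) \<and> isospectral_on D (mv_step \<delta> h) \<and> lie_poisson_on D (mv_step \<delta> h)"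
    if h: "0 < h" "h < h0" for h
  proof -
    define a where "a = h / (2 * hbar CARD('n))"
    interpret mv_small_step h \<delta> \<rho> a "\<lambda>X :: 'n cmatrix. a *\<^sub>R stream_matrix X"
      by unfold_locales (use a0 h0[OF h] \<delta> in \<open>simp_all add: a_def\<close>)
    have D: "norm Y \<le> \<rho>" "Y \<in> skew_hermitian" if "Y \<in> D" for Y using that by (auto simp: D_def)
    have "\<forall>Y\<in>D. \<exists>!Z. mv_near \<delta> h Y Z" using unique D(1) by blast
    moreover have "isospectral_on D (mv_step \<delta> h)"
      unfolding isospectral_on_def using step_orbit D by blast
    moreover have "lie_poisson_on D (mv_step \<delta> h)" unfolding D_def by (rule step_lie_poisson) simp
    ultimately show ?thesis by blast
  qed
  then show ?thesis using \<open>h0 > 0\<close> by blast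
qed

text \<open>
  The midpoints of all steps from the Stiefel manifold stay in a ball, so the matrices \<open>m S m\<^sup>*\<close>
  stay in a ball of some radius \<open>R\<close>, and there the equation of Modin and Viviani has only one
  solution nearby.
\<close>

lemma midpoint_step_descends:
  fixes S :: "complex^'r::finite^'r"
  assumes S: "S \<in> skew_hermitian" and \<delta>: "\<delta> > 0"
  shows "\<exists>h0>0. \<forall>h. 0 < h \<and> h < h0 \<longrightarrow>
     (\<forall>U\<in>(stiefel :: (('r, 'n::{finite,linorder}) cframe) set). \<exists>!U'. midpoint_near \<delta> S h U U') \<and>
     descends_to S (midpoint_step \<delta> S h) (mv_step \<delta> h :: 'n cmatrix \<Rightarrow> _)"
proof -
  define r where "r = sqrt (real CARD('r))"
  obtain B where B: "B > 0" "\<And>U :: ('r, 'n) cframe. norm U \<le> r + \<delta> \<Longrightarrow> norm (U ** S ** ctranspose U) \<le> B"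
    using lipschitz_on_balls_bounded[OF lipschitz_frame_conj, of "r + \<delta>" S] by blast
  define R where "R = max (norm S) B"
  obtain a0 where "a0 > 0" and a0: "\<And>a. \<bar>a\<bar> < a0 \<Longrightarrow> small_perturbation (R + \<delta>) \<delta> (mv_perturbation a :: 'n cmatrix \<Rightarrow> _)"
    using mv_perturbation_small[OF \<delta>] by blast
  obtain h1 where "h1 > 0" and h1: "\<And>h. 0 < h \<Longrightarrow> h < h1 \<Longrightarrow> \<bar>h / (2 * hbar CARD('n))\<bar> < a0"
    using step_size_small[OF \<open>a0 > 0\<close>] by metis
  obtain h2 where "h2 > 0" and h2: "\<And>h. \<bar>h\<bar> < h2 \<Longrightarrow> small_perturbation (r + \<delta>/2) (\<delta>/2)
     (\<lambda>U :: ('r, 'n) cframe. (h/2) *\<^sub>R reconstruction_field S U)"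
    using midpoint_small[OF \<delta>] unfolding r_def by blast
  have "(\<forall>U\<in>(stiefel :: (('r, 'n) cframe) set). \<exists>!U'. midpoint_near \<delta> S h U U') \<and>
     descends_to S (midpoint_step \<delta> S h) (mv_step \<delta> h :: 'n cmatrix \<Rightarrow> _)"
    if h: "0 < h" "h < min h1 h2" for h
  proof -
    define a where "a = h / (2 * hbar CARD('n))"
    interpret mv_small_step h \<delta> R a "\<lambda>X :: 'n cmatrix. a *\<^sub>R stream_matrix X"
      by unfold_locales (use a0 h1[of h] h \<delta> in \<open>simp_all add: a_def\<close>)
    have mid: "\<exists>!U'. midpoint_near \<delta> S h U U'" if "U \<in> stiefel" for U :: "('r, 'n) cframe"
      unfolding midpoint_near_def
      by (rule midpoint_unique[OF _ _ \<delta>, of r]) (use h2[of h] h norm_stiefel[OF that] in \<open>simp_all add: r_def\<close>)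
    have step_frame: "midpoint_step \<delta> S h U \<in> stiefel \<and>
        mv_step \<delta> h (U ** S ** ctranspose U) = midpoint_step \<delta> S h U ** S ** ctranspose (midpoint_step \<delta> S h U)"
      if U: "U \<in> stiefel" for U :: "('r, 'n) cframe"
    proof -
      define U' where "U' = midpoint_step \<delta> S h U"
      have near: "midpoint_near \<delta> S h U U'"
        unfolding U'_def midpoint_step_def by (rule theI'[OF mid[OF U]])
      have UR: "norm (U ** S ** ctranspose U) \<le> R" using norm_frame_conj[OF U, of S] by (simp add: R_def)
      define m where "m = (1/2) *\<^sub>R (U' + U)"
      define Z where "Z = m ** S ** ctranspose m"
      note frames = midpoint_frames[OF S, of h U U', folded m_def a_def, folded Z_def]
      have rule: "implicit_midpoint_rule (reconstruction_field S) h U U'" and d: "dist U' U < \<delta>"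
        using near by (simp_all add: midpoint_near_def)
      have Y: "mv_conj a Z = U ** S ** ctranspose U" and Y': "mv_conj (- a) Z = U' ** S ** ctranspose U'"
        and U'U: "ctranspose U' ** U' = ctranspose U ** U"
        using frames[OF rule] by simp_all
      have "norm m \<le> (norm U' + norm U) / 2" unfolding m_def using norm_triangle_ineq[of U' U] by simp
      moreover have "norm U' \<le> norm U + \<delta>" using d norm_triangle_sub[of U' U] by (simp add: dist_norm)
      ultimately have "norm m \<le> r + \<delta>" using norm_stiefel[OF U] \<delta> by (simp add: r_def)
      then have "norm Z \<le> R" using B(2)[of m] by (simp add: Z_def R_def)
      then have "norm (mv_perturbation a Z) < \<delta>" using small \<delta> by (simp add: small_perturbation_def)
      then have "dist Z (U ** S ** ctranspose U) < \<delta>"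
        unfolding Y[symmetric] mv_conj_expand dist_norm by simp
      then have "mv_near \<delta> h (U ** S ** ctranspose U) Z"
        using Y by (simp add: mv_near_def a_def)
      then have "sol (U ** S ** ctranspose U) = Z" by (rule sol_eq[OF UR])
      then have "mv_step \<delta> h (U ** S ** ctranspose U) = U' ** S ** ctranspose U'"
        using Y' by (simp add: step mv_conj_cayley)
      moreover have "U' \<in> stiefel" using U U'U by (simp add: stiefel_def)
      ultimately show ?thesis by (simp add: U'_def)
    qed
    then show ?thesis unfolding descends_to_def using mid by blast
  qed
  then show ?thesis using \<open>h1 > 0\<close> \<open>h2 > 0\<close> by (intro exI[of _ "min h1 h2"]) simp
qed

theorem proposition4p2:
  fixes W0 Y0 :: "'n::{finite,linorder} cmatrix"
    and S0 :: "complex^'r::finite^'r"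
    and U0 :: "('r, 'n::{finite,linorder}) cframe"
  assumes "2 \<le> CARD('n)"
    and "CARD('r) \<le> CARD('n)"
    and "W0 \<in> traceless_skew_hermitian"
    and "leading_eigendata W0 S0 U0"
    and "Y0 = U0 ** S0 ** ctranspose U0"
  shows "is_best_rank_approximation CARD('r) W0 Y0 \<and>
    (\<forall>\<delta>>0. \<forall>\<rho>>norm Y0.
       let D = {Y \<in> skew_hermitian. norm Y < \<rho>} in
       zeitlin_order_on 2 D (mv_step \<delta>) \<and>
       (\<exists>h0>0. \<forall>h. 0 < h \<and> h < h0 \<longrightarrow>
          (\<forall>U\<in>(stiefel :: (('r, 'n::{finite,linorder}) cframe) set). \<exists>!U'. midpoint_near \<delta> S0 h U U') \<and>
          (\<forall>Y\<in>D. \<exists>!Yt. mv_near \<delta> h Y Yt) \<and>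
          isospectral_on D (mv_step \<delta> h) \<and>
          lie_poisson_on D (mv_step \<delta> h) \<and>
          descends_to S0 (midpoint_step \<delta> S0 h) (mv_step \<delta> h) \<and>
          (\<forall>U Y. U 0 = U0 \<and> (\<forall>\<tau>. U (Suc \<tau>) = midpoint_step \<delta> S0 h (U \<tau>)) \<and>
                 (\<forall>\<tau>::nat. Y \<tau> = U \<tau> ** S0 ** ctranspose (U \<tau>)) \<longrightarrow>
             Y 0 = Y0 \<and>
             (\<forall>\<tau>. U \<tau> \<in> stiefel \<and> Y \<tau> \<in> D \<and> Y \<tau> \<in> unitary_orbit Y0 \<and>
                   Y (Suc \<tau>) = mv_step \<delta> h (Y \<tau>)))))"
proof (intro conjI allI impI, unfold Let_def)
  show "is_best_rank_approximation CARD('r) W0 Y0"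
    unfolding assms(5) by (rule best_rank_approximation_leading_eigendata[OF assms(4)])
next
  fix \<delta> \<rho> :: real assume \<delta>: "\<delta> > 0" and \<rho>: "norm Y0 < \<rho>"
  let ?D = "{Y :: 'n cmatrix. Y \<in> skew_hermitian \<and> norm Y < \<rho>}"
  have W0: "W0 \<in> skew_hermitian" using assms(3) by (simp add: traceless_skew_hermitian_def)
  have S0: "S0 \<in> skew_hermitian" and U0: "U0 \<in> stiefel" by (rule leading_eigendata_skew[OF W0 assms(4)])+
  have "\<rho> > 0" using \<rho> norm_ge_zero[of Y0] by linarith
  have frameD: "U ** S0 ** ctranspose U \<in> ?D" if "U \<in> stiefel" for U :: "('r, 'n) cframe"
    using that U0 \<rho> by (simp add: norm_frame_conj assms(5) frame_conj_skew[OF S0])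
  obtain h1 where h1: "h1 > 0 \<and> (\<forall>h. 0 < h \<and> h < h1 \<longrightarrow> (\<forall>Y\<in>?D. \<exists>!Z. mv_near \<delta> h Y Z) \<and>
      isospectral_on ?D (mv_step \<delta> h) \<and> lie_poisson_on ?D (mv_step \<delta> h))"
    using mv_step_isospectral_lie_poisson[OF \<delta>] by (rule exE)
  obtain h2 where h2: "h2 > 0 \<and> (\<forall>h. 0 < h \<and> h < h2 \<longrightarrow>
      (\<forall>U\<in>(stiefel :: (('r, 'n) cframe) set). \<exists>!U'. midpoint_near \<delta> S0 h U U') \<and>
      descends_to S0 (midpoint_step \<delta> S0 h) (mv_step \<delta> h :: 'n cmatrix \<Rightarrow> _))"
    using midpoint_step_descends[OF S0 \<delta>] by (rule exE)
  \<comment> \<open>In the clause on descent the number of rows of the frames is independent of \<open>N\<close>, whence a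
    second use of \<open>midpoint_step_descends\<close>; the statement on iterates needs the case of \<open>N\<close> rows.\<close>
  obtain h3 where h3: "h3 > 0 \<and> (\<forall>h. 0 < h \<and> h < h3 \<longrightarrow>
      (\<forall>U\<in>(stiefel :: (('r, 'a::{finite,linorder}) cframe) set). \<exists>!U'. midpoint_near \<delta> S0 h U U') \<and>
      descends_to S0 (midpoint_step \<delta> S0 h) (mv_step \<delta> h :: 'a cmatrix \<Rightarrow> _))"
    using midpoint_step_descends[OF S0 \<delta>] by (rule exE)
  note iso = mp[OF spec[OF conjunct2[OF h1]], OF conjI] and mid = mp[OF spec[OF conjunct2[OF h2]], OF conjI]
    and desc = conjunct2[OF mp[OF spec[OF conjunct2[OF h3]], OF conjI]]
  have iterate: "Y 0 = Y0 \<and> (\<forall>\<tau>. U \<tau> \<in> stiefel \<and> Y \<tau> \<in> ?D \<and> Y \<tau> \<in> unitary_orbit Y0 \<and>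
                   Y (Suc \<tau>) = mv_step \<delta> h (Y \<tau>))"
    if h: "0 < h" "h < min h1 h2"
      and *: "U 0 = U0" "\<And>\<tau>. U (Suc \<tau>) = midpoint_step \<delta> S0 h (U \<tau>)"
        "\<And>\<tau>::nat. Y \<tau> = U \<tau> ** S0 ** ctranspose (U \<tau>)" for h U Y
  proof -
    have step: "midpoint_step \<delta> S0 h V \<in> stiefel \<and> mv_step \<delta> h (V ** S0 ** ctranspose V)
        = midpoint_step \<delta> S0 h V ** S0 ** ctranspose (midpoint_step \<delta> S0 h V)"
      if "V \<in> stiefel" for V :: "('r, 'n) cframe"
      using conjunct2[OF mid[of h]] h that unfolding descends_to_def by simp
    have st: "U \<tau> \<in> stiefel" for \<tau> by (induction \<tau>) (use * U0 step in auto)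
    have D: "Y \<tau> \<in> ?D" for \<tau> unfolding * by (rule frameD[OF st])
    have Suc: "Y (Suc \<tau>) = mv_step \<delta> h (Y \<tau>)" for \<tau> using step[OF st[of \<tau>]] * by simp
    have Y0: "Y 0 = Y0" using * assms(5) by simp
    have "Y \<tau> \<in> unitary_orbit Y0" for \<tau>
    proof (induction \<tau>)
      case 0
      then show ?case by (simp add: Y0 unitary_orbit_refl)
    next
      case (Suc \<tau>)
      have "Y (Suc \<tau>) \<in> unitary_orbit (Y \<tau>)"
        using conjunct1[OF conjunct2[OF iso[of h]]] h D[of \<tau>]
        unfolding \<open>\<And>\<tau>. Y (Suc \<tau>) = mv_step \<delta> h (Y \<tau>)\<close> isospectral_on_def by simp
      then show ?case using Suc.IH by (rule unitary_orbit_trans)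
    qed
    then show ?thesis using Y0 st D Suc by blast
  qed
  have order: "zeitlin_order_on 2 ?D (mv_step \<delta>)" by (rule mv_step_order_two[OF assms(1) \<delta> \<open>\<rho> > 0\<close>])
  have "min h1 (min h2 h3) > 0" using h1 h2 h3 by simp
  then show "zeitlin_order_on 2 ?D (mv_step \<delta>) \<and> (\<exists>h0>0. \<forall>h. 0 < h \<and> h < h0 \<longrightarrow>
          (\<forall>U\<in>(stiefel :: (('r, 'n) cframe) set). \<exists>!U'. midpoint_near \<delta> S0 h U U') \<and>
          (\<forall>Y\<in>?D. \<exists>!Yt. mv_near \<delta> h Y Yt) \<and>
          isospectral_on ?D (mv_step \<delta> h) \<and>
          lie_poisson_on ?D (mv_step \<delta> h) \<and>
          descends_to S0 (midpoint_step \<delta> S0 h) (mv_step \<delta> h :: 'a cmatrix \<Rightarrow> _) \<and>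
          (\<forall>U Y. U 0 = U0 \<and> (\<forall>\<tau>. U (Suc \<tau>) = midpoint_step \<delta> S0 h (U \<tau>)) \<and>
                 (\<forall>\<tau>::nat. Y \<tau> = U \<tau> ** S0 ** ctranspose (U \<tau>)) \<longrightarrow>
             Y 0 = Y0 \<and>
             (\<forall>\<tau>. U \<tau> \<in> stiefel \<and> Y \<tau> \<in> ?D \<and> Y \<tau> \<in> unitary_orbit Y0 \<and>
                   Y (Suc \<tau>) = mv_step \<delta> h (Y \<tau>))))"
  proof (intro conjI[OF order] exI[of _ "min h1 (min h2 h3)"] conjI[of "_ < _"] allI impI)
    fix h assume "0 < h \<and> h < min h1 (min h2 h3)"
    then have h: "0 < h" "h < h1" "h < h2" "h < h3" by auto
    note iso = iso[OF h(1,2)] and mid = mid[OF h(1,3)] and desc = desc[OF h(1,4)]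
    show "(\<forall>U\<in>(stiefel :: (('r, 'n) cframe) set). \<exists>!U'. midpoint_near \<delta> S0 h U U') \<and>
          (\<forall>Y\<in>?D. \<exists>!Yt. mv_near \<delta> h Y Yt) \<and>
          isospectral_on ?D (mv_step \<delta> h) \<and>
          lie_poisson_on ?D (mv_step \<delta> h) \<and>
          descends_to S0 (midpoint_step \<delta> S0 h) (mv_step \<delta> h :: 'a cmatrix \<Rightarrow> _) \<and>
          (\<forall>U Y. U 0 = U0 \<and> (\<forall>\<tau>. U (Suc \<tau>) = midpoint_step \<delta> S0 h (U \<tau>)) \<and>
                 (\<forall>\<tau>::nat. Y \<tau> = U \<tau> ** S0 ** ctranspose (U \<tau>)) \<longrightarrow>
             Y 0 = Y0 \<and>
             (\<forall>\<tau>. U \<tau> \<in> stiefel \<and> Y \<tau> \<in> ?D \<and> Y \<tau> \<in> unitary_orbit Y0 \<and>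
                   Y (Suc \<tau>) = mv_step \<delta> h (Y \<tau>)))"
      by (rule conjI[OF conjunct1[OF mid] conjI[OF conjunct1[OF iso] conjI[OF conjunct1[OF conjunct2[OF iso]]
            conjI[OF conjunct2[OF conjunct2[OF iso]] conjI[OF desc]]]]],
          intro allI impI, rule iterate[of h]) (use h in auto)
  qed
qed

end
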